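(* Let $k>0$, $b>0$, and suppose that the point $C$ lies above the point $A$ on the line $\Gamma$, i.e. $y_C>y_A$. Consider the time-optimal problem with the state constraint $y\ge kx-b$. Then the optimal synthesis is as follows. (i) For starting points in $\Omega_1$ the optimal trajectories are the same as in the free problem (the problem without the state constraint). (ii) For starting points in $\operatorname{int}\Omega_2$ any optimal trajectory is of the following type $N'NCBO$, with control $u=(-1,\,ky,\,-1,\,+1)$: it starts at $N'\in\operatorname{int}\Omega_2$, moves with $u=-1$ to a point $N$ of the open line interval $(C,E)\subset\Gamma$, then moves along $\Gamma$ with $u=ky$ from $N$ to $C$, then with $u=-1$ from $C$ to $B$, and then with $u=+1$ from $B$ to the origin $O$. The measure $d\mu$ in the maximum principle for this trajectory has a unique jump; it is positive and located at the time when the trajectory is at the point $C$. (iii) For starting points lying on the open interval $(C,E)$ of $\Gamma$, the optimal trajectories are the tails of optimal trajectories starting from $\operatorname{int}\Omega_2$ whose first leg is the motion with $u=-1$ to a point on $(C,E)$.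
   Context: Problem: on $[0,T]$ with $T$ free, $\dot x=y$, $\dot y=u$, $x(0)=x_0$, $y(0)=y_0$, $x(T)=0$, $y(T)=0$, $|u|\le 1$, $T\to\min$, under the state constraint $y\ge kx-b$ on $[0,T]$. Controls $u$ are measurable; $x,y$ are Lipschitz. The free problem is the same problem without the state constraint. $O=(0,0)$. $\Gamma$ is the line $y=kx-b$. $S$ is the switching curve of the free problem, the union of the semi-parabolas $x=-\tfrac12y^2,\ y\ge0$ and $x=\tfrac12y^2,\ y\le0$. Characteristic points: $A=(x_A,y_A)$ is the intersection of $\Gamma$ and $S$, with $y_A=\frac{1-\sqrt{2bk+1}}{k}$, $x_A=\frac12y_A^2$; $E=(b/k,0)$; $C$ is the point where $\Gamma$ is tangent to a parabola of the family $x=-\frac12y^2+\mathrm{const}$, namely $C=\left(\frac{kb-1}{k^2},-\frac1k\right)$, the tangent parabola being $x=-\frac12y^2+m$ with $m=\frac{2kb-1}{2k^2}$; $B=(m/2,-\sqrt m)$ is the intersection of this tangent parabola with $S$. Sets: $\Omega_1$ is the closed set of points on the left of $\Gamma$ and of the arc $x=-\frac12y^2+m$, $y\ge -1/k$: that is, all $(x,y)$ with $y\ge kx-b$ and, if $y\ge-1/k$, also $x\le -\frac12y^2+m$. $\Omega_2$ is the closed set bounded by the arc $x=-\frac12y^2+m$ ($y\ge-1/k$), the arc $x=-\frac12y^2+\frac bk$ ($y\ge0$) and the segment $[C,E]$ of $\Gamma$: that is, all $(x,y)$ with $y\ge-1/k$, $x\ge m-\frac12y^2$, and $x\le\frac bk-\frac12y^2$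 if $y\ge0$, $x\le\frac{y+b}{k}$ if $-1/k\le y\le0$. Maximum principle (for a process $(x,y,u)$ on $[0,T]$ with $y_0>kx_0-b$): there exist functions of bounded variation $\varphi,\psi$, continuous from the left and not both identically zero, and a nondecreasing function $\mu$ with $\mu(0)=0$, such that, as equalities between measures, $d\varphi=k\,d\mu$ and $d\psi=-\varphi\,dt-d\mu$; $d\mu(t)\,(y(t)-kx(t)+b)=0$; $\varphi y+\psi u\equiv\mathrm{const}\ge0$; and $u=+1$ where $\psi>0$, $u=-1$ where $\psi<0$, $u\in[-1,1]$ where $\psi=0$ (for a.e. $t$). A jump of the measure is an atom of $d\mu$, i.e. a time $t$ with $\mu(t+0)-\mu(t-0)\neq 0$. *)

theory Defs
  imports "HOL-Analysis.Analysis"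
begin

text \<open>
  A process on \<open>[0,T]\<close> for the double integrator, going from \<open>P\<close> to the origin.
  Duration \<open>T = 0\<close> is allowed, so that the origin itself has an optimal process.
  As usual for measurable controls, conditions on \<open>u\<close> are imposed almost everywhere.
  All functions are total in HOL; only their values on \<open>[0,T]\<close> matter.
\<close>

definition free_process ::
  "real \<times> real \<Rightarrow> real \<Rightarrow> (real \<Rightarrow> real) \<Rightarrow> (real \<Rightarrow> real) \<Rightarrow> (real \<Rightarrow> real) \<Rightarrow> bool" where
  "free_process P T x y u \<longleftrightarrow>
     0 \<le> T \<and>
     u \<in> borel_measurable (lebesgue_on {0..T}) \<and>
     (AE t in lebesgue_on {0..T}. \<bar>u t\<bar> \<le> 1) \<and>
     (\<exists>L. L-lipschitz_on {0..T} x) \<and> (\<exists>L. L-lipschitz_on {0..T} y) \<and>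
     (AE t in lebesgue_on {0..T}. (x has_real_derivative y t) (at t within {0..T})) \<and>
     (AE t in lebesgue_on {0..T}. (y has_real_derivative u t) (at t within {0..T})) \<and>
     (x 0, y 0) = P \<and> (x T, y T) = (0, 0)"

definition constrained_process ::
  "real \<Rightarrow> real \<Rightarrow> real \<times> real \<Rightarrow> real \<Rightarrow> (real \<Rightarrow> real) \<Rightarrow> (real \<Rightarrow> real) \<Rightarrow> (real \<Rightarrow> real) \<Rightarrow> bool" where
  "constrained_process k b P T x y u \<longleftrightarrow>
     free_process P T x y u \<and> (\<forall>t\<in>{0..T}. y t \<ge> k * x t - b)"

definition time_optimal ::
  "(real \<Rightarrow> (real \<Rightarrow> real) \<Rightarrow> (real \<Rightarrow> real) \<Rightarrow> (real \<Rightarrow> real) \<Rightarrow> bool) \<Rightarrow>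
   real \<Rightarrow> (real \<Rightarrow> real) \<Rightarrow> (real \<Rightarrow> real) \<Rightarrow> (real \<Rightarrow> real) \<Rightarrow> bool" where
  "time_optimal adm T x y u \<longleftrightarrow>
     adm T x y u \<and> (\<forall>T' x' y' u'. adm T' x' y' u' \<longrightarrow> T \<le> T')"

abbreviation free_optimal where
  "free_optimal P \<equiv> time_optimal (free_process P)"

abbreviation constrained_optimal where
  "constrained_optimal k b P \<equiv> time_optimal (constrained_process k b P)"

definition is_tail ::
  "real \<Rightarrow> real \<Rightarrow> (real \<Rightarrow> real) \<Rightarrow> (real \<Rightarrow> real) \<Rightarrow> (real \<Rightarrow> real) \<Rightarrow>
   real \<Rightarrow> (real \<Rightarrow> real) \<Rightarrow> (real \<Rightarrow> real) \<Rightarrow> (real \<Rightarrow> real) \<Rightarrow> bool" where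
  "is_tail \<tau> T' x' y' u' T x y u \<longleftrightarrow>
     \<tau> \<in> {0..T'} \<and> T = T' - \<tau> \<and>
     (\<forall>t\<in>{0..T}. x t = x' (\<tau> + t) \<and> y t = y' (\<tau> + t)) \<and>
     (AE t in lebesgue_on {0..T}. u t = u' (\<tau> + t))"

definition boundary_line :: "real \<Rightarrow> real \<Rightarrow> (real \<times> real) set" where
  "boundary_line k b = {(x, y). y = k * x - b}"

definition switching_curve :: "(real \<times> real) set" where
  "switching_curve = {(x, y). x = - (1/2) * y\<^sup>2 \<and> y \<ge> 0} \<union> {(x, y). x = (1/2) * y\<^sup>2 \<and> y \<le> 0}"

definition tangent_const :: "real \<Rightarrow> real \<Rightarrow> real" where
  "tangent_const k b = (2 * k * b - 1) / (2 * k\<^sup>2)"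

definition tangent_parabola :: "real \<Rightarrow> real \<Rightarrow> (real \<times> real) set" where
  "tangent_parabola k b = {(x, y). x = - (1/2) * y\<^sup>2 + tangent_const k b}"

definition point_A :: "real \<Rightarrow> real \<Rightarrow> real \<times> real" where
  "point_A k b = (let y = (1 - sqrt (2 * b * k + 1)) / k in ((1/2) * y\<^sup>2, y))"

definition point_B :: "real \<Rightarrow> real \<Rightarrow> real \<times> real" where
  "point_B k b = (tangent_const k b / 2, - sqrt (tangent_const k b))"

definition point_C :: "real \<Rightarrow> real \<Rightarrow> real \<times> real" where
  "point_C k b = ((k * b - 1) / k\<^sup>2, - 1 / k)"

definition point_E :: "real \<Rightarrow> real \<Rightarrow> real \<times> real" where
  "point_E k b = (b / k, 0)"

definition Omega1 :: "real \<Rightarrow> real \<Rightarrow> (real \<times> real) set" where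
  "Omega1 k b = {(x, y). y \<ge> k * x - b \<and>
                         (y \<ge> - 1 / k \<longrightarrow> x \<le> - (1/2) * y\<^sup>2 + tangent_const k b)}"

definition Omega2 :: "real \<Rightarrow> real \<Rightarrow> (real \<times> real) set" where
  "Omega2 k b = {(x, y). y \<ge> - 1 / k \<and> x \<ge> tangent_const k b - (1/2) * y\<^sup>2 \<and>
                         (y \<ge> 0 \<longrightarrow> x \<le> b / k - (1/2) * y\<^sup>2) \<and>
                         (- 1 / k \<le> y \<and> y \<le> 0 \<longrightarrow> x \<le> (y + b) / k)}"

lemma boundary_line_Int_switching_curve:
  assumes "k > 0" "b > 0"
  shows "boundary_line k b \<inter> switching_curve = {point_A k b}"
proof -
  define s where "s = sqrt (2 * b * k + 1)"
  have s2: "s\<^sup>2 = 2 * b * k + 1" and s1: "s > 1"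
    using assms by (auto simp: s_def)
  have A: "point_A k b = ((1/2) * ((1 - s) / k)\<^sup>2, (1 - s) / k)"
    by (simp add: point_A_def s_def Let_def)
  have yA: "(1 - s) / k \<le> 0"
    using s1 assms by (simp add: divide_nonpos_pos)
  have "k * ((1/2) * ((1 - s) / k)\<^sup>2) - b = ((1 - s)\<^sup>2 - 2 * b * k) / (2 * k)"
    using assms by (simp add: field_simps power2_eq_square)
  also have "(1 - s)\<^sup>2 - 2 * b * k = 2 * (1 - s)"
    using s2 by (simp add: power2_eq_square algebra_simps)
  finally have "k * ((1/2) * ((1 - s) / k)\<^sup>2) - b = (1 - s) / k"
    by (simp only: mult_divide_mult_cancel_left_if) simp
  then have "point_A k b \<in> boundary_line k b \<inter> switching_curve"
    using yA assms by (auto simp: A boundary_line_def switching_curve_def)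
  moreover have "p = point_A k b" if p: "p \<in> boundary_line k b \<inter> switching_curve" for p
  proof -
    obtain x y where xy: "p = (x, y)" by (cases p)
    have g: "y = k * x - b" using p by (auto simp: xy boundary_line_def)
    have y0: "y \<le> 0" and x: "x = (1/2) * y\<^sup>2"
    proof -
      have "\<not> (x = - (1/2) * y\<^sup>2 \<and> y \<ge> 0)"
      proof
        assume *: "x = - (1/2) * y\<^sup>2 \<and> y \<ge> 0"
        then have "k * x \<le> 0" using assms by (simp add: mult_nonneg_nonpos)
        then show False using * g assms by linarith
      qed
      then show "y \<le> 0" "x = (1/2) * y\<^sup>2"
        using p by (auto simp: xy switching_curve_def)
    qed
    have "(k * y - 1)\<^sup>2 = k * (k * y\<^sup>2 - 2 * y) + 1"
      by (simp add: power2_eq_square algebra_simps)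
    also have "k * y\<^sup>2 - 2 * y = 2 * b"
      using g x by (simp add: algebra_simps)
    finally have "(1 - k * y)\<^sup>2 = s\<^sup>2"
      using s2 by (simp add: power2_commute algebra_simps)
    moreover have "1 - k * y \<ge> 0" using y0 assms by (smt (verit) mult_nonneg_nonpos)
    ultimately have "1 - k * y = s" using s1 by (simp add: power2_eq_iff_nonneg)
    then have "y = (1 - s) / k" using assms by (auto simp: field_simps)
    then show ?thesis using x by (simp add: xy A)
  qed
  ultimately show ?thesis by blast
qed

lemma boundary_line_Int_tangent_parabola:
  assumes "k > 0"
  shows "boundary_line k b \<inter> tangent_parabola k b = {point_C k b}"
proof -
  have gap: "(y + b) / k - (- (1/2) * y\<^sup>2 + tangent_const k b) = (1/2) * (y + 1 / k)\<^sup>2" for y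
    using assms by (simp add: tangent_const_def field_simps power2_eq_square)
  have G: "(x, y) \<in> boundary_line k b \<longleftrightarrow> x = (y + b) / k" for x y
    using assms by (auto simp: boundary_line_def field_simps)
  have C: "point_C k b = ((- 1 / k + b) / k, - 1 / k)"
    using assms by (simp add: point_C_def field_simps power2_eq_square)
  have "(x, y) \<in> boundary_line k b \<inter> tangent_parabola k b \<longleftrightarrow> x = (y + b) / k \<and> y = - 1 / k" for x y
  proof -
    have "(y + b) / k = - (1/2) * y\<^sup>2 + tangent_const k b \<longleftrightarrow> (y + 1 / k)\<^sup>2 = 0"
      using gap[of y] by linarith
    also have "\<dots> \<longleftrightarrow> y = - 1 / k"
      by (simp add: add_eq_0_iff2)
    finally show ?thesis
      by (auto simp: G tangent_parabola_def)
  qed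
  then show ?thesis
    unfolding C by (intro set_eqI) (simp only: split_paired_all singleton_iff prod.inject, fastforce)
qed

lemma tangent_parabola_Int_switching_curve:
  assumes "tangent_const k b > 0"
  shows "tangent_parabola k b \<inter> switching_curve = {point_B k b}"
proof -
  have "y = - sqrt (tangent_const k b)" if "y\<^sup>2 = tangent_const k b" "y \<le> 0" for y
    using that by (metis abs_of_nonpos minus_equation_iff real_sqrt_abs)
  then show ?thesis
    using assms
    by (auto simp: tangent_parabola_def switching_curve_def point_B_def)
qed

definition bounded_variation_on :: "real \<Rightarrow> real \<Rightarrow> (real \<Rightarrow> real) \<Rightarrow> bool" where
  "bounded_variation_on a c f \<longleftrightarrow>
     (\<exists>V. \<forall>n (s :: nat \<Rightarrow> real).
        (\<forall>i\<le>n. s i \<in> {a..c}) \<and> (\<forall>i<n. s i \<le> s (Suc i)) \<longrightarrow>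
        (\<Sum>i<n. \<bar>f (s (Suc i)) - f (s i)\<bar>) \<le> V)"

text \<open>
  A nondecreasing \<open>\<mu>\<close> on \<open>[0,T]\<close> is extended by the constants \<open>\<mu> 0\<close> and \<open>\<mu> T\<close>, which
  gives a meaning to \<open>\<mu>(0-0)\<close> and \<open>\<mu>(T+0)\<close>. The measure \<open>d\<mu>\<close> on \<open>[0,T]\<close> depends only on
  the one-sided limits of \<open>\<mu>\<close>; it is obtained from the library's
  \<^const>\<open>interval_measure\<close>, which expects a right-continuous function, by passing to
  \<open>t \<mapsto> \<mu>(t+0)\<close>. Thus \<open>d\<mu> {s..<t} = \<mu>(t-0) - \<mu>(s-0)\<close> and \<open>d\<mu> {t} = \<mu>(t+0) - \<mu>(t-0)\<close>.
\<close>

definition const_ext :: "real \<Rightarrow> (real \<Rightarrow> real) \<Rightarrow> real \<Rightarrow> real" where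
  "const_ext T \<mu> t = \<mu> (max 0 (min T t))"

definition stieltjes_measure :: "real \<Rightarrow> (real \<Rightarrow> real) \<Rightarrow> real measure" where
  "stieltjes_measure T \<mu> = interval_measure (\<lambda>t. Lim (at_right t) (const_ext T \<mu>))"

definition jump :: "real \<Rightarrow> (real \<Rightarrow> real) \<Rightarrow> real \<Rightarrow> real" where
  "jump T \<mu> t = Lim (at_right t) (const_ext T \<mu>) - Lim (at_left t) (const_ext T \<mu>)"

text \<open>
  The equalities of measures \<open>d\<phi> = k d\<mu>\<close> and \<open>d\<psi> = - \<phi> dt - d\<mu>\<close> are evaluated on the
  intervals \<open>{s..<t}\<close>, which determine them on \<open>[0,T)\<close>; on such an interval \<open>d\<phi>\<close> of a
  left-continuous \<open>\<phi>\<close> is \<open>\<phi> t - \<phi> s\<close>. An atom of \<open>d\<mu>\<close> at \<open>T\<close> is excluded by the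
  complementary slackness condition when \<open>b > 0\<close>, because the process ends at the origin.
\<close>

definition maximum_principle ::
  "real \<Rightarrow> real \<Rightarrow> real \<Rightarrow> (real \<Rightarrow> real) \<Rightarrow> (real \<Rightarrow> real) \<Rightarrow> (real \<Rightarrow> real) \<Rightarrow>
   (real \<Rightarrow> real) \<Rightarrow> (real \<Rightarrow> real) \<Rightarrow> (real \<Rightarrow> real) \<Rightarrow> bool" where
  "maximum_principle k b T x y u \<phi> \<psi> \<mu> \<longleftrightarrow>
     bounded_variation_on 0 T \<phi> \<and> bounded_variation_on 0 T \<psi> \<and>
     (\<forall>t\<in>{0<..T}. continuous (at_left t) \<phi> \<and> continuous (at_left t) \<psi>) \<and>
     \<not> (\<forall>t\<in>{0..T}. \<phi> t = 0 \<and> \<psi> t = 0) \<and>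
     mono_on {0..T} \<mu> \<and> \<mu> 0 = 0 \<and>
     (\<forall>s t. 0 \<le> s \<and> s \<le> t \<and> t \<le> T \<longrightarrow>
        \<phi> t - \<phi> s = k * measure (stieltjes_measure T \<mu>) {s..<t} \<and>
        \<psi> t - \<psi> s = - integral {s..t} \<phi> - measure (stieltjes_measure T \<mu>) {s..<t}) \<and>
     (AE t in stieltjes_measure T \<mu>. t \<in> {0..T} \<longrightarrow> y t - k * x t + b = 0) \<and>
     (\<exists>h\<ge>0. AE t in lebesgue_on {0..T}. \<phi> t * y t + \<psi> t * u t = h) \<and>
     (AE t in lebesgue_on {0..T}.
        (\<psi> t > 0 \<longrightarrow> u t = 1) \<and> (\<psi> t < 0 \<longrightarrow> u t = - 1) \<and> (\<psi> t = 0 \<longrightarrow> u t \<in> {-1..1}))"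

text \<open>
  The trajectory is at \<open>N \<in> (C,E)\<close>, \<open>C\<close>, \<open>B\<close> and \<open>O\<close> at the times \<open>t1\<close>, \<open>t2\<close>, \<open>t3\<close> and \<open>T\<close>.
\<close>

definition type_NNCBO ::
  "real \<Rightarrow> real \<Rightarrow> real \<Rightarrow> (real \<Rightarrow> real) \<Rightarrow> (real \<Rightarrow> real) \<Rightarrow> (real \<Rightarrow> real) \<Rightarrow>
   real \<Rightarrow> real \<Rightarrow> real \<Rightarrow> bool" where
  "type_NNCBO k b T x y u t1 t2 t3 \<longleftrightarrow>
     0 < t1 \<and> t1 < t2 \<and> t2 < t3 \<and> t3 < T \<and>
     (AE t in lebesgue_on {0..t1}. u t = - 1) \<and>
     (x t1, y t1) \<in> open_segment (point_C k b) (point_E k b) \<and>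
     (\<forall>t\<in>{t1..t2}. (x t, y t) \<in> boundary_line k b) \<and>
     (AE t in lebesgue_on {t1..t2}. u t = k * y t) \<and>
     (x t2, y t2) = point_C k b \<and>
     (AE t in lebesgue_on {t2..t3}. u t = - 1) \<and>
     (x t3, y t3) = point_B k b \<and>
     (AE t in lebesgue_on {t3..T}. u t = 1) \<and>
     (x T, y T) = (0, 0)"

end

theory Submission
  imports Defs
begin

text \<open>
The problem is linear with convex constraints, so multipliers that satisfy the maximum principle
certify optimality. Let \<open>(\<xi>, \<eta>)\<close> be a candidate of duration \<open>T\<close> with multipliers \<open>\<phi>, \<psi>\<close>, and
let \<open>(x, y)\<close> be a competitor that is not slower, prolonged by rest at the origin up to time
\<open>T\<close>. Then \<open>D = \<phi> (x - \<xi>) + \<psi> (y - \<eta>)\<close> is nonincreasing and vanishes at both ends, hence vanishes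
identically, and this forces \<open>(x, y) = (\<xi>, \<eta>)\<close>. Since the candidate does not rest at the origin
before \<open>T\<close>, no competitor is faster. So the candidate is not just optimal; the optimal
processes are exactly those that follow it (\<open>time_optimal_iff_follows\<close>), and every claim about
optimal processes becomes a claim about one explicit curve.

The argument needs no control. A process gives a pair \<open>(x, y)\<close> with \<open>y\<close> 1-Lipschitz and
\<open>x' = y\<close> everywhere (\<open>free_process_trajectory\<close>, which rests on the fundamental theorem of
calculus for Lipschitz functions). On an arc where the candidate has \<open>u = \<sigma>\<close> and
\<open>\<psi> t = \<phi> (\<theta> - t)\<close> with \<open>\<sigma> \<psi> \<ge> 0\<close>, the mean value theorem gives, with \<open>g = y - \<eta>\<close> and some
\<open>q\<close> between \<open>s\<close> and \<open>t\<close>,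
\<open>D t - D s = \<psi> t (g t - g q) + \<psi> s (g q - g s)\<close>, and both terms are nonpositive because
\<open>\<sigma> g\<close> is nonincreasing (\<open>arc_inequality\<close>).

Free problem: two such arcs with \<open>\<phi> = \<sigma>\<close> constant. From a point of \<open>\<Omega>\<^sub>1\<close> the resulting
trajectory stays in the half-plane \<open>y \<ge> k x - b\<close> (\<open>bang_in_halfplane\<close>), so the
two problems have the same optimal processes.

Constrained problem: for a start in \<open>int \<Omega>\<^sub>2\<close> or on \<open>(C, E)\<close> the candidate reaches the line at
\<open>N = ((b - p) / k, - p)\<close> at time \<open>t1\<close>, slides to \<open>C\<close>, and then continues as a free optimal trajectory.
While it slides, the constraint says \<open>(y - \<eta>) - k (x - \<xi>) \<ge> 0\<close>, so \<open>exp (- k t) (x - \<xi>)\<close> is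
nondecreasing; this carries the inequality for \<open>D\<close> from the first arc to the last two
(\<open>slide_rigid\<close>). The hypothesis \<open>y\<^sub>C > y\<^sub>A\<close> is equivalent to \<open>k b > 3 / 2\<close>, which puts the switching
point \<open>B\<close> strictly below \<open>C\<close>.

Multipliers of the sliding trajectory: along the slide \<open>|u| < 1\<close>, so \<open>\<psi> = 0\<close> and
\<open>\<phi> = h / y\<close> with the constant \<open>h\<close> of the maximum principle, which excludes atoms inside the slide;
at \<open>N\<close> the signs of \<open>\<psi>\<close> and of the jump are incompatible with an atom. Without an
atom at \<open>C\<close> the function \<open>\<psi>\<close> would be linear on the last two arcs and vanish at \<open>C\<close>, while having
to change sign at \<open>B\<close>; then all multipliers vanish (\<open>multiplier_jump_unique\<close>).
\<close>

section \<open>Lipschitz functions and their derivatives\<close>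

lemma AE_lebesgue_on_interval_iff:
  fixes a c :: real
  shows "(AE t in lebesgue_on {a..c}. P t) \<longleftrightarrow> negligible {t \<in> {a..c}. \<not> P t}"
proof -
  have "(AE t in lebesgue_on {a..c}. P t) \<longleftrightarrow> (AE t in lebesgue. t \<in> {a..c} \<longrightarrow> P t)"
    by (subst AE_restrict_space_iff) auto
  also have "\<dots> \<longleftrightarrow> negligible {t \<in> {a..c}. \<not> P t}"
    by (auto simp: eventually_ae_filter_negligible intro: negligible_subset)
  finally show ?thesis .
qed

lemma AE_lebesgue_on_shift:
  fixes d :: real
  assumes "AE t in lebesgue_on {0..d + c}. Q t" "0 \<le> d"
  shows "AE t in lebesgue_on {0..c}. Q (d + t)"
proof -
  have "negligible ((+) (- d) ` {t \<in> {0..d + c}. \<not> Q t})"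
    using assms(1) unfolding AE_lebesgue_on_interval_iff by (rule negligible_translation)
  then show ?thesis unfolding AE_lebesgue_on_interval_iff
  proof (rule negligible_subset)
    show "{t \<in> {0..c}. \<not> Q (d + t)} \<subseteq> (+) (- d) ` {t \<in> {0..d + c}. \<not> Q t}"
    proof
      fix t assume "t \<in> {t \<in> {0..c}. \<not> Q (d + t)}"
      then show "t \<in> (+) (- d) ` {t \<in> {0..d + c}. \<not> Q t}"
        using assms(2) by (intro image_eqI[of _ _ "d + t"]) auto
    qed
  qed
qed

lemma AE_interval_contradiction:
  fixes a c :: real
  assumes "AE t in lebesgue_on {a..c}. Q t" "a \<le> a'" "a' < c'" "c' \<le> c"
    and "\<And>t. t \<in> {a'<..<c'} \<Longrightarrow> \<not> Q t"
  shows False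
proof -
  have "negligible {t \<in> {a..c}. \<not> Q t}" using assms(1) by (simp add: AE_lebesgue_on_interval_iff)
  then have "negligible (box a' c')" by (rule negligible_subset) (use assms in auto)
  then show False using assms(3) unfolding negligible_interval by simp
qed

lemma AE_lebesgue_on_subinterval:
  fixes a c :: real
  assumes "AE t in lebesgue_on {a..c}. Q t" "a \<le> a'" "c' \<le> c"
  shows "AE t in lebesgue_on {a'..c'}. Q t"
  using assms unfolding AE_lebesgue_on_interval_iff
  by (elim negligible_subset) auto

text \<open>
A Lipschitz function is the integral of its almost everywhere derivative. In a fine tagged
division the intervals tagged in \<open>N\<close> contribute at most \<open>L\<close> times their total length, which is
controlled because the indicator of \<open>N\<close> has integral zero.
\<close>

lemma Lipschitz_has_integral_derivative:
  fixes f :: "real \<Rightarrow> real"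
  assumes "a \<le> b" and lip: "L-lipschitz_on {a..b} f" and N: "negligible N"
    and der: "\<And>t. t \<in> {a..b} - N \<Longrightarrow> (f has_real_derivative f' t) (at t within {a..b})"
  shows "(f' has_integral (f b - f a)) {a..b}"
proof (cases "a = b")
  case True
  then show ?thesis by (simp add: has_integral_refl)
next
  case False
  with \<open>a \<le> b\<close> have "a < b" by simp
  define g where "g t = (if t \<in> N then 0 else f' t)" for t
  have L0: "0 \<le> L" using lip by (rule lipschitz_on_nonneg)
  have "(g has_integral (f b - f a)) (cbox a b)"
    unfolding has_integral_factor_content
  proof safe
    fix e :: real
    assume e: "e > 0"
    have "\<forall>x. \<exists>d>0. x \<in> {a..b} - N \<longrightarrow>
         (\<forall>y\<in>{a..b}. norm (y-x) < d \<longrightarrow> norm (f y - f x - (y-x) *\<^sub>R g x) \<le> (e/2) * norm (y-x))"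
    proof
      fix x
      show "\<exists>d>0. x \<in> {a..b} - N \<longrightarrow>
         (\<forall>y\<in>{a..b}. norm (y-x) < d \<longrightarrow> norm (f y - f x - (y-x) *\<^sub>R g x) \<le> (e/2) * norm (y-x))"
      proof (cases "x \<in> {a..b} - N")
        case True
        have "(f has_derivative (\<lambda>h. h *\<^sub>R f' x)) (at x within {a..b})"
          using has_field_derivative_imp_has_derivative[OF der[OF True]]
            by (rule has_derivative_eq_rhs) (simp add: fun_eq_iff)
        then have "\<forall>e>0. \<exists>d>0. \<forall>y\<in>{a..b}. norm (y-x) < d \<longrightarrow> norm (f y - f x - (y-x) *\<^sub>R f' x) \<le> e * norm (y-x)"
          unfolding has_derivative_within_alt by blast
        then show ?thesis using e True
          by (auto simp: g_def dest!: spec[of _ "e/2"])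
      qed (auto intro: exI[of _ 1])
    qed
    then obtain d where d: "\<And>x. 0 < d x"
                 "\<And>x y. \<lbrakk>x \<in> {a..b} - N; y \<in> {a..b}; norm (y-x) < d x\<rbrakk>
                        \<Longrightarrow> norm (f y - f x - (y-x) *\<^sub>R g x) \<le> (e/2) * norm (y-x)"
      by metis
    have "(indicat_real N has_integral 0) (cbox a b)"
      using N by (simp add: negligible_def)
    moreover have e2: "e * (b - a) / (2 * (L + 1)) > 0"
      using e \<open>a < b\<close> L0 by simp
    ultimately obtain \<gamma> where \<gamma>: "gauge \<gamma>"
      "\<And>p. \<lbrakk>p tagged_division_of (cbox a b); \<gamma> fine p\<rbrakk> \<Longrightarrow>
         norm ((\<Sum>(x, K)\<in>p. measure lborel K *\<^sub>R indicat_real N x) - 0) < e * (b - a) / (2 * (L + 1))"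
      unfolding has_integral by meson
    show "\<exists>d. gauge d \<and> (\<forall>p. p tagged_division_of (cbox a b) \<and> d fine p \<longrightarrow>
      norm ((\<Sum>(x, k)\<in>p. measure lborel k *\<^sub>R g x) - (f b - f a)) \<le> e * measure lborel (cbox a b))"
    proof (intro exI conjI allI impI)
      show "gauge (\<lambda>x. ball x (d x) \<inter> \<gamma> x)"
        using d(1) gauge_ball_dependent \<gamma>(1) by (intro gauge_Int) auto
    next
      fix p
      assume "p tagged_division_of cbox a b \<and> (\<lambda>x. ball x (d x) \<inter> \<gamma> x) fine p"
      then have ptag: "p tagged_division_of cbox a b"
        and finep: "(\<lambda>x. ball x (d x)) fine p" and fine\<gamma>: "\<gamma> fine p"
        by (auto simp: fine_Int)
      have ba: "b - a = (\<Sum>(x,K)\<in>p. Sup K - Inf K)" "f b - f a = (\<Sum>(x,K)\<in>p. f(Sup K) - f(Inf K))"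
        using additive_tagged_division_1[where f= "\<lambda>x. x"] additive_tagged_division_1[where f= f]
              \<open>a \<le> b\<close> ptag by auto
      have "norm (\<Sum>(x, K) \<in> p. (measure lborel K *\<^sub>R g x) - (f (Sup K) - f (Inf K)))
          \<le> (\<Sum>n\<in>p. case n of (x, K) \<Rightarrow> (e/2) * (Sup K - Inf K) + L * (measure lborel K *\<^sub>R indicat_real N x))"
      proof (rule sum_norm_le, safe)
        fix x K
        assume xK: "(x, K) \<in> p"
        then obtain u v where K: "K = cbox u v" and "x \<in> K" and kab: "K \<subseteq> cbox a b"
          using ptag by (meson tagged_division_ofD)
        have "u \<le> v" using \<open>x \<in> K\<close> unfolding K by auto
        then have uv: "u \<in> K" "v \<in> K" "Sup K = v" "Inf K = u" "measure lborel K = v - u"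
          by (simp_all add: K)
        have uvab: "u \<in> {a..b}" "v \<in> {a..b}" using uv kab by auto
        show "norm (measure lborel K *\<^sub>R g x - (f (Sup K) - f (Inf K)))
            \<le> (e/2) * (Sup K - Inf K) + L * (measure lborel K *\<^sub>R indicat_real N x)"
        proof (cases "x \<in> N")
          case True
          have "dist (f v) (f u) \<le> L * dist v u"
            using lipschitz_onD[OF lip] uvab by blast
          moreover have "0 \<le> (e/2) * (v - u)" using e \<open>u \<le> v\<close> by simp
          ultimately show ?thesis
            using True \<open>u \<le> v\<close> by (simp add: uv g_def dist_real_def)
        next
          case False
          then have x: "x \<in> {a..b} - N" using \<open>x \<in> K\<close> kab by auto
          have ball: "\<And>y. y \<in> K \<Longrightarrow> norm (y - x) < d x"
            using finep xK by (force simp: fine_def dist_real_def)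
          have "norm ((v - u) *\<^sub>R g x - (f v - f u)) = norm (f u - f x - (u - x) *\<^sub>R g x - (f v - f x - (v - x) *\<^sub>R g x))"
            by (auto simp: algebra_simps)
          also have "\<dots> \<le> norm (f u - f x - (u - x) *\<^sub>R g x) + norm (f v - f x - (v - x) *\<^sub>R g x)"
            by (rule norm_triangle_ineq4)
          also have "\<dots> \<le> (e/2) * norm (u - x) + (e/2) * norm (v - x)"
            by (intro add_mono d(2)[OF x] uvab ball uv)
          also have "\<dots> = (e/2) * (v - u)"
            using \<open>x \<in> K\<close> by (simp add: K field_simps)
          finally show ?thesis using False by (simp add: uv)
        qed
      qed
      also have "\<dots> = (e/2) * (b - a) + L * (\<Sum>(x, K)\<in>p. measure lborel K *\<^sub>R indicat_real N x)"
        by (simp only: split_def sum.distrib sum_distrib_left ba(1))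
      also have "\<dots> \<le> (e/2) * (b - a) + L * (e * (b - a) / (2 * (L + 1)))"
        using \<gamma>(2)[OF ptag fine\<gamma>] L0 by (intro add_left_mono mult_left_mono) auto
      also have "\<dots> \<le> (e/2) * (b - a) + (e/2) * (b - a)"
      proof -
        have "L * (e * (b - a) / (2 * (L + 1))) = (L / (L + 1)) * ((e/2) * (b - a))" by simp
        also have "\<dots> \<le> 1 * ((e/2) * (b - a))"
          using L0 e \<open>a < b\<close> by (intro mult_right_mono) auto
        finally show ?thesis by linarith
      qed
      finally show "norm ((\<Sum>(x, k)\<in>p. measure lborel k *\<^sub>R g x) - (f b - f a)) \<le> e * measure lborel (cbox a b)"
        using \<open>a < b\<close> by (simp add: ba split_def sum_subtractf)
    qed
  qed
  then have "(f' has_integral (f b - f a)) (cbox a b)"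
    by (rule has_integral_spike[OF N, rotated]) (auto simp: g_def)
  then show ?thesis by simp
qed

section \<open>Processes as trajectories\<close>

text \<open>
A pair that some measurable control with values in \<open>[-1, 1]\<close> can produce on \<open>[a, c]\<close>, described
without the control: \<open>y\<close> is 1-Lipschitz and \<open>x' = y\<close> (one-sided at the end points).
\<close>

definition trajectory :: "real \<Rightarrow> real \<Rightarrow> (real \<Rightarrow> real) \<Rightarrow> (real \<Rightarrow> real) \<Rightarrow> bool" where
  "trajectory a c x y \<longleftrightarrow> 1-lipschitz_on {a..c} y \<and>
     (\<forall>t\<in>{a..c}. (x has_real_derivative y t) (at t within {a..c}))"

lemma trajectoryD:
  assumes "trajectory a c x y"
  shows "\<And>s t. \<lbrakk>s \<in> {a..c}; t \<in> {a..c}\<rbrakk> \<Longrightarrow> \<bar>y t - y s\<bar> \<le> \<bar>t - s\<bar>"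
    and "\<And>t. t \<in> {a..c} \<Longrightarrow> (x has_real_derivative y t) (at t within {a..c})"
    and "continuous_on {a..c} x" and "continuous_on {a..c} y"
proof -
  show "\<bar>y t - y s\<bar> \<le> \<bar>t - s\<bar>" if "s \<in> {a..c}" "t \<in> {a..c}" for s t
    using assms lipschitz_onD[of 1 "{a..c}" y t s] that
    by (auto simp: trajectory_def dist_real_def)
  show *: "(x has_real_derivative y t) (at t within {a..c})" if "t \<in> {a..c}" for t
    using assms that by (auto simp: trajectory_def)
  show "continuous_on {a..c} x"
    using * by (meson DERIV_continuous continuous_on_eq_continuous_within)
  show "continuous_on {a..c} y"
    using assms lipschitz_on_continuous_on unfolding trajectory_def by blast
qed

lemma trajectory_subset:
  assumes "trajectory a c x y" "a \<le> a'" "c' \<le> c"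
  shows "trajectory a' c' x y"
proof -
  have "{a'..c'} \<subseteq> {a..c}" using assms by auto
  then show ?thesis using assms(1)
    unfolding trajectory_def by (meson lipschitz_on_subset DERIV_subset subsetD)
qed

lemma trajectory_cong:
  assumes "trajectory a c x y" "\<And>t. t \<in> {a..c} \<Longrightarrow> x' t = x t" "\<And>t. t \<in> {a..c} \<Longrightarrow> y' t = y t"
  shows "trajectory a c x' y'"
  using assms unfolding trajectory_def
  by (auto intro: lipschitz_on_transform has_field_derivative_transform_within[where d=1])

lemma trajectory_glue:
  assumes 1: "trajectory a b x y" and 2: "trajectory b c x y"
  shows "trajectory a c x y"
proof (cases "a \<le> b \<and> b \<le> c")
  case False
  then consider "b < a" "b \<le> c" | "a \<le> b" "c < b" | "b < a" "c < b" by linarith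
  then show ?thesis
  proof cases
    case 1 then show ?thesis using trajectory_subset[OF 2] by auto
  next
    case 2 then show ?thesis using trajectory_subset[OF assms(1)] by auto
  next
    case 3 then show ?thesis by (auto simp: trajectory_def)
  qed
next
  case True
  then have ab: "a \<le> b" and bc: "b \<le> c" by auto
  have "1-lipschitz_on {a..c} y"
  proof (rule lipschitz_on_leI)
    fix s t assume st: "s \<in> {a..c}" "t \<in> {a..c}" "s \<le> t"
    have "\<bar>y t - y s\<bar> \<le> \<bar>t - s\<bar>"
    proof (cases "t \<le> b \<or> b \<le> s")
      case True
      then show ?thesis using st trajectoryD(1)[OF 1, of s t] trajectoryD(1)[OF 2, of s t] by auto
    next
      case False
      then show ?thesis using st trajectoryD(1)[OF 1, of s b] trajectoryD(1)[OF 2, of b t] by auto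
    qed
    then show "dist (y s) (y t) \<le> 1 * dist s t"
      by (simp add: dist_real_def abs_minus_commute)
  qed simp
  moreover have "(x has_real_derivative y t) (at t within {a..c})" if t: "t \<in> {a..c}" for t
  proof -
    have ac: "{a..c} = {a..b} \<union> {b..c}" using ab bc by auto
    have l: "((\<lambda>s. (x s - x t) / (s - t)) \<longlongrightarrow> y t) (at t within {a..b})"
    proof (cases "t \<in> {a..b}")
      case True then show ?thesis using trajectoryD(2)[OF 1] by (simp add: has_field_derivative_iff)
    next
      case False
      then have "t \<notin> closure ({a..b} - {t})" by simp
      then show ?thesis by (simp add: at_within_eq_bot_iff[THEN iffD2])
    qed
    have r: "((\<lambda>s. (x s - x t) / (s - t)) \<longlongrightarrow> y t) (at t within {b..c})"
    proof (cases "t \<in> {b..c}")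
      case True then show ?thesis using trajectoryD(2)[OF 2] by (simp add: has_field_derivative_iff)
    next
      case False
      then have "t \<notin> closure ({b..c} - {t})" by simp
      then show ?thesis by (simp add: at_within_eq_bot_iff[THEN iffD2])
    qed
    show ?thesis unfolding has_field_derivative_iff ac using l r by (intro Lim_Un)
  qed
  ultimately show ?thesis by (simp add: trajectory_def)
qed

lemma free_process_trajectory:
  assumes "free_process P T x y u"
  shows "0 \<le> T" "trajectory 0 T x y" "(x 0, y 0) = P" "x T = 0" "y T = 0"
proof -
  show T: "0 \<le> T" and "(x 0, y 0) = P" "x T = 0" "y T = 0"
    using assms by (auto simp: free_process_def)
  define N where "N = {t \<in> {0..T}. \<not> \<bar>u t\<bar> \<le> 1} \<union>
      {t \<in> {0..T}. \<not> (x has_real_derivative y t) (at t within {0..T})} \<union>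
      {t \<in> {0..T}. \<not> (y has_real_derivative u t) (at t within {0..T})}"
  have N: "negligible N"
    using assms unfolding free_process_def AE_lebesgue_on_interval_iff N_def
    by (intro negligible_Un) auto
  obtain L1 L2 where lx: "L1-lipschitz_on {0..T} x" and ly: "L2-lipschitz_on {0..T} y"
    using assms by (auto simp: free_process_def)
  have sub: "(x has_real_derivative y t) (at t within {a..c})"
            "(y has_real_derivative u t) (at t within {a..c})"
    if "0 \<le> a" "c \<le> T" "t \<in> {a..c} - N" for t a c
    using that by (auto simp: N_def intro: DERIV_subset)
  have iy: "(u has_integral (y t - y s)) {s..t}" if "0 \<le> s" "s \<le> t" "t \<le> T" for s t
    by (rule Lipschitz_has_integral_derivative[OF _ _ N]) 
       (use that sub in \<open>auto intro: lipschitz_on_subset[OF ly]\<close>)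
  have ix: "(y has_integral (x t - x 0)) {0..t}" if "0 \<le> t" "t \<le> T" for t
    by (rule Lipschitz_has_integral_derivative[OF _ _ N]) 
       (use that sub in \<open>auto intro: lipschitz_on_subset[OF lx]\<close>)
  have "1-lipschitz_on {0..T} y"
  proof (rule lipschitz_on_leI)
    fix s t assume st: "s \<in> {0..T}" "t \<in> {0..T}" "s \<le> t"
    have "((\<lambda>r. if r \<in> N then 0 else u r) has_integral (y t - y s)) (cbox s t)"
      using iy[of s t] st by (auto intro: has_integral_spike[OF N, rotated])
    then have "norm (y t - y s) \<le> 1 * measure lborel (cbox s t)"
      by (rule has_integral_bound[rotated]) (use st in \<open>auto simp: N_def\<close>)
    then show "dist (y s) (y t) \<le> 1 * dist s t"
      using st by (simp add: dist_real_def abs_minus_commute)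
  qed simp
  moreover have "(x has_real_derivative y t) (at t within {0..T})" if t: "t \<in> {0..T}" for t
  proof -
    have cy: "continuous_on {0..T} y" using ly by (rule lipschitz_on_continuous_on)
    have "((\<lambda>t. integral {0..t} y) has_real_derivative y t) (at t within {0..T})"
      using integral_has_vector_derivative[OF cy t] by (simp add: has_real_derivative_iff_has_vector_derivative)
    then have "((\<lambda>t. x 0 + integral {0..t} y) has_real_derivative y t) (at t within {0..T})"
      by (auto intro!: derivative_eq_intros)
    then show ?thesis
    proof (rule has_field_derivative_transform_within[of _ _ _ _ 1])
      show "x 0 + integral {0..s} y = x s" if "s \<in> {0..T}" for s
        using ix[of s] that by (simp add: integral_unique)
    qed (use t in auto)
  qed
  ultimately show "trajectory 0 T x y" by (simp add: trajectory_def)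
qed

text \<open>
Conversely, a trajectory whose velocity has an explicit derivative \<open>v\<close> off a finite set is a
process for every control that agrees with \<open>v\<close> almost everywhere. The bound \<open>|u| \<le> 1\<close> is
inherited from the Lipschitz constant.
\<close>

lemma free_processI:
  assumes T: "0 \<le> T" and traj: "trajectory 0 T x y" and S: "finite S"
    and v: "v \<in> borel_measurable borel"
    and vy: "\<And>t. t \<in> {0<..<T} - S \<Longrightarrow> (y has_real_derivative v t) (at t)"
    and uv: "AE t in lebesgue_on {0..T}. u t = v t"
    and ends: "(x 0, y 0) = P" "x T = 0" "y T = 0"
  shows "free_process P T x y u"
proof -
  define N where "N = {t \<in> {0..T}. u t \<noteq> v t} \<union> (S \<union> {0, T}) \<inter> {0..T}"
  have N: "negligible N"
    using uv S unfolding AE_lebesgue_on_interval_iff N_def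
    by (intro negligible_Un) (simp_all add: negligible_finite)
  have der: "(y has_real_derivative u t) (at t within {0..T})" if "t \<in> {0..T} - N" for t
  proof -
    have "t \<in> {0<..<T} - S" "u t = v t" using that by (auto simp: N_def)
    then show ?thesis using vy[of t] by (auto intro: has_field_derivative_at_within)
  qed
  have bnd: "\<bar>u t\<bar> \<le> 1" if "t \<in> {0..T} - N" for t
  proof -
    have t: "t \<in> {0<..<T} - S" "u t = v t" using that by (auto simp: N_def)
    have "((\<lambda>s. (y s - y t) / (s - t)) \<longlongrightarrow> v t) (at t)"
      using vy[OF t(1)] by (simp add: has_field_derivative_iff)
    then have "((\<lambda>s. \<bar>(y s - y t) / (s - t)\<bar>) \<longlongrightarrow> \<bar>v t\<bar>) (at t)"
      by (rule tendsto_rabs)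
    moreover have "\<forall>\<^sub>F s in at t. \<bar>(y s - y t) / (s - t)\<bar> \<le> 1"
    proof -
      have "\<forall>\<^sub>F s in at t. s \<in> {0<..<T}"
        using t by (intro eventually_at_in_open') auto
      moreover have "\<forall>\<^sub>F s in at t. s \<noteq> t"
        by (simp add: eventually_at_filter)
      ultimately show ?thesis
      proof eventually_elim
        case (elim s)
        then have "\<bar>y s - y t\<bar> \<le> \<bar>s - t\<bar>" using t by (intro trajectoryD(1)[OF traj]) auto
        then show ?case using elim by (simp add: abs_divide divide_le_eq)
      qed
    qed
    ultimately show ?thesis using t(2) tendsto_upperbound[of _ "\<bar>v t\<bar>" "at t" 1] by auto
  qed
  have "u \<in> borel_measurable (lebesgue_on {0..T})"
  proof -
    have N': "N \<in> null_sets (lebesgue_on {0..T})"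
      using N by (subst null_sets_restrict_space) (auto simp: negligible_iff_null_sets N_def)
    have "v \<in> borel_measurable (lebesgue_on {0..T})"
      using v by (intro measurable_restrict_space1 measurable_completion) simp
    then have "v \<in> borel_measurable (lebesgue_on ({0..T} - N))"
      using borel_measurable_diff_null[OF N', of v] by simp
    then have "u \<in> borel_measurable (lebesgue_on ({0..T} - N))"
      by (rule measurable_cong[THEN iffD1, rotated]) (auto simp: N_def space_restrict_space)
    then show ?thesis 
      using borel_measurable_diff_null[OF N', of u] by simp
  qed
  moreover have "\<exists>L. L-lipschitz_on {0..T} x"
  proof (intro exI)
    have yb: "\<bar>y t\<bar> \<le> \<bar>y 0\<bar> + T" if "t \<in> {0..T}" for t
      using trajectoryD(1)[OF traj, of 0 t] that by auto
    show "(\<bar>y 0\<bar> + T)-lipschitz_on {0..T} x"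
    proof (rule lipschitz_on_leI)
      fix s t assume st: "s \<in> {0..T}" "t \<in> {0..T}" "s \<le> t"
      have "norm (x s - x t) \<le> (\<bar>y 0\<bar> + T) * norm (s - t)"
        by (rule field_differentiable_bound[of "{0..T}" x y])
           (use st yb trajectoryD(2)[OF traj] in auto)
      then show "dist (x s) (x t) \<le> (\<bar>y 0\<bar> + T) * dist s t" by (simp add: dist_real_def)
    qed (use T in auto)
  qed
  moreover have "AE t in lebesgue_on {0..T}. \<bar>u t\<bar> \<le> 1"
    using bnd unfolding AE_lebesgue_on_interval_iff by (auto intro: negligible_subset[OF N])
  moreover have "AE t in lebesgue_on {0..T}. (y has_real_derivative u t) (at t within {0..T})"
    using der unfolding AE_lebesgue_on_interval_iff by (auto intro: negligible_subset[OF N])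
  moreover have "\<exists>L. L-lipschitz_on {0..T} y" using traj by (auto simp: trajectory_def)
  moreover have "AE t in lebesgue_on {0..T}. (x has_real_derivative y t) (at t within {0..T})"
    using trajectoryD(2)[OF traj] by (intro AE_I2) simp
  ultimately show ?thesis using T ends by (simp add: free_process_def)
qed

lemma free_process_control_AE:
  assumes p: "free_process P T x y u" and S: "finite S"
    and vy: "\<And>t. t \<in> {0<..<T} - S \<Longrightarrow> (y has_real_derivative v t) (at t)"
  shows "AE t in lebesgue_on {0..T}. u t = v t"
proof -
  have "negligible ({t \<in> {0..T}. \<not> (y has_real_derivative u t) (at t within {0..T})} \<union> (S \<union> {0, T}))"
    using p S unfolding free_process_def AE_lebesgue_on_interval_iff
    by (intro negligible_Un) (simp_all add: negligible_finite)
  moreover have "u t = v t" if t: "t \<in> {0<..<T} - S"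
    and u: "(y has_real_derivative u t) (at t within {0..T})" for t
  proof -
    have "(y has_real_derivative u t) (at t)"
      using u t by (simp add: at_within_Icc_at)
    then show ?thesis using vy[OF t] by (rule DERIV_unique)
  qed
  ultimately show ?thesis unfolding AE_lebesgue_on_interval_iff
    by (elim negligible_subset) fastforce
qed

section \<open>The basic inequality on an arc with constant control\<close>

text \<open>
The reference \<open>(\<xi>, \<eta>)\<close> moves with control \<open>\<sigma> = \<plusminus>1\<close>, and \<open>\<phi> (\<theta> - t)\<close> is the costate \<open>\<psi> t\<close>, which has the
sign of \<open>\<sigma>\<close>. The pairing \<open>D\<close> of the costate with the deviation of any trajectory decreases; if
it does not drop at all, the deviation in \<open>y\<close> is constant.
\<close>

lemma arc_inequality:
  fixes x y \<xi> \<eta> :: "real \<Rightarrow> real"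
  assumes traj: "trajectory a c x y" and ref: "trajectory a c \<xi> \<eta>"
    and \<sigma>: "\<sigma>\<^sup>2 = 1"
    and slope: "\<And>s t. \<lbrakk>s \<in> {a..c}; t \<in> {a..c}\<rbrakk> \<Longrightarrow> \<eta> t - \<eta> s = \<sigma> * (t - s)"
    and sign: "\<And>t. t \<in> {a..c} \<Longrightarrow> 0 \<le> \<sigma> * (\<phi> * (\<theta> - t))"
  defines "D \<equiv> \<lambda>t. \<phi> * (x t - \<xi> t) + \<phi> * (\<theta> - t) * (y t - \<eta> t)"
  shows arc_antimono: "\<lbrakk>s \<in> {a..c}; t \<in> {a..c}; s \<le> t\<rbrakk> \<Longrightarrow> D t \<le> D s"
    and arc_rigid: "\<lbrakk>\<phi> \<noteq> 0; D a \<le> D c; t \<in> {a..c}\<rbrakk> \<Longrightarrow> y t - \<eta> t = y a - \<eta> a"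
proof -
  define g where "g t = y t - \<eta> t" for t
  have \<sigma>1: "\<bar>\<sigma>\<bar> = 1" "\<sigma> * \<sigma> = 1" using \<sigma> by (auto simp: power2_eq_1_iff)
  have gmono: "\<sigma> * (g t - g s) \<le> 0" if "s \<in> {a..c}" "t \<in> {a..c}" "s \<le> t" for s t
  proof -
    have "\<sigma> * (g t - g s) = \<sigma> * (y t - y s) - \<sigma> * (\<eta> t - \<eta> s)"
      by (simp add: g_def algebra_simps)
    also have "\<dots> = \<sigma> * (y t - y s) - (t - s)"
      using slope[OF that(1,2)] \<sigma>1(2) by (simp flip: mult.assoc)
    also have "\<dots> \<le> \<bar>\<sigma> * (y t - y s)\<bar> - (t - s)" by simp
    also have "\<dots> \<le> 0"
      using trajectoryD(1)[OF traj that(1,2)] that(3) \<sigma>1(1) by (simp add: abs_mult)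
    finally show ?thesis .
  qed
  have prod: "\<phi> * (\<theta> - q) * (g t - g s) \<le> 0"
    if "q \<in> {a..c}" "s \<in> {a..c}" "t \<in> {a..c}" "s \<le> t" for q s t
  proof -
    have "\<phi> * (\<theta> - q) * (g t - g s) = (\<sigma> * (\<phi> * (\<theta> - q))) * (\<sigma> * (g t - g s))"
      using \<sigma>1(2) by (metis mult.left_commute mult.assoc mult_1_right)
    also have "\<dots> \<le> 0"
      by (rule mult_nonneg_nonpos[OF sign gmono]) (use that in auto)
    finally show ?thesis .
  qed
  have split: "\<exists>r\<in>{s..t}. D t - D s = \<phi> * (\<theta> - t) * (g t - g r) + \<phi> * (\<theta> - s) * (g r - g s)"
    if st: "s \<in> {a..c}" "t \<in> {a..c}" "s < t" for s t
  proof -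
    have der: "((\<lambda>r. x r - \<xi> r) has_derivative (\<lambda>h. g r * h)) (at r within {s..t})" 
      if "r \<in> {s..t}" for r
    proof -
      have r: "r \<in> {a..c}" "{s..t} \<subseteq> {a..c}" using that st by auto
      have "((\<lambda>r. x r - \<xi> r) has_real_derivative g r) (at r within {a..c})"
        unfolding g_def using trajectoryD(2)[OF traj r(1)] trajectoryD(2)[OF ref r(1)]
        by (rule DERIV_diff)
      then show ?thesis using r by (auto simp: has_field_derivative_def intro: has_derivative_subset)
    qed
    obtain r where r: "r \<in> {s<..<t}"
      and mvt: "(x t - \<xi> t) - (x s - \<xi> s) = g r * (t - s)"
      using mvt_simple[OF \<open>s < t\<close> der] by auto
    have "D t - D s = \<phi> * ((x t - \<xi> t) - (x s - \<xi> s)) + \<phi> * (\<theta> - t) * g t - \<phi> * (\<theta> - s) * g s"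
      by (simp add: D_def g_def algebra_simps)
    also have "\<dots> = \<phi> * (\<theta> - t) * (g t - g r) + \<phi> * (\<theta> - s) * (g r - g s)"
      unfolding mvt by (simp add: algebra_simps)
    finally show ?thesis using r by (intro bexI[of _ r]) auto
  qed
  have anti: "D t \<le> D s" if st: "s \<in> {a..c}" "t \<in> {a..c}" "s \<le> t" for s t
  proof (cases "s = t")
    case False
    then have "s < t" using st by simp
    then obtain r where r: "r \<in> {s..t}"
      "D t - D s = \<phi> * (\<theta> - t) * (g t - g r) + \<phi> * (\<theta> - s) * (g r - g s)"
      using split[OF st(1,2)] by blast
    have "\<phi> * (\<theta> - t) * (g t - g r) \<le> 0" "\<phi> * (\<theta> - s) * (g r - g s) \<le> 0"
      by (rule prod; use st r in auto)+
    then show ?thesis using r(2) by linarith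
  qed simp
  then show "\<lbrakk>s \<in> {a..c}; t \<in> {a..c}; s \<le> t\<rbrakk> \<Longrightarrow> D t \<le> D s" .
  assume \<phi>: "\<phi> \<noteq> 0" and Dac: "D a \<le> D c" and t: "t \<in> {a..c}"
  show "y t - \<eta> t = y a - \<eta> a"
  proof (cases "a < c")
    case False
    then have "t = a" using t by auto
    then show ?thesis by simp
  next
    case True
    have const: "D t = D a" if "t \<in> {a..c}" for t
      using anti[of a t] anti[of t c] Dac that by auto
    \<comment> \<open>The costate has one sign on the whole arc, so its zero is not inside.\<close>
    have \<theta>: "\<theta> \<notin> {a<..<c}"
    proof
      assume \<theta>: "\<theta> \<in> {a<..<c}"
      have "0 \<le> (\<sigma> * \<phi>) * (\<theta> - a)" "0 \<le> (\<sigma> * \<phi>) * (\<theta> - c)"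
        using sign[of a] sign[of c] True by (auto simp: mult.assoc)
      then have "\<sigma> * \<phi> = 0"
        using \<theta> zero_le_mult_iff[of "\<sigma> * \<phi>" "\<theta> - a"]
          zero_le_mult_iff[of "\<sigma> * \<phi>" "\<theta> - c"] by auto
      then show False using \<phi> \<sigma> by auto
    qed
    have eq: "g t = g s" if st: "s \<in> {a<..<c}" "t \<in> {a<..<c}" "s < t" for s t
    proof -
      obtain r where r: "r \<in> {s..t}"
        "D t - D s = \<phi> * (\<theta> - t) * (g t - g r) + \<phi> * (\<theta> - s) * (g r - g s)"
        using split[of s t] st by auto
      have "\<phi> * (\<theta> - t) * (g t - g r) \<le> 0" "\<phi> * (\<theta> - s) * (g r - g s) \<le> 0"
        by (rule prod; use st r in auto)+
      moreover have "D t = D s" using const[of s] const[of t] st by auto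
      ultimately have "\<phi> * (\<theta> - t) * (g t - g r) = 0" "\<phi> * (\<theta> - s) * (g r - g s) = 0"
        using r(2) by linarith+
      then show ?thesis using \<phi> \<theta> st by auto
    qed
    define q where "q = (a + c) / 2"
    have q: "q \<in> {a<..<c}" using True by (simp add: q_def)
    have cont: "continuous_on (closure {a<..<c}) g"
      unfolding g_def closure_greaterThanLessThan[OF True]
      by (intro continuous_on_diff trajectoryD(4)[OF traj] trajectoryD(4)[OF ref])
    have "g t = g q" if "t \<in> {a..c}" for t
    proof (rule continuous_constant_on_closure[OF cont])
      show "g s = g q" if "s \<in> {a<..<c}" for s
        using eq[of s q] eq[of q s] that q by (cases s q rule: linorder_cases) auto
    qed (use that True in \<open>auto simp: closure_greaterThanLessThan\<close>)
    then have "g t = g a" using t True by auto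
    then show ?thesis by (simp add: g_def)
  qed
qed

section \<open>Bang-bang trajectories\<close>

text \<open>
The trajectory with control \<open>\<sigma>\<close> up to time \<open>\<theta>\<close> and \<open>- \<sigma>\<close> afterwards that is at the origin at
time \<open>\<theta> + r\<close>; at the switching time its velocity is \<open>\<sigma> r\<close>. Both coordinates are
given by one formula for all times.
\<close>

definition bang_y :: "real \<Rightarrow> real \<Rightarrow> real \<Rightarrow> real \<Rightarrow> real" where
  "bang_y \<sigma> r \<theta> t = \<sigma> * (r - \<bar>t - \<theta>\<bar>)"

definition bang_x :: "real \<Rightarrow> real \<Rightarrow> real \<Rightarrow> real \<Rightarrow> real" where
  "bang_x \<sigma> r \<theta> t = \<sigma> * (r * (t - \<theta>) - (t - \<theta>) * \<bar>t - \<theta>\<bar> / 2 - r\<^sup>2 / 2)"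

lemma trajectoryI_affine:
  assumes "\<bar>\<sigma>\<bar> \<le> 1" and "\<And>t. t \<in> {a..c} \<Longrightarrow> y t = y0 + \<sigma> * t"
    and "\<And>t. t \<in> {a..c} \<Longrightarrow> x t = x0 + y0 * t + \<sigma> * t\<^sup>2 / 2"
  shows "trajectory a c x y"
proof (rule trajectory_cong[of a c "\<lambda>t. x0 + y0 * t + \<sigma> * t\<^sup>2 / 2" "\<lambda>t. y0 + \<sigma> * t"])
  show "trajectory a c (\<lambda>t. x0 + y0 * t + \<sigma> * t\<^sup>2 / 2) (\<lambda>t. y0 + \<sigma> * t)"
    unfolding trajectory_def
  proof (intro conjI ballI)
    show "1-lipschitz_on {a..c} (\<lambda>t. y0 + \<sigma> * t)"
    proof (rule lipschitz_onI)
      fix s t :: real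
      have "\<bar>\<sigma> * (s - t)\<bar> \<le> 1 * \<bar>s - t\<bar>"
        unfolding abs_mult by (rule mult_right_mono) (use assms(1) in auto)
      then show "dist (y0 + \<sigma> * s) (y0 + \<sigma> * t) \<le> 1 * dist s t"
        by (simp add: dist_real_def algebra_simps)
    qed simp
  qed (auto intro!: derivative_eq_intros)
qed (use assms in auto)

lemma trajectory_bang:
  assumes "\<sigma>\<^sup>2 = 1"
  shows "trajectory a c (bang_x \<sigma> r \<theta>) (bang_y \<sigma> r \<theta>)"
proof -
  have \<sigma>: "\<bar>\<sigma>\<bar> \<le> 1" using assms by (auto simp: power2_eq_1_iff)
  \<comment> \<open>For \<open>\<theta> < a\<close> the left piece degenerates to a single point, an affine motion with any slope.\<close>
  have "trajectory a (max a \<theta>) (bang_x \<sigma> r \<theta>) (bang_y \<sigma> r \<theta>)" if "a \<le> \<theta>"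
    by (rule trajectoryI_affine[of \<sigma> _ _ _ "\<sigma> * (r - \<theta>)" _ "\<sigma> * (\<theta>\<^sup>2 / 2 - r * \<theta> - r\<^sup>2 / 2)"])
       (use that \<sigma> in \<open>auto simp: bang_x_def bang_y_def power2_eq_square field_simps\<close>)
  then have "trajectory (min a \<theta>) \<theta> (bang_x \<sigma> r \<theta>) (bang_y \<sigma> r \<theta>)"
    by (cases "a \<le> \<theta>") (auto simp: trajectoryI_affine[of 0] max_def min_def
        intro: trajectoryI_affine[of 0 _ _ _ "bang_y \<sigma> r \<theta> \<theta>" _ "bang_x \<sigma> r \<theta> \<theta> - bang_y \<sigma> r \<theta> \<theta> * \<theta>"])
  moreover have "trajectory \<theta> (max c \<theta>) (bang_x \<sigma> r \<theta>) (bang_y \<sigma> r \<theta>)"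
    by (rule trajectoryI_affine[of "-\<sigma>" _ _ _ "\<sigma> * (r + \<theta>)" _ "- \<sigma> * (\<theta>\<^sup>2 / 2 + r * \<theta> + r\<^sup>2 / 2)"])
       (use \<sigma> in \<open>auto simp: bang_x_def bang_y_def power2_eq_square field_simps\<close>)
  ultimately show ?thesis
    by (rule trajectory_subset[OF trajectory_glue]) auto
qed

text \<open>
The start hypothesis is \<open>D a \<le> 0\<close> for the multipliers \<open>\<phi> = \<sigma>\<close>, \<open>\<psi> t = \<sigma> (\<theta> - t)\<close>. The weak form,
instead of equal starting points, allows the lemma to be applied from the end of a slide, where
the competitor is not yet known to agree with the reference.
\<close>

lemma bang_rigid:
  assumes traj: "trajectory a T x y" and \<sigma>: "\<sigma>\<^sup>2 = 1"
    and T: "T = \<theta> + r" "a \<le> \<theta>" "0 \<le> r" and end0: "x T = 0" "y T = 0"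
    and start: "\<sigma> * (x a - bang_x \<sigma> r \<theta> a + (\<theta> - a) * (y a - bang_y \<sigma> r \<theta> a)) \<le> 0"
    and t: "t \<in> {a..T}"
  shows "x t = bang_x \<sigma> r \<theta> t \<and> y t = bang_y \<sigma> r \<theta> t"
proof -
  let ?\<xi> = "bang_x \<sigma> r \<theta>" and ?\<eta> = "bang_y \<sigma> r \<theta>"
  define D where "D t = \<sigma> * (x t - ?\<xi> t) + \<sigma> * (\<theta> - t) * (y t - ?\<eta> t)" for t
  have \<sigma>\<sigma>: "\<sigma> * \<sigma> = 1" using \<sigma> by (simp add: power2_eq_square)
  have \<sigma>\<sigma>': "\<sigma> * (\<sigma> * z) = z" for z using \<sigma>\<sigma> by (simp flip: mult.assoc)
  have \<sigma>0: "\<sigma> \<noteq> 0" using \<sigma> by auto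
  have traj1: "trajectory a \<theta> x y" and traj2: "trajectory \<theta> T x y"
    using T by (auto intro: trajectory_subset[OF traj])
  note arc1 = arc_inequality[OF traj1 trajectory_bang[OF \<sigma>, of a \<theta> r \<theta>] \<sigma>, where \<phi>=\<sigma> and \<theta>=\<theta>, folded D_def]
  note arc2 = arc_inequality[OF traj2 trajectory_bang[OF \<sigma>, of \<theta> T r \<theta>], of "-\<sigma>", where \<phi>=\<sigma> and \<theta>=\<theta>, folded D_def]
  have slope1: "?\<eta> t - ?\<eta> s = \<sigma> * (t - s)" if "s \<in> {a..\<theta>}" "t \<in> {a..\<theta>}" for s t
    using that by (auto simp: bang_y_def algebra_simps)
  have slope2: "?\<eta> t - ?\<eta> s = - \<sigma> * (t - s)" if "s \<in> {\<theta>..T}" "t \<in> {\<theta>..T}" for s t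
    using that by (auto simp: bang_y_def algebra_simps)
  have sign1: "0 \<le> \<sigma> * (\<sigma> * (\<theta> - t))" if "t \<in> {a..\<theta>}" for t using that by (simp add: \<sigma>\<sigma>')
  have sign2: "0 \<le> - \<sigma> * (\<sigma> * (\<theta> - t))" if "t \<in> {\<theta>..T}" for t using that by (simp add: \<sigma>\<sigma>')
  have bT: "?\<xi> T = 0" "?\<eta> T = 0"
    using T by (auto simp: bang_x_def bang_y_def power2_eq_square)
  have D0: "D a \<le> 0" using start by (simp add: D_def algebra_simps)
  have DT: "D T = 0" by (simp add: D_def end0 bT)
  have D1: "D \<theta> \<le> D a" using arc1(1)[OF slope1 sign1, of a \<theta>] T by auto
  have D2: "D T \<le> D \<theta>" using arc2(1)[OF _ slope2 sign2, of \<theta> T] T \<sigma> by auto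
  have g2: "y t - ?\<eta> t = y \<theta> - ?\<eta> \<theta>" if "t \<in> {\<theta>..T}" for t
    using arc2(2)[OF _ slope2 sign2, of t] that \<sigma> \<sigma>0 D0 DT D1 D2 by auto
  have g1: "y t - ?\<eta> t = y a - ?\<eta> a" if "t \<in> {a..\<theta>}" for t
    using arc1(2)[OF slope1 sign1, of t] that \<sigma>0 D0 DT D1 D2 by auto
  have g\<theta>: "y \<theta> - ?\<eta> \<theta> = 0" using g2[of T] T end0 bT by auto
  have g: "y t = ?\<eta> t" if "t \<in> {a..T}" for t
    using g2[of t] g1[of t] g1[of \<theta>] g\<theta> that T by (cases "t \<le> \<theta>") auto
  have "\<exists>c. \<forall>t\<in>{a..T}. x t - ?\<xi> t = c"
  proof (rule has_field_derivative_zero_constant)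
    fix s assume "s \<in> {a..T}"
    then show "((\<lambda>t. x t - ?\<xi> t) has_real_derivative 0) (at s within {a..T})"
      using DERIV_diff[OF trajectoryD(2)[OF traj, of s] trajectoryD(2)[OF trajectory_bang[OF \<sigma>, of a T r \<theta>], of s]] g[of s]
      by simp
  qed simp
  then obtain c where "\<And>t. t \<in> {a..T} \<Longrightarrow> x t - ?\<xi> t = c" by blast
  from this[OF t] this[of T] show ?thesis using g[OF t] end0 bT t by simp
qed

lemma trajectory_extend_zero:
  assumes "trajectory a c x y" "x c = 0" "y c = 0" "a \<le> c"
  shows "trajectory a d (\<lambda>t. if t \<le> c then x t else 0) (\<lambda>t. if t \<le> c then y t else 0)"
proof (rule trajectory_glue[of _ c])
  show "trajectory a c (\<lambda>t. if t \<le> c then x t else 0) (\<lambda>t. if t \<le> c then y t else 0)"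
    by (rule trajectory_cong[OF assms(1)]) auto
  show "trajectory c d (\<lambda>t. if t \<le> c then x t else 0) (\<lambda>t. if t \<le> c then y t else 0)"
    by (rule trajectoryI_affine[of 0 _ _ _ 0 _ 0]) (use assms in auto)
qed

text \<open>
The process \<open>(x, y, u)\<close> of duration \<open>T'\<close> is the reference \<open>(\<xi>, \<eta>, v)\<close> of duration \<open>T\<close>: the states agree
on \<open>[0, T]\<close>, the controls almost everywhere. Values outside \<open>[0, T]\<close> are irrelevant.
\<close>

definition follows ::
  "real \<Rightarrow> (real \<Rightarrow> real) \<Rightarrow> (real \<Rightarrow> real) \<Rightarrow> (real \<Rightarrow> real) \<Rightarrow>
   real \<Rightarrow> (real \<Rightarrow> real) \<Rightarrow> (real \<Rightarrow> real) \<Rightarrow> (real \<Rightarrow> real) \<Rightarrow> bool" where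
  "follows T \<xi> \<eta> v T' x y u \<longleftrightarrow> T' = T \<and> (\<forall>t\<in>{0..T}. x t = \<xi> t \<and> y t = \<eta> t) \<and>
     (AE t in lebesgue_on {0..T}. u t = v t)"

lemma follows_refl: "follows T \<xi> \<eta> v T \<xi> \<eta> v"
  by (simp add: follows_def)

text \<open>
If the reference is the only trajectory of duration \<open>T\<close> in \<open>K\<close> with the given end points, and it
does not stand at the origin between \<open>\<theta>\<close> and \<open>T\<close>, then the optimal processes are exactly
those that follow it: a competitor that arrives early could rest at the origin until \<open>T\<close> and would then
be a second such trajectory.
\<close>

lemma time_optimal_iff_follows:
  fixes \<xi> \<eta> v :: "real \<Rightarrow> real" and K :: "(real \<times> real) set"
  defines "adm \<equiv> \<lambda>P T x y u. free_process P T x y u \<and> (\<forall>t\<in>{0..T}. (x t, y t) \<in> K)"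
  assumes T: "0 \<le> T" and traj: "trajectory 0 T \<xi> \<eta>"
    and S: "finite S" and v: "v \<in> borel_measurable borel"
    and vy: "\<And>t. t \<in> {0<..<T} - S \<Longrightarrow> (\<eta> has_real_derivative v t) (at t)"
    and ends: "(\<xi> 0, \<eta> 0) = P" "\<xi> T = 0" "\<eta> T = 0"
    and K: "\<And>t. t \<in> {0..T} \<Longrightarrow> (\<xi> t, \<eta> t) \<in> K" "(0, 0) \<in> K"
    and moving: "T = 0 \<or> \<theta> < T" "\<And>t. t \<in> {\<theta>..<T} \<Longrightarrow> \<eta> t \<noteq> 0"
    and rigid: "\<And>x y t. \<lbrakk>trajectory 0 T x y; (x 0, y 0) = P; x T = 0; y T = 0;
       \<And>t. t \<in> {0..T} \<Longrightarrow> (x t, y t) \<in> K; t \<in> {0..T}\<rbrakk> \<Longrightarrow> x t = \<xi> t \<and> y t = \<eta> t"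
  shows "time_optimal (adm P) T' x y u \<longleftrightarrow> follows T \<xi> \<eta> v T' x y u"
proof -
  have vx: "t \<in> {0<..<T} - S \<Longrightarrow> (y has_real_derivative v t) (at t)"
    if "\<And>t. t \<in> {0..T} \<Longrightarrow> y t = \<eta> t" for t y
    by (rule has_field_derivative_transform_within_open[OF vy, of _ "{0<..<T}"])
       (use that in auto)
  have adm: "adm P T x y u" if "\<And>t. t \<in> {0..T} \<Longrightarrow> x t = \<xi> t \<and> y t = \<eta> t"
    "AE t in lebesgue_on {0..T}. u t = v t" for x y u
  proof -
    have "free_process P T x y u"
      by (rule free_processI[OF T _ S v])
         (use that T ends in \<open>auto intro: vx trajectory_cong[OF traj]\<close>)
    then show ?thesis using that(1) K by (auto simp: adm_def)
  qed
  have min: "T' = T \<and> (\<forall>t\<in>{0..T}. x t = \<xi> t \<and> y t = \<eta> t)"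
    if p: "adm P T' x y u" and le: "T' \<le> T" for T' x y u
  proof -
    have fp: "free_process P T' x y u" and xK: "\<And>t. t \<in> {0..T'} \<Longrightarrow> (x t, y t) \<in> K"
      using p by (auto simp: adm_def)
    note P = free_process_trajectory[OF fp]
    define x1 y1 where "x1 t = (if t \<le> T' then x t else 0)" 
      and "y1 t = (if t \<le> T' then y t else 0)" for t
    \<comment> \<open>A competitor that is not slower is prolonged by rest at the origin.\<close>
    have eq: "x1 t = \<xi> t \<and> y1 t = \<eta> t" if "t \<in> {0..T}" for t
    proof (rule rigid[OF _ _ _ _ _ that])
      show "trajectory 0 T x1 y1"
        using trajectory_extend_zero[OF P(2,4,5,1), of T] unfolding x1_def y1_def .
      show "(x1 t, y1 t) \<in> K" if "t \<in> {0..T}" for t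
        using xK K(2) that by (auto simp: x1_def y1_def)
    qed (use P le in \<open>auto simp: x1_def y1_def\<close>)
    have "T' = T"
    proof (rule ccontr)
      assume "T' \<noteq> T"
      then have lt: "T' < T" using le by simp
      let ?t = "max T' \<theta>"
      have "?t \<in> {\<theta>..<T}" "?t \<in> {0..T}" using moving(1) lt P(1) by auto
      moreover have "y1 ?t = 0" using P(5) by (auto simp: y1_def max_def)
      ultimately show False using eq[of ?t] moving(2)[of ?t] by auto
    qed
    then show ?thesis using eq by (auto simp: x1_def y1_def)
  qed
  show ?thesis
  proof
    assume opt: "time_optimal (adm P) T' x y u"
    then have p: "adm P T' x y u" by (simp add: time_optimal_def)
    have "adm P T \<xi> \<eta> v" by (rule adm) auto
    then have "T' \<le> T" using opt by (auto simp: time_optimal_def)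
    with min[OF p] have *: "T' = T" "\<And>t. t \<in> {0..T} \<Longrightarrow> x t = \<xi> t \<and> y t = \<eta> t" by auto
    moreover have "AE t in lebesgue_on {0..T}. u t = v t"
    proof (rule free_process_control_AE[OF _ S])
      show "free_process P T x y u" using p * by (simp add: adm_def)
      show "(y has_real_derivative v t) (at t)" if "t \<in> {0<..<T} - S" for t
        using vx[of y t] * that by blast
    qed
    ultimately show "follows T \<xi> \<eta> v T' x y u" by (simp add: follows_def)
  next
    assume "follows T \<xi> \<eta> v T' x y u"
    then have f: "T' = T" "\<And>t. t \<in> {0..T} \<Longrightarrow> x t = \<xi> t \<and> y t = \<eta> t"
      "AE t in lebesgue_on {0..T}. u t = v t" by (auto simp: follows_def)
    show "time_optimal (adm P) T' x y u"
      unfolding time_optimal_def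
    proof (intro conjI allI impI)
      show "adm P T' x y u" unfolding f(1) by (rule adm[OF f(2,3)])
      show "T' \<le> T''" if "adm P T'' x'' y'' u''" for T'' x'' y'' u''
        using min[OF that] f(1) by (cases "T'' \<le> T") auto
    qed
  qed
qed

section \<open>The free problem and the region \<open>\<Omega>\<^sub>1\<close>\<close>

text \<open>
The set allowed by the state constraint.
\<close>

definition halfplane :: "real \<Rightarrow> real \<Rightarrow> (real \<times> real) set" where
  "halfplane k b = {(x, y). k * x - b \<le> y}"

lemma zero_in_halfplane: "0 < b \<Longrightarrow> (0, 0) \<in> halfplane k b"
  by (simp add: halfplane_def)

lemma constrained_process_halfplane:
  "constrained_process k b P =
     (\<lambda>T x y u. free_process P T x y u \<and> (\<forall>t\<in>{0..T}. (x t, y t) \<in> halfplane k b))"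
  by (simp add: constrained_process_def halfplane_def fun_eq_iff)

lemma free_process_UNIV:
  "free_process P = (\<lambda>T x y u. free_process P T x y u \<and> (\<forall>t\<in>{0..T}. (x t, y t) \<in> UNIV))"
  by simp

text \<open>
The control of the bang-bang trajectory. Its value at the switching time is immaterial.
\<close>

definition bang_u :: "real \<Rightarrow> real \<Rightarrow> real \<Rightarrow> real" where
  "bang_u \<sigma> \<theta> t = (if t < \<theta> then \<sigma> else - \<sigma>)"

lemma DERIV_bang_y:
  assumes "t \<noteq> \<theta>"
  shows "(bang_y \<sigma> r \<theta> has_real_derivative bang_u \<sigma> \<theta> t) (at t)"
proof (cases "t < \<theta>")
  case True
  show ?thesis
    by (rule has_field_derivative_transform_within_open[of "\<lambda>t. \<sigma> * (r - (\<theta> - t))" _ _ "{..<\<theta>}"])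
       (use True in \<open>auto simp: bang_y_def bang_u_def intro!: derivative_eq_intros\<close>)
next
  case False
  show ?thesis
    by (rule has_field_derivative_transform_within_open[of "\<lambda>t. \<sigma> * (r - (t - \<theta>))" _ _ "{\<theta><..}"])
       (use False assms in \<open>auto simp: bang_y_def bang_u_def intro!: derivative_eq_intros\<close>)
qed

lemma bang_end: "bang_x \<sigma> r \<theta> (\<theta> + r) = 0" "bang_y \<sigma> r \<theta> (\<theta> + r) = 0" if "0 \<le> r"
  using that by (auto simp: bang_x_def bang_y_def power2_eq_square)

lemma time_optimal_iff_follows_bang:
  assumes \<sigma>: "\<sigma>\<^sup>2 = 1" and \<theta>: "0 \<le> \<theta>" and r: "0 \<le> r" "0 < r \<or> \<theta> = 0"
    and K: "\<And>t. t \<in> {0..\<theta> + r} \<Longrightarrow> (bang_x \<sigma> r \<theta> t, bang_y \<sigma> r \<theta> t) \<in> K" "(0, 0) \<in> K"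
  shows "time_optimal (\<lambda>T x y u. free_process (bang_x \<sigma> r \<theta> 0, bang_y \<sigma> r \<theta> 0) T x y u \<and>
            (\<forall>t\<in>{0..T}. (x t, y t) \<in> K)) T' x y u \<longleftrightarrow>
         follows (\<theta> + r) (bang_x \<sigma> r \<theta>) (bang_y \<sigma> r \<theta>) (bang_u \<sigma> \<theta>) T' x y u"
proof (rule time_optimal_iff_follows[where S = "{\<theta>}" and \<theta> = \<theta>])
  show "bang_u \<sigma> \<theta> \<in> borel_measurable borel"
    unfolding bang_u_def by measurable
  show "bang_y \<sigma> r \<theta> t \<noteq> 0" if "t \<in> {\<theta>..<\<theta> + r}" for t
    using that \<sigma> by (auto simp: bang_y_def)
  fix x y :: "real \<Rightarrow> real" and t
  assume *: "trajectory 0 (\<theta> + r) x y" "(x 0, y 0) = (bang_x \<sigma> r \<theta> 0, bang_y \<sigma> r \<theta> 0)"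
    "x (\<theta> + r) = 0" "y (\<theta> + r) = 0" "t \<in> {0..\<theta> + r}"
  show "x t = bang_x \<sigma> r \<theta> t \<and> y t = bang_y \<sigma> r \<theta> t"
    by (rule bang_rigid[OF *(1) \<sigma> _ _ r(1) *(3,4) _ *(5)]) (use * \<theta> in auto)
qed (use \<theta> r K in \<open>auto simp: trajectory_bang[OF \<sigma>] DERIV_bang_y bang_end\<close>)

text \<open>
Every point is the start of a bang-bang trajectory: with \<open>\<sigma> = - 1\<close> above the switching curve and on
its branch \<open>y < 0\<close>, with \<open>\<sigma> = 1\<close> elsewhere. The case \<open>\<theta> > 0 = r\<close> is excluded, because there the
trajectory would arrive at the origin without a second arc.
\<close>

lemma ex_bang_from:
  obtains \<sigma> r \<theta> where "\<sigma>\<^sup>2 = 1" "0 \<le> \<theta>" "0 \<le> r" "0 < r \<or> \<theta> = 0"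
    "P = (bang_x \<sigma> r \<theta> 0, bang_y \<sigma> r \<theta> 0)"
proof -
  note found = that
  obtain x0 y0 where P: "P = (x0, y0)" by (cases P)
  have start: thesis if \<sigma>: "\<sigma> = 1 \<or> \<sigma> = -1" and c: "0 \<le> y0\<^sup>2 / 2 - \<sigma> * x0"
    and \<theta>: "\<sigma> * y0 \<le> sqrt (y0\<^sup>2 / 2 - \<sigma> * x0)"
    and r: "0 < y0\<^sup>2 / 2 - \<sigma> * x0 \<or> \<sigma> * y0 = 0" for \<sigma>
  proof -
    \<comment> \<open>The first arc lies on a parabola \<open>x = \<sigma> (y\<^sup>2 / 2 - r\<^sup>2)\<close>, which fixes \<open>r\<close>.\<close>
    define r where "r = sqrt (y0\<^sup>2 / 2 - \<sigma> * x0)"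
    define \<theta> where "\<theta> = r - \<sigma> * y0"
    have r2: "r\<^sup>2 = y0\<^sup>2 / 2 - \<sigma> * x0" using c by (simp add: r_def)
    have \<theta>0: "0 \<le> \<theta>" using \<theta> by (simp add: \<theta>_def r_def)
    have r0: "0 \<le> r" using c by (simp add: r_def)
    have "y0 = bang_y \<sigma> r \<theta> 0"
      using \<sigma> \<theta>0 by (auto simp: bang_y_def \<theta>_def)
    moreover have "bang_x \<sigma> r \<theta> 0 = \<sigma> * (\<theta>\<^sup>2 / 2 - r * \<theta> - r\<^sup>2 / 2)"
      using \<theta>0 by (simp add: bang_x_def power2_eq_square algebra_simps)
    moreover have "\<sigma> * (\<theta>\<^sup>2 / 2 - r * \<theta> - r\<^sup>2 / 2) = \<sigma> * (y0\<^sup>2 / 2 - r\<^sup>2)"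
      using \<sigma> by (auto simp: \<theta>_def power2_eq_square field_simps)
    moreover have "\<dots> = x0" using \<sigma> by (auto simp: r2)
    moreover have "0 < r \<or> \<theta> = 0"
    proof (cases "0 < y0\<^sup>2 / 2 - \<sigma> * x0")
      case True
      then show ?thesis by (simp add: r_def)
    next
      case False
      then have "\<sigma> * y0 = 0" "y0\<^sup>2 / 2 - \<sigma> * x0 = 0" using r c by auto
      then show ?thesis by (simp add: \<theta>_def r_def)
    qed
    ultimately show thesis
      using found[of \<sigma> \<theta> r] \<sigma> r0 \<theta>0 P by auto
  qed
  have sq: "y0 \<le> sqrt (y0\<^sup>2)" "- y0 \<le> sqrt (y0\<^sup>2)" by auto
  show thesis
  proof (cases "(0 \<le> y0 \<and> 0 < x0 + y0\<^sup>2 / 2) \<or> (y0 < 0 \<and> y0\<^sup>2 / 2 \<le> x0)")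
    case True
    show thesis
    proof (rule start[of "-1"])
      have pos: "0 < y0\<^sup>2 / 2 + x0" using True
      proof
        assume "y0 < 0 \<and> y0\<^sup>2 / 2 \<le> x0"
        moreover have "0 < y0\<^sup>2" if "y0 < 0" using that by simp
        ultimately show ?thesis by linarith
      qed auto
      show "0 \<le> y0\<^sup>2 / 2 - (-1) * x0" "0 < y0\<^sup>2 / 2 - (-1) * x0 \<or> -1 * y0 = 0" using pos by auto
      show "-1 * y0 \<le> sqrt (y0\<^sup>2 / 2 - (-1) * x0)"
      proof (cases "0 \<le> y0")
        case True
        have "0 \<le> sqrt (y0\<^sup>2 / 2 - (-1) * x0)" using pos by simp
        then show ?thesis using True by linarith
      next
        case False
        then have "sqrt (y0\<^sup>2) \<le> sqrt (y0\<^sup>2 / 2 - (-1) * x0)"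
          using True by (intro real_sqrt_le_mono) auto
        then show ?thesis using sq by linarith
      qed
    qed simp
  next
    case False
    show thesis
    proof (rule start[of 1])
      show nn: "0 \<le> y0\<^sup>2 / 2 - 1 * x0"
      proof (cases "0 \<le> y0")
        case True
        then have "x0 + y0\<^sup>2 / 2 \<le> 0" using False by simp
        moreover have "0 \<le> y0\<^sup>2" by simp
        ultimately show ?thesis by linarith
      qed (use False in auto)
      show "1 * y0 \<le> sqrt (y0\<^sup>2 / 2 - 1 * x0)"
      proof (cases "0 \<le> y0")
        case True
        then have "sqrt (y0\<^sup>2) \<le> sqrt (y0\<^sup>2 / 2 - 1 * x0)"
          using False by (intro real_sqrt_le_mono) auto
        then show ?thesis using sq by linarith
      next
        case False
        have "0 \<le> sqrt (y0\<^sup>2 / 2 - 1 * x0)" using nn by simp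
        then show ?thesis using False by linarith
      qed
      show "0 < y0\<^sup>2 / 2 - 1 * x0 \<or> 1 * y0 = 0"
      proof (cases "0 < y0")
        case True
        then have "x0 + y0\<^sup>2 / 2 \<le> 0" "0 < y0\<^sup>2" using False by auto
        then show ?thesis by linarith
      qed (use False in auto)
    qed simp
  qed
qed

lemma bang_first_arc:
  assumes "\<sigma>\<^sup>2 = 1" "t \<le> \<theta>"
  shows "bang_x \<sigma> r \<theta> t = \<sigma> * ((bang_y \<sigma> r \<theta> t)\<^sup>2 / 2 - r\<^sup>2)"
proof -
  have sq: "(bang_y \<sigma> r \<theta> t)\<^sup>2 = (r - (\<theta> - t))\<^sup>2"
    using assms by (simp add: bang_y_def power_mult_distrib)
  show ?thesis unfolding sq using assms(2)
    by (simp add: bang_x_def power2_eq_square field_simps)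
qed

lemma bang_second_arc:
  assumes "\<sigma>\<^sup>2 = 1" "\<theta> \<le> t"
  shows "bang_x \<sigma> r \<theta> t = - \<sigma> * (bang_y \<sigma> r \<theta> t)\<^sup>2 / 2"
proof -
  have sq: "(bang_y \<sigma> r \<theta> t)\<^sup>2 = (r - (t - \<theta>))\<^sup>2"
    using assms by (simp add: bang_y_def power_mult_distrib)
  show ?thesis unfolding sq using assms(2)
    by (simp add: bang_x_def power2_eq_square field_simps)
qed

text \<open>
Write \<open>f = y - k x + b\<close>. With \<open>u = - 1\<close> a motion that starts at height at least \<open>- 1 / k\<close> lies to the left
of the tangent parabola, where \<open>f \<ge> 0\<close>; one that starts lower has \<open>f\<close> increasing. With \<open>u = 1\<close> the
function \<open>f\<close> increases while \<open>y \<le> 0\<close>. Wherever \<open>x \<le> 0 \<le> y\<close> the constraint holds because \<open>b > 0\<close>.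
\<close>

lemma bang_in_halfplane:
  assumes k: "0 < k" and b: "0 < b" and \<sigma>: "\<sigma>\<^sup>2 = 1" and \<theta>: "0 \<le> \<theta>" and r: "0 \<le> r"
    and P: "(bang_x \<sigma> r \<theta> 0, bang_y \<sigma> r \<theta> 0) \<in> Omega1 k b" and t: "t \<in> {0..\<theta> + r}"
  shows "(bang_x \<sigma> r \<theta> t, bang_y \<sigma> r \<theta> t) \<in> halfplane k b"
proof -
  define Y where "Y = bang_y \<sigma> r \<theta>"
  define X where "X = bang_x \<sigma> r \<theta>"
  have P1: "k * X 0 - b \<le> Y 0" and P2: "- 1 / k \<le> Y 0 \<Longrightarrow> X 0 \<le> - (1/2) * (Y 0)\<^sup>2 + tangent_const k b"
    using P by (auto simp: Omega1_def X_def Y_def)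
  have arc1: "X t = \<sigma> * ((Y t)\<^sup>2 / 2 - r\<^sup>2)" if "t \<le> \<theta>" for t
    using bang_first_arc[OF \<sigma> that] by (simp add: X_def Y_def)
  have arc2: "X t = - \<sigma> * (Y t)\<^sup>2 / 2" if "\<theta> \<le> t" for t
    using bang_second_arc[OF \<sigma> that] by (simp add: X_def Y_def)
  have pos: ?thesis if "X t \<le> 0" "0 \<le> Y t"
  proof -
    have "k * X t \<le> 0" using k that by (simp add: mult_nonneg_nonpos)
    then show ?thesis using that b by (simp add: halfplane_def X_def Y_def)
  qed
  consider "\<sigma> = 1" | "\<sigma> = - 1" using \<sigma> by (auto simp: power2_eq_1_iff)
  then show ?thesis
  proof cases
    case 1
    show ?thesis
    proof (cases "\<theta> \<le> t \<or> 0 \<le> Y t")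
      case True
      have Y0: "0 \<le> Y t" using True t 1 by (auto simp: Y_def bang_y_def)
      have "X t \<le> 0"
      proof (cases "\<theta> \<le> t")
        case True then show ?thesis using arc2[OF True] \<open>\<sigma> = 1\<close> by simp
      next
        case False
        then have "Y t \<le> r" using \<open>\<sigma> = 1\<close> by (simp add: Y_def bang_y_def)
        then have "(Y t)\<^sup>2 \<le> r\<^sup>2" using Y0 by (intro power_mono)
        moreover have "0 \<le> r\<^sup>2" by simp
        moreover have "X t = (Y t)\<^sup>2 / 2 - r\<^sup>2" using arc1[of t] False \<open>\<sigma> = 1\<close> by simp
        ultimately show ?thesis by linarith
      qed
      then show ?thesis using Y0 by (rule pos)
    next
      case False
      then have t\<theta>: "t \<le> \<theta>" and Yt: "Y t < 0" by auto
      have le: "Y 0 \<le> Y t" using t\<theta> \<theta> t 1 by (auto simp: Y_def bang_y_def)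
      have "Y t - k * X t + b - (Y 0 - k * X 0 + b) = (Y t - Y 0) * (1 - k / 2 * (Y t + Y 0))"
        using 1 arc1[OF t\<theta>] arc1[OF \<theta>] by simp (simp add: power2_eq_square field_simps)
      moreover have "k / 2 * (Y t + Y 0) \<le> 0"
        using k le Yt by (intro mult_nonneg_nonpos) auto
      then have "0 \<le> (Y t - Y 0) * (1 - k / 2 * (Y t + Y 0))"
        using le by (intro mult_nonneg_nonneg) auto
      ultimately show ?thesis using P1 by (simp add: halfplane_def X_def Y_def)
    qed
  next
    case neg: 2
    have first: "0 \<le> Y t - k * X t + b" if t: "0 \<le> t" "t \<le> \<theta>" for t
    proof (cases "- 1 / k \<le> Y 0")
      case True
      have "X 0 = r\<^sup>2 - (Y 0)\<^sup>2 / 2" using arc1[of 0] \<theta> neg by simp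
      then have "r\<^sup>2 \<le> tangent_const k b" using P2[OF True] by simp
      then have "0 \<le> k * (tangent_const k b - r\<^sup>2) + k / 2 * (Y t + 1 / k)\<^sup>2" using k by simp
      also have "\<dots> = Y t - k * (r\<^sup>2 - (Y t)\<^sup>2 / 2) + b"
        using k by (simp add: tangent_const_def power2_eq_square field_simps)
      finally show ?thesis using arc1[OF t(2)] neg by simp
    next
      case False
      have le: "Y t \<le> Y 0" using t \<theta> neg by (auto simp: Y_def bang_y_def)
      have "Y t - k * X t + b - (Y 0 - k * X 0 + b) = (Y t - Y 0) * (1 + k / 2 * (Y t + Y 0))"
        unfolding arc1[OF t(2)] arc1[OF \<theta>] neg by (simp add: power2_eq_square field_simps)
      moreover have "1 + k / 2 * (Y t + Y 0) \<le> 0"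
      proof -
        have "k * Y 0 < -1" using False k by (simp add: field_simps)
        moreover have "k * Y t \<le> k * Y 0" using le k by simp
        ultimately have "k * Y t + k * Y 0 \<le> - 2" by linarith
        then show ?thesis by (simp add: distrib_left field_simps)
      qed
      then have "0 \<le> (Y t - Y 0) * (1 + k / 2 * (Y t + Y 0))"
        using le by (intro mult_nonpos_nonpos) auto
      ultimately show ?thesis using P1 by simp
    qed
    show ?thesis
    proof (cases "t \<le> \<theta>")
      case True
      then show ?thesis using first[of t] t by (simp add: halfplane_def X_def Y_def)
    next
      case False
      have Y\<theta>: "Y \<theta> = - r" using neg by (simp add: Y_def bang_y_def)
      have le: "Y \<theta> \<le> Y t" "Y t \<le> 0" using False t neg by (auto simp: Y_def bang_y_def)
      have "Y t - k * X t + b - (Y \<theta> - k * X \<theta> + b) = (Y t - Y \<theta>) * (1 - k / 2 * (Y t + Y \<theta>))"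
        using arc2[of t] arc2[of \<theta>] False neg by simp (simp add: power2_eq_square field_simps)
      moreover have "k / 2 * (Y t + Y \<theta>) \<le> 0"
        using k le by (intro mult_nonneg_nonpos) auto
      then have "0 \<le> (Y t - Y \<theta>) * (1 - k / 2 * (Y t + Y \<theta>))"
        using le by (intro mult_nonneg_nonneg) auto
      ultimately show ?thesis using first[of \<theta>] \<theta> by (simp add: halfplane_def X_def Y_def)
    qed
  qed
qed

proposition Omega1_synthesis:
  assumes "0 < k" "0 < b" "P \<in> Omega1 k b"
  shows "\<exists>T x y u. constrained_optimal k b P T x y u"
    and "constrained_optimal k b P T x y u \<longleftrightarrow> free_optimal P T x y u"
proof -
  obtain \<sigma> r \<theta> where *: "\<sigma>\<^sup>2 = 1" "0 \<le> \<theta>" "0 \<le> r" "0 < r \<or> \<theta> = 0"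
    and P: "P = (bang_x \<sigma> r \<theta> 0, bang_y \<sigma> r \<theta> 0)"
    using ex_bang_from by blast
  note iff = time_optimal_iff_follows_bang[OF *]
  have c: "constrained_optimal k b P T x y u \<longleftrightarrow>
    follows (\<theta> + r) (bang_x \<sigma> r \<theta>) (bang_y \<sigma> r \<theta>) (bang_u \<sigma> \<theta>) T x y u" for T x y u
    unfolding constrained_process_halfplane P
    by (intro iff bang_in_halfplane zero_in_halfplane) (use assms * P in auto)
  have f: "free_optimal P T x y u \<longleftrightarrow>
    follows (\<theta> + r) (bang_x \<sigma> r \<theta>) (bang_y \<sigma> r \<theta>) (bang_u \<sigma> \<theta>) T x y u"
    unfolding P by (subst free_process_UNIV) (intro iff UNIV_I)
  show "constrained_optimal k b P T x y u \<longleftrightarrow> free_optimal P T x y u"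
    by (simp only: c f)
  show "\<exists>T x y u. constrained_optimal k b P T x y u"
    unfolding c by (intro exI) (rule follows_refl)
qed

section \<open>The trajectory that slides along the boundary line\<close>

text \<open>
The trajectory with control \<open>u = - 1\<close> until it meets the line \<open>y = k x - b\<close> at height \<open>- p\<close> at time
\<open>t1\<close>, with \<open>u = k y\<close> along the line until height \<open>- 1 / k\<close> (the point \<open>C\<close>) at time
\<open>slide_end\<close>, and then bang-bang with a switch at time \<open>slide_switch\<close> (the point \<open>B\<close>) to the origin at time
\<open>slide_time\<close>. It is parametrised by \<open>p\<close> and \<open>t1\<close>; the starting point is determined by them.
On the line \<open>y' = k y\<close>, so \<open>y = - p exp (k (t - t1))\<close>, which gives the logarithm.
\<close>

definition slide_end :: "real \<Rightarrow> real \<Rightarrow> real \<Rightarrow> real" where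
  "slide_end k p t1 = t1 + ln (1 / (k * p)) / k"

text \<open>
The distance of \<open>B\<close> from the axis \<open>y = 0\<close>, equal to the duration of the last arc.
\<close>

definition tangent_radius :: "real \<Rightarrow> real \<Rightarrow> real" where
  "tangent_radius k b = sqrt (tangent_const k b)"

definition slide_switch :: "real \<Rightarrow> real \<Rightarrow> real \<Rightarrow> real \<Rightarrow> real" where
  "slide_switch k b p t1 = slide_end k p t1 + (tangent_radius k b - 1 / k)"

definition slide_time :: "real \<Rightarrow> real \<Rightarrow> real \<Rightarrow> real \<Rightarrow> real" where
  "slide_time k b p t1 = slide_switch k b p t1 + tangent_radius k b"

definition slide_y :: "real \<Rightarrow> real \<Rightarrow> real \<Rightarrow> real \<Rightarrow> real \<Rightarrow> real" where
  "slide_y k b p t1 t =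
     (if t \<le> t1 then - p + (t1 - t)
      else if t \<le> slide_end k p t1 then - p * exp (k * (t - t1))
      else bang_y (-1) (tangent_radius k b) (slide_switch k b p t1) t)"

definition slide_x :: "real \<Rightarrow> real \<Rightarrow> real \<Rightarrow> real \<Rightarrow> real \<Rightarrow> real" where
  "slide_x k b p t1 t =
     (if t \<le> t1 then (b - p) / k + p\<^sup>2 / 2 - (- p + (t1 - t))\<^sup>2 / 2
      else if t \<le> slide_end k p t1 then (- p * exp (k * (t - t1)) + b) / k
      else bang_x (-1) (tangent_radius k b) (slide_switch k b p t1) t)"

definition slide_u :: "real \<Rightarrow> real \<Rightarrow> real \<Rightarrow> real \<Rightarrow> real \<Rightarrow> real" where
  "slide_u k b p t1 t =
     (if t < t1 then - 1
      else if t < slide_end k p t1 then k * (- p * exp (k * (t - t1)))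
      else bang_u (-1) (slide_switch k b p t1) t)"

text \<open>
Here \<open>k b > 3 / 2\<close> says that \<open>C\<close> is above \<open>A\<close>, and \<open>0 < p < 1 / k\<close> that the trajectory meets the line
strictly between \<open>C\<close> and \<open>E\<close>. The case \<open>t1 = 0\<close> is a start on the line.
\<close>

locale sliding =
  fixes k b p t1 :: real
  assumes k: "0 < k" and kb: "3 / 2 < k * b" and p: "0 < p" "k * p < 1" and t1: "0 \<le> t1"
begin

abbreviation "t2 \<equiv> slide_end k p t1"
abbreviation "t3 \<equiv> slide_switch k b p t1"
abbreviation "T \<equiv> slide_time k b p t1"
abbreviation "r \<equiv> tangent_radius k b"
abbreviation "\<xi> \<equiv> slide_x k b p t1"
abbreviation "\<eta> \<equiv> slide_y k b p t1"
abbreviation "v \<equiv> slide_u k b p t1"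

lemma b_pos: "0 < b"
  using kb k zero_less_mult_pos[of k b] by linarith

lemma radius: "1 / k < r" "r\<^sup>2 = tangent_const k b"
proof -
  have "(1 / k)\<^sup>2 < tangent_const k b"
    using kb k by (simp add: tangent_const_def field_simps power2_eq_square)
  moreover have "0 \<le> (1 / k)\<^sup>2" by simp
  ultimately have "0 \<le> tangent_const k b" "(1 / k)\<^sup>2 < tangent_const k b" by linarith+
  then show "1 / k < r" "r\<^sup>2 = tangent_const k b"
    unfolding tangent_radius_def by (auto intro: real_less_rsqrt)
qed

lemma radius_pos: "0 < r"
  using radius(1) k by (meson less_trans zero_less_divide_1_iff)

lemma times: "0 \<le> t1" "t1 < t2" "t2 < t3" "t3 < T"
proof -
  have "1 < 1 / (k * p)" using k p by (simp add: field_simps)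
  then have "0 < ln (1 / (k * p))" by (rule ln_gt_zero)
  then show "t1 < t2" using k by (simp add: slide_end_def)
qed (use t1 radius radius_pos in \<open>auto simp: slide_switch_def slide_time_def\<close>)

lemma exp_end: "exp (k * (t2 - t1)) = 1 / (k * p)"
proof -
  have "k * (t2 - t1) = ln (1 / (k * p))" using k by (simp add: slide_end_def)
  then show ?thesis using k p by simp
qed

lemma exp_range:
  assumes "t \<in> {t1..t2}"
  shows "1 \<le> exp (k * (t - t1))" "k * p * exp (k * (t - t1)) \<le> 1"
proof -
  show "1 \<le> exp (k * (t - t1))" using assms k by simp
  have "exp (k * (t - t1)) \<le> 1 / (k * p)"
    unfolding exp_end[symmetric] using assms k by simp
  then show "k * p * exp (k * (t - t1)) \<le> 1"
    using k p by (simp add: field_simps)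
qed

lemma first_leg:
  assumes "t \<le> t1"
  shows "\<eta> t = - p + (t1 - t)" "\<xi> t = (b - p) / k + p\<^sup>2 / 2 - (\<eta> t)\<^sup>2 / 2"
  using assms by (auto simp: slide_x_def slide_y_def)

lemma second_leg:
  assumes "t \<in> {t1..t2}"
  shows "\<eta> t = - p * exp (k * (t - t1))" "\<xi> t = (\<eta> t + b) / k"
  using assms by (auto simp: slide_x_def slide_y_def)

lemma third_leg:
  assumes "t2 \<le> t"
  shows "\<eta> t = bang_y (-1) r t3 t" "\<xi> t = bang_x (-1) r t3 t"
proof -
  have y2: "- p * exp (k * (t2 - t1)) = - 1 / k"
    using k p by (simp add: exp_end)
  have y3: "bang_y (-1) r t3 t2 = - 1 / k"
    using radius k by (simp add: bang_y_def slide_switch_def)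
  have "bang_x (-1) r t3 t2 = r\<^sup>2 - (- 1 / k)\<^sup>2 / 2"
    using bang_first_arc[of "-1" t2 t3 r] times by (simp add: y3)
  also have "\<dots> = (- 1 / k + b) / k"
    unfolding radius(2) tangent_const_def using k by (simp add: field_simps power2_eq_square)
  finally have x3: "bang_x (-1) r t3 t2 = (- 1 / k + b) / k" .
  show "\<eta> t = bang_y (-1) r t3 t" "\<xi> t = bang_x (-1) r t3 t"
    using assms times x3 y3 y2 by (cases "t = t2"; simp add: slide_x_def slide_y_def)+
qed

lemma corner: "\<eta> t2 = - 1 / k"
  using second_leg(1)[of t2] times k p by (simp add: exp_end)

lemma start: "(\<xi> 0, \<eta> 0) = ((b - p) / k + p\<^sup>2 / 2 - (t1 - p)\<^sup>2 / 2, t1 - p)"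
  using t1 first_leg[of 0] by simp

lemma finish: "\<xi> T = 0" "\<eta> T = 0"
  using third_leg[of T] times radius_pos bang_end[of r] by (auto simp: slide_time_def)

lemma trajectory_slide: "trajectory a c \<xi> \<eta>" if "0 \<le> a" "c \<le> T"
proof -
  have "trajectory 0 t1 \<xi> \<eta>"
    by (rule trajectoryI_affine[of "-1" _ _ _ "t1 - p" _ "(b - p) / k + p\<^sup>2 / 2 - (t1 - p)\<^sup>2 / 2"])
       (auto simp: first_leg power2_eq_square field_simps)
  moreover have "trajectory t1 t2 \<xi> \<eta>"
  proof (rule trajectory_cong)
    let ?y = "\<lambda>t. - p * exp (k * (t - t1))"
    let ?x = "\<lambda>t. (?y t + b) / k"
    have dy: "(?y has_real_derivative k * ?y t) (at t within A)" for t A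
      by (auto intro!: derivative_eq_intros)
    show "trajectory t1 t2 ?x ?y" unfolding trajectory_def
    proof (intro conjI ballI)
      show "1-lipschitz_on {t1..t2} ?y"
      proof (rule lipschitz_onI)
        fix s t assume st: "s \<in> {t1..t2}" "t \<in> {t1..t2}"
        have "norm (?y s - ?y t) \<le> 1 * norm (s - t)"
        proof (rule field_differentiable_bound[OF _ dy])
          show "norm (k * ?y t) \<le> 1" if "t \<in> {t1..t2}" for t
            using exp_range[OF that] k p by (simp add: abs_mult mult.assoc)
        qed (use st in auto)
        then show "dist (?y s) (?y t) \<le> 1 * dist s t" by (simp add: dist_real_def)
      qed simp
      show "(?x has_real_derivative ?y t) (at t within {t1..t2})" for t
        using k by (auto intro!: derivative_eq_intros)
    qed
  qed (auto simp: second_leg)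
  moreover have "trajectory t2 T \<xi> \<eta>"
    by (rule trajectory_cong[OF trajectory_bang[of "-1"]]) (auto simp: third_leg)
  ultimately have "trajectory 0 T \<xi> \<eta>"
    by (blast intro: trajectory_glue)
  then show ?thesis using that by (rule trajectory_subset)
qed

lemma DERIV_slide_y:
  assumes t: "t \<notin> {t1, t2, t3}"
  shows "(\<eta> has_real_derivative v t) (at t)"
proof -
  consider "t < t1" | "t1 < t" "t < t2" | "t2 < t" using t by fastforce
  then show ?thesis
  proof cases
    case 1
    show ?thesis
      by (rule has_field_derivative_transform_within_open[of "\<lambda>t. - p + (t1 - t)" _ _ "{..<t1}"])
         (use 1 in \<open>auto simp: slide_y_def slide_u_def intro!: derivative_eq_intros\<close>)
  next
    case 2
    show ?thesis
      by (rule has_field_derivative_transform_within_open[of "\<lambda>t. - p * exp (k * (t - t1))" _ _ "{t1<..<t2}"])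
         (use 2 in \<open>auto simp: slide_y_def slide_u_def intro!: derivative_eq_intros\<close>)
  next
    case 3
    have "(bang_y (-1) r t3 has_real_derivative v t) (at t)"
      using DERIV_bang_y[of t t3 "-1" r] t 3 times by (simp add: slide_u_def)
    then show ?thesis
      by (rule has_field_derivative_transform_within_open[of _ _ _ "{t2<..}"])
         (use 3 in \<open>auto simp: third_leg\<close>)
  qed
qed

lemma slide_u_measurable: "v \<in> borel_measurable borel"
  unfolding slide_u_def bang_u_def by measurable

lemma first_leg_gap:
  assumes "t \<le> t1"
  shows "\<eta> t - (k * \<xi> t - b) = (t1 - t) * (1 - k * p + k * (t1 - t) / 2)"
  unfolding first_leg[OF assms] using k by (simp add: power2_eq_square field_simps)

lemma slide_in_halfplane:
  assumes t: "t \<in> {0..T}"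
  shows "(\<xi> t, \<eta> t) \<in> halfplane k b"
proof -
  consider "t \<le> t1" | "t \<in> {t1..t2}" | "t2 \<le> t" by fastforce
  then show ?thesis
  proof cases
    case 1
    have "0 \<le> (t1 - t) * (1 - k * p + k * (t1 - t) / 2)"
      using 1 p k by (intro mult_nonneg_nonneg add_nonneg_nonneg) auto
    then show ?thesis using first_leg_gap[OF 1] by (simp add: halfplane_def)
  next
    case 2
    then show ?thesis using second_leg(2)[OF 2] k by (simp add: halfplane_def)
  next
    case 3
    let ?\<theta> = "t3 - t2"
    have sh: "bang_x (-1) r t3 s = bang_x (-1) r ?\<theta> (s - t2)"
      "bang_y (-1) r t3 s = bang_y (-1) r ?\<theta> (s - t2)" for s
      by (simp_all add: bang_x_def bang_y_def)
    have "(bang_x (-1) r ?\<theta> (t - t2), bang_y (-1) r ?\<theta> (t - t2)) \<in> halfplane k b"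
    proof (rule bang_in_halfplane[OF k b_pos])
      have "(\<xi> t2, \<eta> t2) \<in> Omega1 k b"
      proof -
        have x2: "\<xi> t2 = (- 1 / k + b) / k"
          using second_leg(2)[of t2] times by (simp add: corner)
        have "k * \<xi> t2 - b \<le> \<eta> t2"
          unfolding x2 corner using k by simp
        moreover have "\<xi> t2 \<le> - (1/2) * (\<eta> t2)\<^sup>2 + tangent_const k b"
          unfolding x2 corner tangent_const_def using k by (simp add: field_simps power2_eq_square)
        ultimately show ?thesis by (simp add: Omega1_def)
      qed
      then show "(bang_x (-1) r ?\<theta> 0, bang_y (-1) r ?\<theta> 0) \<in> Omega1 k b"
        using third_leg[of t2] sh[of t2] by simp
    qed (use times t 3 radius_pos in \<open>auto simp: slide_time_def\<close>)
    then show ?thesis by (simp add: third_leg[OF 3] sh)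
  qed
qed

text \<open>
The three parts of the trajectory are joined by the deviation in \<open>x\<close>: it is nonnegative at
\<open>t1\<close> by the arc inequality and stays so along the slide; at \<open>t2\<close> the deviation in \<open>y\<close> is then
nonnegative too, and the bang-bang part forces all deviations to vanish from \<open>t2\<close> on. Going back, the
inequalities on the slide and on the first arc become equalities.
\<close>

lemma slide_rigid:
  assumes traj: "trajectory 0 T x y" and st: "(x 0, y 0) = (\<xi> 0, \<eta> 0)"
    and fin: "x T = 0" "y T = 0"
    and K: "\<And>t. t \<in> {0..T} \<Longrightarrow> (x t, y t) \<in> halfplane k b"
    and t: "t \<in> {0..T}"
  shows "x t = \<xi> t \<and> y t = \<eta> t"
proof -
  define dx dy where "dx t = x t - \<xi> t" and "dy t = y t - \<eta> t" for t
  have sub: "trajectory a c x y" if "0 \<le> a" "c \<le> T" for a c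
    using that by (rule trajectory_subset[OF traj])
  have ddx: "(dx has_real_derivative dy t) (at t within {a..c})"
    if "0 \<le> a" "c \<le> T" "t \<in> {a..c}" for a c t
    unfolding dx_def dy_def
    using trajectoryD(2)[OF sub[OF that(1,2)] that(3)] trajectoryD(2)[OF trajectory_slide[OF that(1,2)] that(3)]
    by (rule DERIV_diff)
  have d0: "dx 0 = 0" "dy 0 = 0" using st by (auto simp: dx_def dy_def)

  \<comment> \<open>The costate on the first arc is \<open>\<psi> t = - (t1 - t) / p\<close>.\<close>
  define D where "D t = - 1 / p * (x t - \<xi> t) + - 1 / p * (t1 - t) * (y t - \<eta> t)" for t
  note arc = arc_inequality[OF sub[of 0 t1] trajectory_slide[of 0 t1], where \<sigma> = "-1" and \<phi> = "- 1 / p" and \<theta> = t1, folded D_def]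
  have slope: "\<eta> t - \<eta> s = - 1 * (t - s)" if "s \<in> {0..t1}" "t \<in> {0..t1}" for s t
    using that by (auto simp: first_leg)
  have sign: "0 \<le> - 1 * (- 1 / p * (t1 - t))" if "t \<in> {0..t1}" for t
    using that p by (simp add: divide_nonpos_pos)
  have "D t1 \<le> D 0"
    by (rule arc(1)) (use times slope sign in auto)
  then have dx1: "0 \<le> dx t1"
    using d0 p by (simp add: D_def dx_def dy_def zero_le_divide_iff)

  \<comment> \<open>The competitor satisfies the constraint on which the reference is tight.\<close>
  define E where "E t = exp (- k * t) * dx t" for t
  have gap: "0 \<le> dy t - k * dx t" if "t \<in> {t1..t2}" for t
  proof -
    have "k * x t - b \<le> y t" using K[of t] that times by (auto simp: halfplane_def)
    moreover have "k * \<xi> t - b = \<eta> t" using second_leg(2)[OF that] k by simp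
    ultimately show ?thesis by (simp add: dx_def dy_def algebra_simps)
  qed
  have Emono: "E s \<le> E t" if st: "s \<in> {t1..t2}" "t \<in> {t1..t2}" "s \<le> t" for s t
  proof (rule DERIV_nonneg_imp_increasing_open[OF st(3)])
    have sT: "0 \<le> s" "t \<le> T" using st times by auto
    have dE: "(E has_real_derivative exp (- k * q) * (dy q - k * dx q)) (at q within {s..t})"
      if "q \<in> {s..t}" for q
      unfolding E_def
      by (rule derivative_eq_intros ddx[OF sT that] refl)+ (simp add: algebra_simps)
    show "continuous_on {s..t} E"
      using dE by (meson DERIV_continuous continuous_on_eq_continuous_within)
    show "\<exists>e. (E has_real_derivative e) (at q) \<and> 0 \<le> e" if "s < q" "q < t" for q
      using dE[of q] gap[of q] that st by (auto simp: at_within_Icc_at)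
  qed
  have E1: "0 \<le> E t1" using dx1 by (simp add: E_def)
  have "E t1 \<le> E t2" using times by (intro Emono) auto
  then have "0 \<le> E t2" using E1 by linarith
  then have dx2: "0 \<le> dx t2" by (simp add: E_def zero_le_mult_iff)
  moreover have "k * dx t2 \<le> dy t2" using gap[of t2] times by simp
  ultimately have dy2: "0 \<le> dy t2" using k by (meson mult_nonneg_nonneg order_trans less_imp_le)

  have eq3: "x t = \<xi> t \<and> y t = \<eta> t" if "t \<in> {t2..T}" for t
  proof -
    have "x t = bang_x (-1) r t3 t \<and> y t = bang_y (-1) r t3 t"
    proof (rule bang_rigid[OF sub[of t2 T] _ _ _ _ fin _ that])
      have "0 \<le> dx t2 + (t3 - t2) * dy t2" using dx2 dy2 times by simp
      then show "- 1 * (x t2 - bang_x (-1) r t3 t2 + (t3 - t2) * (y t2 - bang_y (-1) r t3 t2)) \<le> 0"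
        using third_leg[of t2] by (simp add: dx_def dy_def)
    qed (use times radius_pos in \<open>auto simp: slide_time_def\<close>)
    then show ?thesis using third_leg[of t] that by simp
  qed
  have E2: "E t2 = 0" using eq3[of t2] times by (simp add: E_def dx_def)
  have dx0: "dx t = 0" if "t \<in> {t1..t2}" for t
  proof -
    have "E t1 \<le> E t" "E t \<le> E t2" using that by (intro Emono; auto)+
    then have "E t = 0" using E1 E2 by linarith
    then show ?thesis by (simp add: E_def)
  qed

  have dy1: "dy t = 0" if "t \<in> {0..t1}" for t
  proof -
    have "D 0 \<le> D t1" using d0 dx0[of t1] times by (simp add: D_def dx_def dy_def)
    then have "y t - \<eta> t = y 0 - \<eta> 0"
      by (intro arc(2)) (use times slope sign that p in auto)
    then show ?thesis using d0 by (simp add: dy_def)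
  qed
  have eq1: "x t = \<xi> t \<and> y t = \<eta> t" if t: "t \<in> {0..t1}" for t
  proof -
    have "\<exists>c. \<forall>t\<in>{0..t1}. dx t = c"
      by (rule has_field_derivative_zero_constant)
         (use ddx[of 0 t1] dy1 times in auto)
    then have "dx t = 0" using d0(1) t times(1) by force
    then show ?thesis using dy1[OF t] by (simp add: dx_def dy_def)
  qed
  have eq2: "x t = \<xi> t \<and> y t = \<eta> t" if t: "t \<in> {t1..t2}" for t
  proof (cases "t = t1 \<or> t = t2")
    case True
    then show ?thesis using eq1[of t1] eq3[of t2] times by auto
  next
    case False
    then have t': "t1 < t" "t < t2" using t by auto
    have "(dx has_real_derivative dy t) (at t)"
      using ddx[of t1 t2 t] t' times by (simp add: at_within_Icc_at)
    moreover have "(dx has_real_derivative 0) (at t)"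
      by (rule has_field_derivative_transform_within_open[of "\<lambda>_. 0" _ _ "{t1<..<t2}"])
         (use t' dx0 in auto)
    ultimately have "dy t = 0" by (rule DERIV_unique)
    then show ?thesis using dx0[OF t] by (simp add: dx_def dy_def)
  qed
  show ?thesis using eq1[of t] eq2[of t] eq3[of t] t by fastforce
qed

proposition constrained_optimal_iff_follows:
  "constrained_optimal k b (\<xi> 0, \<eta> 0) T' x y u \<longleftrightarrow> follows T \<xi> \<eta> v T' x y u"
  unfolding constrained_process_halfplane
proof (rule time_optimal_iff_follows[where S = "{t1, t2, t3}" and \<theta> = t3])
  show "\<eta> t \<noteq> 0" if "t \<in> {t3..<T}" for t
    using that times third_leg[of t] by (auto simp: bang_y_def slide_time_def)
  show "x t = \<xi> t \<and> y t = \<eta> t"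
    if "trajectory 0 T x y" "(x 0, y 0) = (\<xi> 0, \<eta> 0)" "x T = 0" "y T = 0"
      "\<And>t. t \<in> {0..T} \<Longrightarrow> (x t, y t) \<in> halfplane k b" "t \<in> {0..T}" for x y t
    using that by (rule slide_rigid)
  show "(\<eta> has_real_derivative v t) (at t)" if "t \<in> {0<..<T} - {t1, t2, t3}" for t
    using that by (intro DERIV_slide_y) auto
  show "0 \<le> T" "T = 0 \<or> t3 < T" using times by auto
  show "trajectory 0 T \<xi> \<eta>" by (simp add: trajectory_slide)
  show "(\<xi> t, \<eta> t) \<in> halfplane k b" if "t \<in> {0..T}" for t
    using that by (rule slide_in_halfplane)
qed (rule slide_u_measurable finish zero_in_halfplane[OF b_pos] refl finite.intros)+

end

section \<open>Synthesis on the boundary line\<close>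

lemma open_segment_CE_iff:
  assumes k: "0 < k"
  shows "P \<in> open_segment (point_C k b) (point_E k b) \<longleftrightarrow>
    (\<exists>p. 0 < p \<and> k * p < 1 \<and> P = ((b - p) / k, - p))"
proof -
  have ne: "point_C k b \<noteq> point_E k b"
    using k by (simp add: point_C_def point_E_def)
  have pt: "(1 - q) *\<^sub>R point_C k b + q *\<^sub>R point_E k b = ((b - (1 - q) / k) / k, - ((1 - q) / k))" for q
    using k by (simp add: point_C_def point_E_def field_simps power2_eq_square)
  show ?thesis
  proof
    assume "P \<in> open_segment (point_C k b) (point_E k b)"
    then obtain q where q: "0 < q" "q < 1" "P = (1 - q) *\<^sub>R point_C k b + q *\<^sub>R point_E k b"
      by (auto simp: in_segment)
    then show "\<exists>p. 0 < p \<and> k * p < 1 \<and> P = ((b - p) / k, - p)"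
      using k by (intro exI[of _ "(1 - q) / k"]) (simp add: pt)
  next
    assume "\<exists>p. 0 < p \<and> k * p < 1 \<and> P = ((b - p) / k, - p)"
    then obtain p where p: "0 < p" "k * p < 1" "P = ((b - p) / k, - p)" by blast
    have "P = (1 - (1 - k * p)) *\<^sub>R point_C k b + (1 - k * p) *\<^sub>R point_E k b"
      unfolding pt using k p(3) by simp
    then show "P \<in> open_segment (point_C k b) (point_E k b)"
      using ne p k unfolding in_segment by (intro conjI exI[of _ "1 - k * p"]) auto
  qed
qed

lemma C_above_A_iff:
  assumes k: "0 < k" and "0 < b"
  shows "snd (point_A k b) < snd (point_C k b) \<longleftrightarrow> 3 / 2 < k * b"
proof -
  have "snd (point_A k b) < snd (point_C k b) \<longleftrightarrow> 2 < sqrt (2 * b * k + 1)"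
    using k by (simp add: point_A_def point_C_def Let_def divide_less_cancel field_simps)
  also have "\<dots> \<longleftrightarrow> sqrt (2\<^sup>2) < sqrt (2 * b * k + 1)" by simp
  also have "\<dots> \<longleftrightarrow> 3 / 2 < k * b"
    unfolding real_sqrt_less_iff by (auto simp: mult.commute mult.left_commute)
  finally show ?thesis .
qed

text \<open>
Along \<open>u = - 1\<close> the quantity \<open>c = x + y\<^sup>2 / 2\<close> is constant, and in the interior it is strictly between
its values on the tangent parabola and at \<open>E\<close>. The height \<open>- p\<close> at which the parabola meets the line
solves \<open>(1 / k - p)\<^sup>2 = 2 (c - m)\<close> with \<open>m\<close> the constant of the tangent parabola.
\<close>

lemma interior_Omega2_slide:
  assumes k: "0 < k" and kb: "3 / 2 < k * b" and P: "P \<in> interior (Omega2 k b)"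
  obtains p t1 where "sliding k b p t1" "0 < t1" "P = (slide_x k b p t1 0, slide_y k b p t1 0)"
proof -
  obtain x0 y0 where xy: "P = (x0, y0)" by (cases P)
  define m where "m = tangent_const k b"
  have m: "m = b / k - (1 / k)\<^sup>2 / 2"
    unfolding m_def tangent_const_def using k by (simp add: field_simps power2_eq_square)
  obtain e where e: "0 < e" "ball P e \<subseteq> Omega2 k b"
    using P by (meson mem_interior)
  have "(x0 + e/2, y0) \<in> ball P e" "(x0 - e/2, y0) \<in> ball P e" "(x0, y0 - e/2) \<in> ball P e"
    using e(1) by (auto simp: xy dist_Pair_Pair dist_real_def)
  then have pts: "(x0 + e/2, y0) \<in> Omega2 k b" "(x0 - e/2, y0) \<in> Omega2 k b" "(x0, y0 - e/2) \<in> Omega2 k b"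
    using e(2) by auto
  have y0: "- 1 / k < y0" using pts(3) e(1) by (auto simp: Omega2_def)
  have cm: "m < x0 + y0\<^sup>2 / 2" using pts(2) e(1) by (auto simp: Omega2_def m_def)
  have up: "0 \<le> y0 \<Longrightarrow> x0 < b / k - y0\<^sup>2 / 2" "y0 \<le> 0 \<Longrightarrow> x0 < (y0 + b) / k"
    using pts(1) e(1) y0 by (auto simp: Omega2_def)
  define c where "c = x0 + y0\<^sup>2 / 2"
  have cb: "c < b / k"
  proof (cases "0 \<le> y0")
    case True then show ?thesis using up by (simp add: c_def)
  next
    case False
    have "c < (y0 + b) / k + y0\<^sup>2 / 2" using up(2) False by (simp add: c_def)
    also have "\<dots> = b / k + y0 * (1 / k + y0 / 2)"
      using k by (simp add: field_simps power2_eq_square)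
    also have "\<dots> \<le> b / k"
    proof -
      have "0 < 1 / k" using k by simp
      then have "0 \<le> 1 / k + y0 / 2" using y0 by (simp del: zero_less_divide_1_iff)
      then show ?thesis using False by (simp add: mult_nonpos_nonneg)
    qed
    finally show ?thesis .
  qed
  \<comment> \<open>The smaller root is needed: \<open>p < 1 / k\<close> keeps the meeting point above \<open>C\<close>.\<close>
  define q where "q = sqrt (2 * (c - m))"
  define p where "p = 1 / k - q"
  have q2: "q\<^sup>2 = 2 * (c - m)" using cm by (simp add: q_def c_def)
  have q0: "0 < q" using cm by (simp add: q_def c_def)
  have "q\<^sup>2 < (1 / k)\<^sup>2" using cb by (simp add: q2 m)
  then have "q < 1 / k" using k by (simp add: power2_less_imp_less)
  then have p0: "0 < p" by (simp add: p_def)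
  have kp: "k * p < 1" using k q0 by (simp add: p_def algebra_simps)
  have c: "c = (b - p) / k + p\<^sup>2 / 2"
  proof -
    have "c = m + q\<^sup>2 / 2" unfolding q2 by (simp add: field_simps)
    also have "\<dots> = m + (1 / k - p)\<^sup>2 / 2" by (simp add: p_def)
    also have "\<dots> = (b - p) / k + p\<^sup>2 / 2"
      using k by (simp add: m field_simps power2_eq_square)
    finally show ?thesis .
  qed
  have t1: "0 < y0 + p"
  proof (cases "0 \<le> y0")
    case False
    have "k * x0 < y0 + b" using up(2) False k by (simp add: field_simps)
    then have "0 < y0 - k * (c - y0\<^sup>2 / 2) + b" by (simp add: c_def)
    also have "\<dots> = (y0 + p) * (1 + k * (y0 - p) / 2)"
      unfolding c using k by (simp add: field_simps power2_eq_square)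
    finally have "0 < (y0 + p) * (1 + k * (y0 - p) / 2)" .
    moreover have "0 < 1 + k * (y0 - p) / 2"
    proof -
      have "- 1 < k * y0" using y0 k by (simp add: field_simps)
      then show ?thesis using kp by (simp add: right_diff_distrib field_simps)
    qed
    ultimately show ?thesis using zero_less_mult_pos2 by blast
  qed (use p0 in auto)
  have sl: "sliding k b p (y0 + p)"
    using k kb p0 kp t1 by unfold_locales auto
  moreover have "P = (slide_x k b p (y0 + p) 0, slide_y k b p (y0 + p) 0)"
    unfolding sliding.start[OF sl] by (simp add: xy flip: c) (simp add: c_def)
  ultimately show thesis using t1 that by blast
qed

text \<open>
The point at height 1 on the parabola \<open>u = - 1\<close> through a point of \<open>(C, E)\<close>.
\<close>

lemma interior_Omega2I:
  assumes k: "0 < k" and p: "0 < p" "k * p < 1"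
  shows "((b - p) / k + p\<^sup>2 / 2 - 1 / 2, 1) \<in> interior (Omega2 k b)"
proof (rule interiorI)
  let ?S = "{z. 0 < snd z \<and> tangent_const k b - (snd z)\<^sup>2 / 2 < fst z \<and> fst z < b / k - (snd z)\<^sup>2 / 2}"
  show "open ?S"
    by (intro open_Collect_conj open_Collect_less continuous_intros) auto
  have "tangent_const k b < (b - p) / k + p\<^sup>2 / 2"
  proof -
    have "(b - p) / k + p\<^sup>2 / 2 - tangent_const k b = (1 / k - p)\<^sup>2 / 2"
      unfolding tangent_const_def using k by (simp add: field_simps power2_eq_square)
    moreover have "p < 1 / k" using k p by (simp add: field_simps)
    then have "0 < (1 / k - p)\<^sup>2 / 2" by simp
    ultimately show ?thesis by linarith
  qed
  moreover have "(b - p) / k + p\<^sup>2 / 2 < b / k"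
  proof -
    have "b / k - ((b - p) / k + p\<^sup>2 / 2) = p * (2 - k * p) / (2 * k)"
      using k by (simp add: field_simps power2_eq_square)
    moreover have "0 < p * (2 - k * p) / (2 * k)" using k p by simp
    ultimately show ?thesis by linarith
  qed
  ultimately show "((b - p) / k + p\<^sup>2 / 2 - 1 / 2, 1) \<in> ?S" by simp
  show "?S \<subseteq> Omega2 k b"
  proof
    fix z assume z: "z \<in> ?S"
    obtain x y where xy: "z = (x, y)" by (cases z)
    have "- 1 / k \<le> 0" using k by simp
    moreover have "0 < y" using z by (simp add: xy)
    ultimately have "- 1 / k \<le> y" by linarith
    then show "z \<in> Omega2 k b"
      using z by (auto simp: Omega2_def xy)
  qed
qed

lemma slide_shift:
  assumes "0 \<le> t"
  shows "slide_x k b p s (s + t) = slide_x k b p 0 t"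
    and "slide_y k b p s (s + t) = slide_y k b p 0 t"
    and "slide_u k b p s (s + t) = slide_u k b p 0 t"
    and "slide_time k b p s = s + slide_time k b p 0"
  using assms
  by (auto simp: slide_x_def slide_y_def slide_u_def slide_end_def slide_switch_def slide_time_def
      bang_x_def bang_y_def bang_u_def algebra_simps)

text \<open>
A point of \<open>(C, E)\<close> at height \<open>- p\<close> is preceded by the point at height 1 on its parabola, at a distance of
\<open>1 + p\<close> in time. Conversely, an arc with \<open>u = - 1\<close> that ends on the line cannot reach into the slide, where
\<open>u > - 1\<close>, so it ends exactly at the arrival time.
\<close>

proposition boundary_synthesis:
  assumes k: "0 < k" and kb: "3 / 2 < k * b"
    and P: "P \<in> open_segment (point_C k b) (point_E k b)"
  shows "\<exists>T x y u. constrained_optimal k b P T x y u"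
    and "constrained_optimal k b P T x y u \<longleftrightarrow>
           (\<exists>P' \<in> interior (Omega2 k b). \<exists>T' x' y' u' \<tau>.
              constrained_optimal k b P' T' x' y' u' \<and>
              0 < \<tau> \<and> \<tau> \<le> T' \<and> (AE t in lebesgue_on {0..\<tau>}. u' t = - 1) \<and>
              (x' \<tau>, y' \<tau>) = P \<and>
              is_tail \<tau> T' x' y' u' T x y u)" (is "_ \<longleftrightarrow> ?tail")
proof -
  obtain p where p: "0 < p" "k * p < 1" and Pp: "P = ((b - p) / k, - p)"
    using P open_segment_CE_iff[OF k] by blast
  interpret S0: sliding k b p 0 using k kb p by unfold_locales auto
  have start0: "(S0.\<xi> 0, S0.\<eta> 0) = P"
    unfolding S0.start by (simp add: Pp power2_eq_square)
  have opt0: "constrained_optimal k b P T x y u \<longleftrightarrow> follows S0.T S0.\<xi> S0.\<eta> S0.v T x y u" for T x y u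
    using S0.constrained_optimal_iff_follows unfolding start0 .
  show "\<exists>T x y u. constrained_optimal k b P T x y u"
    unfolding opt0 by (intro exI) (rule follows_refl)
  show "constrained_optimal k b P T x y u \<longleftrightarrow> ?tail"
  proof
    assume "constrained_optimal k b P T x y u"
    then have f: "T = S0.T" "\<And>t. t \<in> {0..S0.T} \<Longrightarrow> x t = S0.\<xi> t \<and> y t = S0.\<eta> t"
      "AE t in lebesgue_on {0..S0.T}. u t = S0.v t"
      unfolding opt0 by (auto simp: follows_def)
    let ?s = "1 + p"
    interpret S1: sliding k b p ?s using k kb p by unfold_locales auto
    have start1: "(S1.\<xi> 0, S1.\<eta> 0) = ((b - p) / k + p\<^sup>2 / 2 - 1 / 2, 1)"
      unfolding S1.start by simp
    have shift: "S1.T = ?s + S0.T" by (rule slide_shift(4)) auto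
    show ?tail
    proof (intro bexI exI conjI)
      show "constrained_optimal k b (S1.\<xi> 0, S1.\<eta> 0) S1.T S1.\<xi> S1.\<eta> S1.v"
        unfolding S1.constrained_optimal_iff_follows by (rule follows_refl)
      show "(S1.\<xi> 0, S1.\<eta> 0) \<in> interior (Omega2 k b)"
        unfolding start1 by (rule interior_Omega2I[OF k p])
      show "0 < ?s" "?s \<le> S1.T" using p shift S0.times by auto
      show "AE t in lebesgue_on {0..?s}. S1.v t = - 1"
        unfolding AE_lebesgue_on_interval_iff
        by (rule negligible_subset[of "{?s}"]) (auto simp: slide_u_def)
      show "(S1.\<xi> ?s, S1.\<eta> ?s) = P"
        using slide_shift(1,2)[of 0 k b p ?s] start0 by simp
      show "is_tail ?s S1.T S1.\<xi> S1.\<eta> S1.v T x y u"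
        unfolding is_tail_def f(1)
      proof (intro conjI ballI)
        show "?s \<in> {0..S1.T}" using p shift S0.times by auto
        show "S0.T = S1.T - ?s" by (simp add: shift)
        show "x t = S1.\<xi> (?s + t)" "y t = S1.\<eta> (?s + t)" if "t \<in> {0..S0.T}" for t
          using f(2)[OF that] that by (simp_all add: slide_shift)
        show "AE t in lebesgue_on {0..S0.T}. u t = S1.v (?s + t)"
          using f(3) by (rule lebesgue_on_mono) (simp add: slide_shift)
      qed
    qed
  next
    assume ?tail
    then obtain P' T' x' y' u' \<tau> where P': "P' \<in> interior (Omega2 k b)"
      and opt: "constrained_optimal k b P' T' x' y' u'" and \<tau>: "0 < \<tau>" "\<tau> \<le> T'"
      and u': "AE t in lebesgue_on {0..\<tau>}. u' t = - 1" and at: "(x' \<tau>, y' \<tau>) = P"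
      and tail: "is_tail \<tau> T' x' y' u' T x y u" by blast
    obtain p' t1 where sl: "sliding k b p' t1" and t1: "0 < t1"
      and P'eq: "P' = (slide_x k b p' t1 0, slide_y k b p' t1 0)"
      using interior_Omega2_slide[OF k kb P'] by blast
    interpret S1: sliding k b p' t1 by (rule sl)
    have f: "T' = S1.T" "\<And>t. t \<in> {0..S1.T} \<Longrightarrow> x' t = S1.\<xi> t \<and> y' t = S1.\<eta> t"
      "AE t in lebesgue_on {0..S1.T}. u' t = S1.v t"
      using opt unfolding P'eq S1.constrained_optimal_iff_follows by (auto simp: follows_def)
    have "\<tau> \<le> t1"
    proof (rule ccontr)
      assume *: "\<not> \<tau> \<le> t1"
      have "AE t in lebesgue_on {0..\<tau>}. u' t = - 1 \<and> u' t = S1.v t"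
        using u' AE_lebesgue_on_subinterval[OF f(3), of 0 \<tau>] \<tau> f(1) by auto
      then show False
      proof (rule AE_interval_contradiction)
        show "t1 < min \<tau> S1.t2" using * S1.times by auto
        show "\<not> (u' t = - 1 \<and> u' t = S1.v t)" if t: "t \<in> {t1<..<min \<tau> S1.t2}" for t
        proof -
          have "S1.v t = - (k * p' * exp (k * (t - t1)))" using t by (simp add: slide_u_def)
          moreover have "exp (k * (t - t1)) < exp (k * (S1.t2 - t1))" using t k by simp
          then have "k * p' * exp (k * (t - t1)) < k * p' * exp (k * (S1.t2 - t1))"
            using k S1.p by (intro mult_strict_left_mono) auto
          then have "k * p' * exp (k * (t - t1)) < 1"
            using k S1.p by (simp add: S1.exp_end)
          ultimately show ?thesis by linarith
        qed
      qed (use S1.times in auto)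
    qed
    moreover have at': "S1.\<xi> \<tau> = (b - p) / k" "S1.\<eta> \<tau> = - p"
      using f(2)[of \<tau>] \<tau> f(1) at Pp by auto
    then have "(t1 - \<tau>) * (1 - k * p' + k * (t1 - \<tau>) / 2) = 0"
      using S1.first_leg_gap[OF \<open>\<tau> \<le> t1\<close>] k by simp
    moreover have "0 < 1 - k * p' + k * (t1 - \<tau>) / 2"
      using \<open>\<tau> \<le> t1\<close> k S1.p by (intro add_pos_nonneg) auto
    ultimately have \<tau>t1: "\<tau> = t1" by auto
    have pp': "p' = p" using S1.first_leg(1)[of t1] at' by (simp add: \<tau>t1)
    have shift: "S1.T = t1 + S0.T" unfolding pp' by (rule slide_shift(4)) auto
    have tl: "T = S0.T" "\<And>t. t \<in> {0..S0.T} \<Longrightarrow> x t = x' (t1 + t) \<and> y t = y' (t1 + t)"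
      "AE t in lebesgue_on {0..S0.T}. u t = u' (t1 + t)"
      using tail unfolding is_tail_def \<tau>t1 f(1) shift by auto
    have "AE t in lebesgue_on {0..S0.T}. u' (t1 + t) = S1.v (t1 + t)"
      by (rule AE_lebesgue_on_shift[OF f(3)[unfolded shift]]) (use t1 in simp)

    then have "AE t in lebesgue_on {0..S0.T}. u t = S1.v (t1 + t)"
      using tl(3) by eventually_elim simp
    then have "AE t in lebesgue_on {0..S0.T}. u t = S0.v t"
      by (rule lebesgue_on_mono) (simp add: slide_shift pp')
    moreover have "x t = S0.\<xi> t \<and> y t = S0.\<eta> t" if "t \<in> {0..S0.T}" for t
    proof -
      have "t1 + t \<in> {0..S1.T}" using that t1 by (simp add: shift)
      then show ?thesis using tl(2)[OF that] f(2)[of "t1 + t"] that by (simp add: slide_shift pp')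
    qed
    ultimately show "constrained_optimal k b P T x y u"
      unfolding opt0 follows_def using tl(1) by blast
  qed
qed

section \<open>Stieltjes measures and functions of bounded variation\<close>

lemma mono_one_sided_limits:
  fixes M :: "real \<Rightarrow> real"
  assumes M: "mono M"
  shows mono_tendsto_at_left: "(M \<longlongrightarrow> Lim (at_left t) M) (at_left t)"
    and mono_tendsto_at_right: "(M \<longlongrightarrow> Lim (at_right t) M) (at_right t)"
proof -
  have l: "(M \<longlongrightarrow> Sup (M ` {..<t})) (at_left t)"
  proof (rule increasing_tendsto)
    have bdd: "bdd_above (M ` {..<t})"
      using M by (intro bdd_aboveI2[of _ _ "M t"]) (auto simp: mono_def)
    have ne: "M ` {..<t} \<noteq> {}" by (auto intro: exI[of _ "t - 1"])
    show "\<forall>\<^sub>F s in at_left t. M s \<le> Sup (M ` {..<t})"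
      unfolding eventually_at_filter using bdd by (auto intro!: always_eventually cSup_upper)
    show "\<forall>\<^sub>F s in at_left t. z < M s" if z: "z < Sup (M ` {..<t})" for z
    proof -
      obtain s where s: "s < t" "z < M s"
        using z less_cSup_iff[OF ne bdd] by auto
      have "\<forall>\<^sub>F q in at_left t. q \<in> {s<..<t}"
        using eventually_at_left_real[OF s(1)] .
      then show ?thesis
      proof eventually_elim
        case (elim q)
        then have "M s \<le> M q" by (intro monoD[OF M]) auto
        then show ?case using s by linarith
      qed
    qed
  qed
  have r: "(M \<longlongrightarrow> Inf (M ` {t<..})) (at_right t)"
  proof (rule decreasing_tendsto)
    have bdd: "bdd_below (M ` {t<..})"
      using M by (intro bdd_belowI2[of _ "M t"]) (auto simp: mono_def)
    have ne: "M ` {t<..} \<noteq> {}" by (auto intro: exI[of _ "t + 1"])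
    show "\<forall>\<^sub>F s in at_right t. Inf (M ` {t<..}) \<le> M s"
      unfolding eventually_at_filter using bdd by (auto intro!: always_eventually cInf_lower)
    show "\<forall>\<^sub>F s in at_right t. M s < z" if z: "Inf (M ` {t<..}) < z" for z
    proof -
      obtain s where s: "t < s" "M s < z"
        using z cInf_less_iff[OF ne bdd] by auto
      have "\<forall>\<^sub>F q in at_right t. q \<in> {t<..<s}"
        using eventually_at_right_real[OF s(1)] .
      then show ?thesis
      proof eventually_elim
        case (elim q)
        then have "M q \<le> M s" by (intro monoD[OF M]) auto
        then show ?case using s by linarith
      qed
    qed
  qed
  show "(M \<longlongrightarrow> Lim (at_left t) M) (at_left t)"
    using l tendsto_Lim[OF _ l] by simp
  show "(M \<longlongrightarrow> Lim (at_right t) M) (at_right t)"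
    using r tendsto_Lim[OF _ r] by simp
qed

lemma mono_const_ext: "0 \<le> T \<Longrightarrow> mono_on {0..T} \<mu> \<Longrightarrow> mono (const_ext T \<mu>)"
  unfolding const_ext_def by (intro monoI) (auto elim!: mono_onD simp: min_def max_def)

text \<open>
\<open>F\<close> and \<open>G\<close> are the right and left limits of a monotone \<open>M\<close>. The measure defined by the right-continuous \<open>F\<close>
gives \<open>{s..<t}\<close> the mass \<open>G t - G s\<close> and \<open>{t}\<close> the mass \<open>F t - G t\<close>.
\<close>

locale mono_jumps =
  fixes M :: "real \<Rightarrow> real"
  assumes M: "mono M"
begin

abbreviation F :: "real \<Rightarrow> real" where "F t \<equiv> Lim (at_right t) M"
abbreviation G :: "real \<Rightarrow> real" where "G t \<equiv> Lim (at_left t) M"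
abbreviation \<nu> where "\<nu> \<equiv> interval_measure F"

lemma G_le: "G t \<le> M t"
  by (rule tendsto_upperbound[OF mono_tendsto_at_left[OF M, of t]])
     (use M in \<open>auto simp: eventually_at_filter mono_def\<close>)

lemma le_F: "M t \<le> F t"
  by (rule tendsto_lowerbound[OF mono_tendsto_at_right[OF M, of t]])
     (use M in \<open>auto simp: eventually_at_filter mono_def\<close>)

lemma F_le:
  assumes "s < t"
  shows "F s \<le> M t"
proof (rule tendsto_upperbound[OF mono_tendsto_at_right[OF M, of s]])
  show "\<forall>\<^sub>F q in at_right s. M q \<le> M t"
    using eventually_at_right_real[OF assms] by eventually_elim (use M in \<open>auto simp: mono_def\<close>)
qed simp

lemma le_G:
  assumes "s < t"
  shows "M s \<le> G t"
proof (rule tendsto_lowerbound[OF mono_tendsto_at_left[OF M, of t]])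
  show "\<forall>\<^sub>F q in at_left t. M s \<le> M q"
    using eventually_at_left_real[OF assms] by eventually_elim (use M in \<open>auto simp: mono_def\<close>)
qed simp

lemma mono_F: "s \<le> t \<Longrightarrow> F s \<le> F t"
  using F_le[of s t] le_F[of t] by (cases "s = t") auto

lemma F_right_continuous: "continuous (at_right t) F"
  unfolding continuous_within
proof (rule decreasing_tendsto)
  show "\<forall>\<^sub>F s in at_right t. F t \<le> F s"
    unfolding eventually_at_filter by (auto intro!: always_eventually mono_F)
  show "\<forall>\<^sub>F s in at_right t. F s < z" if "F t < z" for z
  proof -
    have "\<forall>\<^sub>F s in at_right t. M s < z"
      using order_tendstoD(2)[OF mono_tendsto_at_right[OF M] that] .
    then obtain q where q: "t < q" "\<And>s. \<lbrakk>t < s; s < q\<rbrakk> \<Longrightarrow> M s < z"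
      by (auto simp: eventually_at_right_field)
    have "\<forall>\<^sub>F s in at_right t. s \<in> {t<..<q}" using eventually_at_right_real[OF q(1)] .
    then show ?thesis
    proof eventually_elim
      case (elim s)
      have "F s \<le> M ((s + q) / 2)" using elim by (intro F_le) auto
      also have "\<dots> < z" using elim by (intro q) auto
      finally show ?case .
    qed
  qed
qed

lemma emeasure_Ioc: "s \<le> t \<Longrightarrow> emeasure \<nu> {s<..t} = ennreal (F t - F s)"
  by (rule emeasure_interval_measure_Ioc[OF _ mono_F F_right_continuous])

lemma F_tendsto_at_left: "(F \<longlongrightarrow> G t) (at_left t)"
proof (rule increasing_tendsto)
  show "\<forall>\<^sub>F s in at_left t. F s \<le> G t"
  proof -
    have "F s \<le> G t" if "s < t" for s
      using F_le[of s "(s + t) / 2"] le_G[of "(s + t) / 2" t] that by auto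
    then show ?thesis by (simp add: eventually_at_filter)
  qed
  show "\<forall>\<^sub>F s in at_left t. z < F s" if "z < G t" for z
    using order_tendstoD(1)[OF mono_tendsto_at_left[OF M] that]
    by eventually_elim (use le_F less_le_trans in blast)
qed

lemma emeasure_singleton: "emeasure \<nu> {t} = ennreal (F t - G t)"
proof -
  let ?A = "\<lambda>n. {t - 1 / real (Suc n)<..t}"
  have lim: "(\<lambda>n. t - 1 / real (Suc n)) \<longlonglongrightarrow> t"
    using tendsto_diff[OF tendsto_const LIMSEQ_inverse_real_of_nat, of t]
    by (simp add: inverse_eq_divide)
  have "filterlim (\<lambda>n. t - 1 / real (Suc n)) (at_left t) sequentially"
    unfolding filterlim_at using lim by (auto intro!: always_eventually)
  then have "(\<lambda>n. F (t - 1 / real (Suc n))) \<longlonglongrightarrow> G t"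
    by (rule filterlim_compose[OF F_tendsto_at_left])
  then have "(\<lambda>n. ennreal (F t - F (t - 1 / real (Suc n)))) \<longlonglongrightarrow> ennreal (F t - G t)"
    by (intro tendsto_ennrealI tendsto_intros)
  moreover have "(\<lambda>n. emeasure \<nu> (?A n)) \<longlonglongrightarrow> emeasure \<nu> (\<Inter>n. ?A n)"
  proof (rule Lim_emeasure_decseq)
    show "decseq ?A"
    proof (rule decseq_SucI)
      fix n
      have "1 / real (Suc (Suc n)) \<le> 1 / real (Suc n)" by (intro divide_left_mono) auto
      then have "t - 1 / real (Suc n) \<le> t - 1 / real (Suc (Suc n))" by linarith
      then show "?A (Suc n) \<le> ?A n" by (auto simp del: of_nat_Suc)
    qed
  qed (auto simp: emeasure_Ioc)
  moreover have "(\<Inter>n. ?A n) = {t}"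
  proof
    show "(\<Inter>n. ?A n) \<subseteq> {t}"
    proof
      fix s assume s: "s \<in> (\<Inter>n. ?A n)"
      then have "\<And>n. t - 1 / real (Suc n) \<le> s" by (auto intro: less_imp_le)
      then have "t \<le> s" using lim by (intro LIMSEQ_le_const2) auto
      then show "s \<in> {t}" using s by auto
    qed
  qed auto
  ultimately show ?thesis
    using LIMSEQ_unique by (auto simp: emeasure_Ioc)
qed

lemma emeasure_Ico:
  assumes "s \<le> t"
  shows "emeasure \<nu> {s..<t} = ennreal (G t - G s)"
proof (cases "s = t")
  case False
  then have st: "s < t" using assms by simp
  have "emeasure \<nu> {s..<t} + emeasure \<nu> {t} = emeasure \<nu> ({s..<t} \<union> {t})"
    by (rule plus_emeasure) auto
  also have "{s..<t} \<union> {t} = {s} \<union> {s<..t}" using st by auto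
  also have "emeasure \<nu> \<dots> = emeasure \<nu> {s} + emeasure \<nu> {s<..t}"
    by (rule plus_emeasure[symmetric]) auto
  also have "\<dots> = ennreal (F t - G s)"
    using st G_le[of s] le_F[of s] mono_F[of s t]
    by (simp add: emeasure_singleton emeasure_Ioc flip: ennreal_plus)
  also have "\<dots> = ennreal (G t - G s) + ennreal (F t - G t)"
    using G_le[of t] le_F[of t] G_le[of s] le_G[OF st] by (simp flip: ennreal_plus)
  finally show ?thesis by (simp add: emeasure_singleton)
qed simp

lemma measure_Ico: "s \<le> t \<Longrightarrow> measure \<nu> {s..<t} = G t - G s"
  using emeasure_Ico[of s t] G_le[of s] le_G[of s t]
  by (cases "s = t") (auto simp: measure_def)

lemma measure_singleton: "measure \<nu> {t} = F t - G t"
  using emeasure_singleton[of t] G_le[of t] le_F[of t] by (simp add: measure_def)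

lemma measure_Ico_tendsto: "((\<lambda>q. measure \<nu> {t..<q}) \<longlongrightarrow> F t - G t) (at_right t)"
proof -
  have "(G \<longlongrightarrow> F t) (at_right t)"
  proof (rule decreasing_tendsto)
    show "\<forall>\<^sub>F q in at_right t. F t \<le> G q"
    proof -
      have "F t \<le> G q" if "t < q" for q
        using F_le[of t "(t + q) / 2"] le_G[of "(t + q) / 2" q] that by auto
      then show ?thesis by (simp add: eventually_at_filter)
    qed
    show "\<forall>\<^sub>F q in at_right t. G q < z" if "F t < z" for z
      using order_tendstoD(2)[OF mono_tendsto_at_right[OF M] that]
      by eventually_elim (use G_le le_less_trans in blast)
  qed
  then have "((\<lambda>q. G q - G t) \<longlongrightarrow> F t - G t) (at_right t)"
    by (intro tendsto_intros)
  then show ?thesis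
    by (rule Lim_transform_eventually) (auto simp: eventually_at_filter measure_Ico)
qed

end

lemma jump_eq_measure:
  assumes "0 \<le> T" "mono_on {0..T} \<mu>"
  shows "jump T \<mu> t = measure (stieltjes_measure T \<mu>) {t}"
proof -
  interpret mono_jumps "const_ext T \<mu>"
    using assms by unfold_locales (rule mono_const_ext)
  show ?thesis by (simp add: jump_def stieltjes_measure_def measure_singleton)
qed

lemma stieltjes_Ico_tendsto_jump:
  assumes "0 \<le> T" "mono_on {0..T} \<mu>"
  shows "((\<lambda>q. measure (stieltjes_measure T \<mu>) {t..<q}) \<longlongrightarrow> jump T \<mu> t) (at_right t)"
proof -
  interpret mono_jumps "const_ext T \<mu>"
    using assms by unfold_locales (rule mono_const_ext)
  show ?thesis using measure_Ico_tendsto[of t] by (simp add: jump_def stieltjes_measure_def)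
qed

lemma sets_stieltjes_measure [simp]: "sets (stieltjes_measure T \<mu>) = sets borel"
  by (simp add: stieltjes_measure_def)

lemma space_stieltjes_measure [simp]: "space (stieltjes_measure T \<mu>) = UNIV"
  by (simp add: stieltjes_measure_def)

lemma stieltjes_measure_left_continuous:
  assumes T: "0 \<le> T" and \<mu>: "mono_on {0..T} \<mu>"
    and cont: "\<And>t. t \<in> {0<..T} \<Longrightarrow> continuous (at_left t) \<mu>"
    and st: "0 \<le> s" "s \<le> t" "t \<le> T"
  shows "emeasure (stieltjes_measure T \<mu>) {s..<t} = ennreal (\<mu> t - \<mu> s)"
proof -
  interpret mono_jumps "const_ext T \<mu>"
    using T \<mu> by unfold_locales (rule mono_const_ext)
  have G: "G q = \<mu> q" if q: "q \<in> {0..T}" for q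
  proof (rule tendsto_Lim)
    show "(const_ext T \<mu> \<longlongrightarrow> \<mu> q) (at_left q)"
    proof (cases "q = 0")
      case True
      have "\<forall>\<^sub>F w in at_left q. \<mu> q = const_ext T \<mu> w"
        using True T by (auto simp: eventually_at_filter const_ext_def)
      then show ?thesis by (rule Lim_transform_eventually[OF tendsto_const])
    next
      case False
      then have "(\<mu> \<longlongrightarrow> \<mu> q) (at_left q)"
        using cont[of q] q by (simp add: continuous_within)
      moreover have "\<forall>\<^sub>F w in at_left q. w \<in> {0<..<q}"
        using False q by (intro eventually_at_left_real) auto
      then have "\<forall>\<^sub>F w in at_left q. \<mu> w = const_ext T \<mu> w"
        by eventually_elim (use q in \<open>auto simp: const_ext_def\<close>)
      ultimately show ?thesis by (rule Lim_transform_eventually)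
    qed
  qed simp
  show ?thesis
    using emeasure_Ico[OF st(2)] G[of s] G[of t] st by (simp add: stieltjes_measure_def)
qed

lemma stieltjes_measure_Ioc_eq_0:
  assumes T: "0 \<le> T" and \<mu>: "mono_on {0..T} \<mu>"
    and const: "\<And>t. t \<in> {s<..T} \<Longrightarrow> \<mu> t = c" and s: "0 \<le> s" "s < T"
  shows "emeasure (stieltjes_measure T \<mu>) {s<..T} = 0"
proof -
  interpret mono_jumps "const_ext T \<mu>"
    using T \<mu> by unfold_locales (rule mono_const_ext)
  have "F q = c" if q: "q \<in> {s..T}" for q
  proof (rule tendsto_Lim)
    have "\<forall>\<^sub>F w in at_right q. c = const_ext T \<mu> w"
      using const s q by (auto simp: eventually_at_filter const_ext_def min_def max_def)
    then show "(const_ext T \<mu> \<longlongrightarrow> c) (at_right q)"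
      by (rule Lim_transform_eventually[OF tendsto_const])
  qed simp
  then show ?thesis
    using emeasure_Ioc[of s T] s by (simp add: stieltjes_measure_def)
qed

lemma bounded_variation_mono_on:
  assumes f: "mono_on {a..c} f" and "a \<le> c"
  shows "bounded_variation_on a c f"
  unfolding bounded_variation_on_def
proof (intro exI[of _ "f c - f a"] allI impI)
  fix n and s :: "nat \<Rightarrow> real"
  assume s: "(\<forall>i\<le>n. s i \<in> {a..c}) \<and> (\<forall>i<n. s i \<le> s (Suc i))"
  have "(\<Sum>i<n. \<bar>f (s (Suc i)) - f (s i)\<bar>) = (\<Sum>i<n. f (s (Suc i)) - f (s i))"
    using s by (intro sum.cong refl abs_of_nonneg) (auto intro!: mono_onD[OF f])
  also have "\<dots> = f (s n) - f (s 0)" by (rule sum_lessThan_telescope)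
  also have "\<dots> \<le> f c - f a"
    using s assms by (intro diff_mono mono_onD[OF f]) auto
  finally show "(\<Sum>i<n. \<bar>f (s (Suc i)) - f (s i)\<bar>) \<le> f c - f a" .
qed

lemma bounded_variation_diff:
  assumes "bounded_variation_on a c f" "bounded_variation_on a c g"
    and h: "\<And>t. t \<in> {a..c} \<Longrightarrow> h t = f t - g t"
  shows "bounded_variation_on a c h"
proof -
  obtain V W where V: "\<And>n s. (\<forall>i\<le>n. s i \<in> {a..c}) \<and> (\<forall>i<n. s i \<le> s (Suc i)) \<Longrightarrow>
      (\<Sum>i<n. \<bar>f (s (Suc i)) - f (s i)\<bar>) \<le> V"
    and W: "\<And>n s. (\<forall>i\<le>n. s i \<in> {a..c}) \<and> (\<forall>i<n. s i \<le> s (Suc i)) \<Longrightarrow>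
      (\<Sum>i<n. \<bar>g (s (Suc i)) - g (s i)\<bar>) \<le> W"
    using assms(1,2) unfolding bounded_variation_on_def by blast
  show ?thesis unfolding bounded_variation_on_def
  proof (intro exI[of _ "V + W"] allI impI)
    fix n and s :: "nat \<Rightarrow> real"
    assume s: "(\<forall>i\<le>n. s i \<in> {a..c}) \<and> (\<forall>i<n. s i \<le> s (Suc i))"
    have "(\<Sum>i<n. \<bar>h (s (Suc i)) - h (s i)\<bar>) \<le>
        (\<Sum>i<n. \<bar>f (s (Suc i)) - f (s i)\<bar> + \<bar>g (s (Suc i)) - g (s i)\<bar>)"
    proof (rule sum_mono)
      fix i assume "i \<in> {..<n}"
      then have "s i \<in> {a..c}" "s (Suc i) \<in> {a..c}" using s by auto
      then show "\<bar>h (s (Suc i)) - h (s i)\<bar> \<le> \<bar>f (s (Suc i)) - f (s i)\<bar> + \<bar>g (s (Suc i)) - g (s i)\<bar>"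
        by (simp add: h)
    qed
    also have "\<dots> \<le> V + W" using V[OF s] W[OF s] by (simp add: sum.distrib)
    finally show "(\<Sum>i<n. \<bar>h (s (Suc i)) - h (s i)\<bar>) \<le> V + W" .
  qed
qed

text \<open>
A left-continuous function inherits closed pointwise conditions that hold almost everywhere to
the left; this turns the almost everywhere conditions of the maximum principle into conditions at
single times.
\<close>

lemma left_continuous_AE_closed:
  fixes f :: "real \<Rightarrow> real"
  assumes f: "continuous (at_left t) f" and S: "closed S"
    and AE: "AE s in lebesgue_on {a..c}. s \<in> {d<..<t} \<longrightarrow> f s \<in> S"
    and t: "a \<le> d" "d < t" "t \<le> c"
  shows "f t \<in> S"
proof (rule ccontr)
  assume "f t \<notin> S"
  then have "\<forall>\<^sub>F s in at_left t. f s \<in> - S"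
    using f S by (intro topological_tendstoD) (auto simp: continuous_within)
  then obtain e where e: "e < t" "\<And>s. \<lbrakk>e < s; s < t\<rbrakk> \<Longrightarrow> f s \<notin> S"
    by (auto simp: eventually_at_left_field)
  show False
    by (rule AE_interval_contradiction[OF AE, of "max d e" t]) (use e t in auto)
qed

section \<open>Every multiplier measure has exactly one atom\<close>

lemma abs_integral_le:
  fixes f :: "real \<Rightarrow> real"
  assumes B: "0 \<le> B" and "a \<le> c" and f: "\<And>t. t \<in> {a<..c} \<Longrightarrow> \<bar>f t\<bar> \<le> B"
  shows "\<bar>integral {a..c} f\<bar> \<le> B * (c - a)"
proof (cases "f integrable_on {a..c}")
  case True
  then have "(f has_integral integral {a..c} f) (cbox a c)" by (simp add: integrable_integral)
  then have "((\<lambda>t. if t = a then 0 else f t) has_integral integral {a..c} f) (cbox a c)"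
    by (rule has_integral_spike[OF negligible_sing[of a], rotated]) auto
  then have "norm (integral {a..c} f) \<le> B * measure lborel (cbox a c)"
    by (rule has_integral_bound[OF B]) (use f B in auto)
  then show ?thesis using \<open>a \<le> c\<close> by simp
next
  case False
  then show ?thesis using assms by (simp add: not_integrable_integral)
qed

context sliding
begin

text \<open>
The trajectory touches the line only during the slide, so by complementary slackness \<open>d\<mu>\<close> is
carried by \<open>[t1, t2]\<close>.
\<close>

lemma off_boundary:
  assumes t: "0 \<le> t" "t < t1 \<or> t2 < t" "t \<le> T"
  shows "0 < \<eta> t - k * \<xi> t + b"
proof -
  consider "t < t1" | "t2 < t" "t \<le> t3" | "t3 \<le> t" using t by fastforce
  then show ?thesis
  proof cases
    case 1
    then have "0 < (t1 - t) * (1 - k * p + k * (t1 - t) / 2)"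
      using p k by (intro mult_pos_pos add_pos_nonneg) auto
    then show ?thesis using first_leg_gap[of t] 1 by simp
  next
    case 2
    have x: "\<xi> t = r\<^sup>2 - (\<eta> t)\<^sup>2 / 2"
      using bang_first_arc[of "-1" t t3 r] 2 by (simp add: third_leg)
    have eq: "\<eta> t - k * \<xi> t + b = k / 2 * (\<eta> t + 1 / k)\<^sup>2"
      unfolding x radius(2) tangent_const_def using k by (simp add: field_simps power2_eq_square)
    have "\<eta> t < - 1 / k"
      using 2 by (simp add: third_leg bang_y_def) (simp add: slide_switch_def)
    then have "0 < (\<eta> t + 1 / k)\<^sup>2" by simp
    then show ?thesis unfolding eq using k by (intro mult_pos_pos) auto
  next
    case 3
    have le: "- r \<le> \<eta> t" "\<eta> t \<le> 0" using 3 times t by (auto simp: third_leg bang_y_def slide_time_def)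
    have x: "\<xi> t = (\<eta> t)\<^sup>2 / 2"
      using bang_second_arc[of "-1" t3 t r] 3 times by (simp add: third_leg)
    have r2: "0 < - r - k * r\<^sup>2 / 2 + b"
    proof -
      have "b = k * r\<^sup>2 + 1 / (2 * k)"
        unfolding radius(2) tangent_const_def using k by (simp add: field_simps power2_eq_square)
      moreover have "- r - k * r\<^sup>2 / 2 + (k * r\<^sup>2 + 1 / (2 * k)) = k / 2 * (r - 1 / k)\<^sup>2"
        using k by (simp add: field_simps power2_eq_square)
      ultimately have eq: "- r - k * r\<^sup>2 / 2 + b = k / 2 * (r - 1 / k)\<^sup>2" by linarith
      have "0 < (r - 1 / k)\<^sup>2" using radius by simp
      then show ?thesis unfolding eq using k by (intro mult_pos_pos) auto
    qed
    have "\<eta> t - k * \<xi> t + b - (- r - k * r\<^sup>2 / 2 + b) = (\<eta> t + r) * (1 - k / 2 * (\<eta> t - r))"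
      unfolding x by (simp add: power2_eq_square field_simps)
    moreover have "k / 2 * (\<eta> t - r) \<le> 0"
      using k le radius_pos by (intro mult_nonneg_nonpos) auto
    then have "0 \<le> (\<eta> t + r) * (1 - k / 2 * (\<eta> t - r))"
      using le by (intro mult_nonneg_nonneg) auto
    ultimately show ?thesis using r2 by linarith
  qed
qed

lemma slide_y_middle:
  assumes "t \<in> {t1..t2}"
  shows "\<eta> t \<le> - p"
  using exp_range[OF assms] p second_leg(1)[OF assms] by simp

text \<open>
The mass of \<open>{s..<t}\<close> is \<open>(\<phi> t - \<phi> s) / k\<close>, and the atom at \<open>t\<close> is the limit of the masses of \<open>{t..<q}\<close> as
\<open>q\<close> decreases to \<open>t\<close>; so atoms can be read off from \<open>\<phi>\<close> and \<open>\<psi>\<close> to the right of \<open>t\<close>.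
\<close>

proposition multiplier_jump_unique:
  assumes t1: "0 < t1" and f: "follows T \<xi> \<eta> v T x y u"
    and mp: "maximum_principle k b T x y u \<phi> \<psi> \<mu>"
  shows "0 < jump T \<mu> t2" and "\<lbrakk>t \<in> {0..T}; jump T \<mu> t \<noteq> 0\<rbrakk> \<Longrightarrow> t = t2"
proof -
  define \<nu> where "\<nu> = stieltjes_measure T \<mu>"
  have T0: "0 \<le> T" using times by linarith
  have xy: "\<And>t. t \<in> {0..T} \<Longrightarrow> x t = \<xi> t \<and> y t = \<eta> t"
    and uv: "AE t in lebesgue_on {0..T}. u t = v t" using f by (auto simp: follows_def)
  have cont: "\<And>t. t \<in> {0<..T} \<Longrightarrow> continuous (at_left t) \<phi>" "\<And>t. t \<in> {0<..T} \<Longrightarrow> continuous (at_left t) \<psi>"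
    and nontriv: "\<not> (\<forall>t\<in>{0..T}. \<phi> t = 0 \<and> \<psi> t = 0)"
    and \<mu>: "mono_on {0..T} \<mu>"
    and d\<phi>: "\<And>s t. \<lbrakk>0 \<le> s; s \<le> t; t \<le> T\<rbrakk> \<Longrightarrow> \<phi> t - \<phi> s = k * measure \<nu> {s..<t}"
    and d\<psi>: "\<And>s t. \<lbrakk>0 \<le> s; s \<le> t; t \<le> T\<rbrakk> \<Longrightarrow> \<psi> t - \<psi> s = - integral {s..t} \<phi> - measure \<nu> {s..<t}"
    and slack: "AE t in \<nu>. t \<in> {0..T} \<longrightarrow> y t - k * x t + b = 0"
    and sgn: "AE t in lebesgue_on {0..T}.
        (\<psi> t > 0 \<longrightarrow> u t = 1) \<and> (\<psi> t < 0 \<longrightarrow> u t = - 1) \<and> (\<psi> t = 0 \<longrightarrow> u t \<in> {-1..1})"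
    using mp unfolding maximum_principle_def \<nu>_def by blast+
  obtain h where h: "0 \<le> h" "AE t in lebesgue_on {0..T}. \<phi> t * y t + \<psi> t * u t = h"
    using mp unfolding maximum_principle_def by blast
  have jump: "jump T \<mu> t = measure \<nu> {t}" for t
    unfolding \<nu>_def by (rule jump_eq_measure[OF T0 \<mu>])
  have jump_lim: "((\<lambda>q. measure \<nu> {t..<q}) \<longlongrightarrow> jump T \<mu> t) (at_right t)" for t
    unfolding \<nu>_def by (rule stieltjes_Ico_tendsto_jump[OF T0 \<mu>])
  have null: "measure \<nu> A = 0"
    if A: "A \<in> sets borel" "\<And>t. t \<in> A \<Longrightarrow> 0 \<le> t \<and> t \<le> T \<and> (t < t1 \<or> t2 < t)" for A
  proof -
    have "AE t in \<nu>. t \<notin> A" using slack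
    proof eventually_elim
      case (elim t)
      then show ?case using A(2)[of t] off_boundary[of t] xy[of t] by force
    qed
    then have "emeasure \<nu> A = 0"
      using A(1) by (subst (asm) AE_iff_measurable[of A]) (auto simp: \<nu>_def)
    then show ?thesis by (simp add: measure_def)
  qed
  have \<phi>1: "\<phi> t = \<phi> 0" if "t \<in> {0..t1}" for t
    using d\<phi>[of 0 t] null[of "{0..<t}"] that times by auto
  have \<phi>3: "\<phi> t = \<phi> T" if "t \<in> {t2<..T}" for t
    using d\<phi>[of t T] null[of "{t..<T}"] that times by auto
  have AE: "AE t in lebesgue_on {0..T}. \<phi> t * \<eta> t + \<psi> t * v t = h \<and> (\<psi> t > 0 \<longrightarrow> v t = 1) \<and> (\<psi> t < 0 \<longrightarrow> v t = - 1)"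
    using h(2) sgn uv AE_space[of "lebesgue_on {0..T}"]
    by eventually_elim (use xy in auto)
  have v_mid: "- 1 < v t \<and> v t < 1" if "t \<in> {t1<..<t2}" for t
  proof -
    have "exp (k * (t - t1)) < exp (k * (t2 - t1))" using that k by simp
    then have "k * p * exp (k * (t - t1)) < k * p * exp (k * (t2 - t1))"
      using k p by (intro mult_strict_left_mono) auto
    then have "k * p * exp (k * (t - t1)) < 1" using k p by (simp add: exp_end)
    moreover have "0 < k * p * exp (k * (t - t1))" using k p by simp
    moreover have "v t = - (k * p * exp (k * (t - t1)))" using that by (simp add: slide_u_def)
    ultimately show ?thesis by linarith
  qed
  \<comment> \<open>The control is in the open interval along the slide, so the switching function vanishes.\<close>
  have \<psi>2: "\<psi> t = 0" if "t \<in> {t1<..t2}" for t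
  proof -
    have "\<psi> t \<in> {0}"
    proof (rule left_continuous_AE_closed[OF cont(2)])
      show "AE s in lebesgue_on {0..T}. s \<in> {t1<..<t} \<longrightarrow> \<psi> s \<in> {0}" using AE
      proof eventually_elim
        case (elim s)
        show ?case
        proof
          assume "s \<in> {t1<..<t}"
          then show "\<psi> s \<in> {0}" using elim v_mid[of s] that by (cases "\<psi> s" "0 :: real" rule: linorder_cases) auto
        qed
      qed
    qed (use that times in auto)
    then show ?thesis by simp
  qed
  have \<phi>y: "\<phi> t * \<eta> t = h" if t: "t \<in> {t1<..t2}" for t
  proof -
    have "\<phi> t * \<eta> t \<in> {h}"
    proof (rule left_continuous_AE_closed[where f = "\<lambda>t. \<phi> t * \<eta> t"])
      have "continuous (at t within {..<t} \<inter> {0..T}) \<eta>"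
        using trajectoryD(4)[OF trajectory_slide[of 0 T]] t times
        by (auto simp: continuous_on_eq_continuous_within intro: continuous_within_subset)
      moreover have "at t within {..<t} \<inter> {0..T} = at_left t"
        by (rule at_within_nhd[of _ "{0<..<T + 1}"]) (use t times in auto)
      ultimately show "continuous (at_left t) (\<lambda>t. \<phi> t * \<eta> t)"
        using cont(1)[of t] t times by (intro continuous_mult) auto
      show "AE s in lebesgue_on {0..T}. s \<in> {t1<..<t} \<longrightarrow> \<phi> s * \<eta> s \<in> {h}"
        using AE by eventually_elim (use \<psi>2 t in auto)
    qed (use t times in auto)
    then show ?thesis by simp
  qed
  have v1: "v t = - 1" if "t \<in> {0<..<t1}" for t using that by (auto simp: slide_u_def)
  have \<psi>1: "\<psi> t1 \<le> 0"
  proof -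
    have "\<psi> t1 \<in> {..0}"
    proof (rule left_continuous_AE_closed[OF cont(2), where a=0 and c=T and d=0])
      show "AE s in lebesgue_on {0..T}. s \<in> {0<..<t1} \<longrightarrow> \<psi> s \<in> {..0}"
        using AE by eventually_elim (use v1 in fastforce)
    qed (use times t1 in auto)
    then show ?thesis by simp
  qed
  have v3: "v t = - 1" if "t \<in> {t2<..<t3}" for t using that times by (auto simp: slide_u_def bang_u_def)
  have v4: "v t = 1" if "t \<in> {t3<..<T}" for t using that times by (auto simp: slide_u_def bang_u_def)
  have \<psi>3: "\<psi> t3 \<le> 0"
  proof -
    have "\<psi> t3 \<in> {..0}"
    proof (rule left_continuous_AE_closed[OF cont(2), where a=0 and c=T and d=t2])
      show "AE s in lebesgue_on {0..T}. s \<in> {t2<..<t3} \<longrightarrow> \<psi> s \<in> {..0}"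
        using AE by eventually_elim (use v3 in fastforce)
    qed (use times in auto)
    then show ?thesis by simp
  qed
  have \<psi>4: "0 \<le> \<psi> T"
  proof -
    have "\<psi> T \<in> {0..}"
    proof (rule left_continuous_AE_closed[OF cont(2), where a=0 and c=T and d=t3])
      show "AE s in lebesgue_on {0..T}. s \<in> {t3<..<T} \<longrightarrow> \<psi> s \<in> {0..}"
        using AE by eventually_elim (use v4 in fastforce)
    qed (use times in auto)
    then show ?thesis by simp
  qed
  have \<eta>neg: "\<eta> t \<le> - p" "\<eta> t \<noteq> 0" if "t \<in> {t1..t2}" for t
    using slide_y_middle[OF that] p by auto
  have \<phi>2: "\<phi> t = h / \<eta> t" if "t \<in> {t1<..t2}" for t
    using \<phi>y[OF that] \<eta>neg[of t] that by (simp add: field_simps)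

  have jump_mid: "jump T \<mu> t = 0" if t: "t \<in> {t1<..<t2}" for t
  proof -
    have "isCont \<eta> t"
      using trajectoryD(4)[OF trajectory_slide[of 0 T]] t times
      by (intro continuous_on_interior[of "{0..T}"]) auto
    then have "((\<lambda>q. (h / \<eta> q - h / \<eta> t) / k) \<longlongrightarrow> (h / \<eta> t - h / \<eta> t) / k) (at_right t)"
      using \<eta>neg(2)[of t] t k unfolding isCont_def
      by (intro tendsto_intros) (auto intro: tendsto_within_subset)
    then have "((\<lambda>q. (h / \<eta> q - h / \<eta> t) / k) \<longlongrightarrow> 0) (at_right t)" by simp
    then have "((\<lambda>q. measure \<nu> {t..<q}) \<longlongrightarrow> 0) (at_right t)"
    proof (rule Lim_transform_eventually)
      have "\<forall>\<^sub>F q in at_right t. q \<in> {t<..<t2}"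
        using t by (intro eventually_at_right_real) auto
      then show "\<forall>\<^sub>F q in at_right t. (h / \<eta> q - h / \<eta> t) / k = measure \<nu> {t..<q}"
      proof eventually_elim
        case (elim q)
        then show ?case using d\<phi>[of t q] \<phi>2[of t] \<phi>2[of q] t times k by (simp add: field_simps)
      qed
    qed
    then show ?thesis using jump_lim tendsto_unique by (metis trivial_limit_at_right_real)
  qed
  \<comment> \<open>At \<open>N\<close> the mass of \<open>{t1..<q}\<close> is \<open>\<psi> t1 - \<integral> \<phi>\<close> with \<open>\<psi> t1 \<le> 0\<close> and \<open>|\<phi>| \<le> h / p\<close>.\<close>
  have jump1: "jump T \<mu> t1 = 0"
  proof (rule tendsto_unique[OF _ jump_lim])
    show "((\<lambda>q. measure \<nu> {t1..<q}) \<longlongrightarrow> 0) (at_right t1)"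
    proof (rule tendsto_sandwich[of "\<lambda>_. 0" _ _ "\<lambda>q. h / p * (q - t1)"])
      have "\<forall>\<^sub>F q in at_right t1. q \<in> {t1<..<t2}"
        using times by (intro eventually_at_right_real) auto
      then show "\<forall>\<^sub>F q in at_right t1. measure \<nu> {t1..<q} \<le> h / p * (q - t1)"
      proof eventually_elim
        case (elim q)
        have "\<bar>integral {t1..q} \<phi>\<bar> \<le> h / p * (q - t1)"
        proof (rule abs_integral_le)
          show "\<bar>\<phi> t\<bar> \<le> h / p" if "t \<in> {t1<..q}" for t
          proof -
            have t: "t \<in> {t1<..t2}" using that elim by auto
            then have "p \<le> \<bar>\<eta> t\<bar>" using \<eta>neg[of t] p by auto
            then have "h / \<bar>\<eta> t\<bar> \<le> h / p" using h p by (intro divide_left_mono) auto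
            then show ?thesis using h by (simp add: \<phi>2[OF t] abs_divide)
          qed
        qed (use h p elim in auto)
        moreover have "measure \<nu> {t1..<q} = \<psi> t1 - integral {t1..q} \<phi>"
          using d\<psi>[of t1 q] \<psi>2[of q] elim times by auto
        ultimately show ?case using \<psi>1 by linarith
      qed
      show "((\<lambda>q. h / p * (q - t1)) \<longlongrightarrow> 0) (at_right t1)"
        using p by (auto intro!: tendsto_eq_intros)
    qed (auto intro: always_eventually)
  qed simp
  show "t = t2" if "t \<in> {0..T}" "jump T \<mu> t \<noteq> 0"
  proof (rule ccontr)
    assume "t \<noteq> t2"
    then consider "t < t1 \<or> t2 < t" | "t = t1" | "t \<in> {t1<..<t2}" by fastforce
    then show False
    proof cases
      case 1 then show False using that null[of "{t}"] by (simp add: jump)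
    qed (use that jump1 jump_mid in auto)
  qed
  show "0 < jump T \<mu> t2"
  proof (rule ccontr)
    assume "\<not> 0 < jump T \<mu> t2"
    then have j0: "jump T \<mu> t2 = 0" by (simp add: jump not_less measure_le_0_iff)
    \<comment> \<open>Without an atom at \<open>C\<close>, \<open>\<phi>\<close> is constant and \<open>\<psi>\<close> linear on the closed interval from \<open>t2\<close> to \<open>T\<close>.\<close>
    have const: "measure \<nu> {t2..<q} = (\<phi> T - \<phi> t2) / k" if "q \<in> {t2<..T}" for q
      using d\<phi>[of t2 q] \<phi>3[OF that] that times k by (simp add: field_simps)
    have "((\<lambda>q. measure \<nu> {t2..<q}) \<longlongrightarrow> (\<phi> T - \<phi> t2) / k) (at_right t2)"
    proof (rule Lim_transform_eventually[OF tendsto_const])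
      have "\<forall>\<^sub>F q in at_right t2. q \<in> {t2<..<T}"
        using times by (intro eventually_at_right_real) auto
      then show "\<forall>\<^sub>F q in at_right t2. (\<phi> T - \<phi> t2) / k = measure \<nu> {t2..<q}"
        by eventually_elim (simp add: const)
    qed
    then have "(\<phi> T - \<phi> t2) / k = 0"
      using jump_lim[of t2] j0 tendsto_unique by (metis trivial_limit_at_right_real)
    then have \<phi>T: "\<phi> t2 = \<phi> T" using k by simp
    have \<psi>q: "\<psi> q = - \<phi> T * (q - t2)" if q: "q \<in> {t2<..T}" for q
    proof -
      have "integral {t2..q} \<phi> = integral {t2..q} (\<lambda>_. \<phi> T)"
      proof (rule integral_cong)
        show "\<phi> t = \<phi> T" if "t \<in> {t2..q}" for t
          using \<phi>3[of t] \<phi>T q that by (cases "t = t2") auto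
      qed
      also have "\<dots> = \<phi> T * (q - t2)" using q by simp
      finally show ?thesis
        using d\<psi>[of t2 q] \<psi>2[of t2] const[OF q] \<phi>T q times by simp
    qed
    \<comment> \<open>The sign of \<open>\<psi>\<close> at \<open>B\<close> and at the end leaves only \<open>\<phi> T = 0\<close>.\<close>
    have "0 \<le> \<phi> T * (t3 - t2)" using \<psi>3 \<psi>q[of t3] times by auto
    then have "0 \<le> \<phi> T" using times by (simp add: zero_le_mult_iff)
    moreover have "\<phi> T * (T - t2) \<le> 0" using \<psi>4 \<psi>q[of T] times by auto
    then have "\<phi> T \<le> 0" using times by (simp add: mult_le_0_iff)
    ultimately have \<phi>T0: "\<phi> T = 0" by simp
    then have h0: "h = 0" using \<phi>y[of t2] \<phi>T times by simp
    have \<phi>2z: "\<phi> t = 0" if "t \<in> {t1<..T}" for t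
      using \<phi>2[of t] \<phi>3[of t] h0 \<phi>T0 that by (cases "t \<le> t2") auto
    have \<psi>2z: "\<psi> t = 0" if "t \<in> {t1<..T}" for t
      using \<psi>2[of t] \<psi>q[of t] \<phi>T0 that by (cases "t \<le> t2") auto
    have const1: "measure \<nu> {t1..<q} = - \<phi> t1 / k" if "q \<in> {t1<..T}" for q
      using d\<phi>[of t1 q] \<phi>2z[OF that] that times k by (simp add: field_simps)
    have "((\<lambda>q. measure \<nu> {t1..<q}) \<longlongrightarrow> - \<phi> t1 / k) (at_right t1)"
    proof (rule Lim_transform_eventually[OF tendsto_const])
      have "\<forall>\<^sub>F q in at_right t1. q \<in> {t1<..<T}"
        using times by (intro eventually_at_right_real) auto
      then show "\<forall>\<^sub>F q in at_right t1. - \<phi> t1 / k = measure \<nu> {t1..<q}"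
        by eventually_elim (simp add: const1)
    qed
    then have "- \<phi> t1 / k = 0"
      using jump_lim[of t1] jump1 tendsto_unique by (metis trivial_limit_at_right_real)
    then have \<phi>t1: "\<phi> t1 = 0" using k by simp
    have zero: "\<phi> t = 0" if "t \<in> {0..T}" for t
      using \<phi>1[of t] \<phi>1[of t1] \<phi>t1 \<phi>2z[of t] that times by (cases "t \<le> t1") auto
    have "\<psi> t = 0" if t: "t \<in> {0..T}" for t
    proof -
      have "integral {t..T} \<phi> = integral {t..T} (\<lambda>_. 0)"
        by (rule integral_cong) (use zero t in auto)
      moreover have "measure \<nu> {t..<T} = 0" using d\<phi>[of t T] zero[of t] zero[of T] t k by simp
      moreover have "\<psi> T = 0" using \<psi>2z[of T] times by auto
      ultimately show ?thesis using d\<psi>[of t T] t by simp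
    qed
    then show False using zero nontriv by blast
  qed
qed

end

section \<open>Multipliers of the sliding trajectory\<close>

text \<open>
The multipliers, normalised so that \<open>\<phi> y + \<psi> u = 1\<close>. This determines \<open>\<phi> = 1 / y\<close> on the slide, hence
\<open>- 1 / p\<close> before it, and \<open>- 1 / tangent_radius\<close> after it (from \<open>\<psi> = 0\<close> at \<open>B\<close>). The values at
\<open>t1\<close> and \<open>slide_end\<close> are chosen so that both functions are continuous from the left.
\<close>

definition slide_phi :: "real \<Rightarrow> real \<Rightarrow> real \<Rightarrow> real \<Rightarrow> real \<Rightarrow> real" where
  "slide_phi k b p t1 t =
     (if t \<le> t1 then - 1 / p
      else if t \<le> slide_end k p t1 then - exp (- k * (t - t1)) / p
      else - 1 / tangent_radius k b)"

definition slide_psi :: "real \<Rightarrow> real \<Rightarrow> real \<Rightarrow> real \<Rightarrow> real \<Rightarrow> real" where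
  "slide_psi k b p t1 t =
     (if t \<le> t1 then - (t1 - t) / p
      else if t \<le> slide_end k p t1 then 0
      else - (slide_switch k b p t1 - t) / tangent_radius k b)"

text \<open>
From \<open>d\<phi> = k d\<mu>\<close> and \<open>\<mu> 0 = 0\<close>. The atom at \<open>slide_end\<close> is \<open>1 - 1 / (k tangent_radius)\<close>.
\<close>

definition slide_mu :: "real \<Rightarrow> real \<Rightarrow> real \<Rightarrow> real \<Rightarrow> real \<Rightarrow> real" where
  "slide_mu k b p t1 t = (slide_phi k b p t1 t + 1 / p) / k"

lemma continuous_at_left_transform:
  fixes f g :: "real \<Rightarrow> real"
  assumes "d < t" "\<And>s. \<lbrakk>d < s; s \<le> t\<rbrakk> \<Longrightarrow> f s = g s" "isCont g t"
  shows "continuous (at_left t) f"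
proof -
  have "(g \<longlongrightarrow> g t) (at_left t)"
    using assms(3) unfolding isCont_def by (rule tendsto_within_subset) simp
  then have "(f \<longlongrightarrow> g t) (at_left t)"
  proof (rule Lim_transform_eventually)
    show "\<forall>\<^sub>F s in at_left t. g s = f s"
      using eventually_at_left_real[OF assms(1)] by eventually_elim (use assms(2) in auto)
  qed
  then show ?thesis using assms(1,2) by (simp add: continuous_within)
qed

context sliding
begin

abbreviation "\<phi> \<equiv> slide_phi k b p t1"
abbreviation "\<psi> \<equiv> slide_psi k b p t1"
abbreviation "\<mu> \<equiv> slide_mu k b p t1"

lemma exp_neg_end: "exp (- k * (t2 - t1)) = k * p"
proof -
  have "exp (- k * (t2 - t1)) = inverse (exp (k * (t2 - t1)))" by (simp add: exp_minus)
  then show ?thesis by (simp add: exp_end)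
qed

lemma inverse_r: "1 / r < k"
  using radius k radius_pos by (simp add: field_simps)

lemma slide_phi_mono: "mono \<phi>"
proof (rule monoI)
  fix s t :: real assume st: "s \<le> t"
  have mid: "- 1 / p \<le> - exp (- k * (t - t1)) / p" "- exp (- k * (t - t1)) / p \<le> - k" if "t \<in> {t1..t2}" for t
  proof -
    have "exp (- k * (t - t1)) \<le> 1" using that k by simp
    then show "- 1 / p \<le> - exp (- k * (t - t1)) / p" using p by (intro divide_right_mono) auto
    have "exp (- k * (t2 - t1)) \<le> exp (- k * (t - t1))" using that k by simp
    then have "k * p \<le> exp (- k * (t - t1))" unfolding exp_neg_end .
    then show "- exp (- k * (t - t1)) / p \<le> - k" using p by (simp add: field_simps)
  qed
  have kr: "- k \<le> - 1 / r" using inverse_r by simp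
  have p_le: "- 1 / p \<le> - 1 / r" using mid[of t2] kr times by (force intro: order_trans)
  consider "t \<le> t1" | "s \<le> t1" "t1 < t" "t \<le> t2" | "s \<le> t1" "t2 < t"
    | "t1 < s" "t \<le> t2" | "t1 < s" "s \<le> t2" "t2 < t" | "t2 < s" by linarith
  then show "\<phi> s \<le> \<phi> t"
  proof cases
    case 2 then show ?thesis using mid(1)[of t] by (simp add: slide_phi_def)
  next
    case 3 then show ?thesis using p_le times by (simp add: slide_phi_def)
  next
    case 4
    have "exp (- k * (t - t1)) \<le> exp (- k * (s - t1))" using st k by simp
    then have "- exp (- k * (s - t1)) / p \<le> - exp (- k * (t - t1)) / p"
      using p by (intro divide_right_mono) auto
    then show ?thesis using 4 st by (simp add: slide_phi_def)
  next
    case 5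
    then show ?thesis using mid(2)[of s] kr times by (simp add: slide_phi_def)
  qed (use st times in \<open>auto simp: slide_phi_def\<close>)
qed

lemma slide_mu_mono: "mono \<mu>"
  unfolding slide_mu_def using k monoD[OF slide_phi_mono]
  by (intro monoI divide_right_mono) auto

lemma slide_phi_left_continuous: "continuous (at_left t) \<phi>"
proof -
  consider "t \<le> t1" | "t1 < t" "t \<le> t2" | "t2 < t" by linarith
  then show ?thesis
  proof cases
    case 1
    show ?thesis
      by (rule continuous_at_left_transform[of "t - 1" _ _ "\<lambda>_. - 1 / p"])
         (use 1 in \<open>auto simp: slide_phi_def\<close>)
  next
    case 2
    show ?thesis
      by (rule continuous_at_left_transform[of t1 _ _ "\<lambda>t. - exp (- k * (t - t1)) / p"])
         (use 2 p in \<open>auto simp: slide_phi_def intro!: continuous_intros\<close>)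
  next
    case 3
    show ?thesis
      by (rule continuous_at_left_transform[of t2 _ _ "\<lambda>_. - 1 / r"])
         (use 3 times in \<open>auto simp: slide_phi_def\<close>)
  qed
qed

lemma slide_mu_left_continuous: "continuous (at_left t) \<mu>"
  unfolding slide_mu_def using slide_phi_left_continuous k
  by (intro continuous_intros) auto

lemma slide_psi_left_continuous: "continuous (at_left t) \<psi>"
proof -
  consider "t \<le> t1" | "t1 < t" "t \<le> t2" | "t2 < t" by linarith
  then show ?thesis
  proof cases
    case 1
    show ?thesis
      by (rule continuous_at_left_transform[of "t - 1" _ _ "\<lambda>t. - (t1 - t) / p"])
         (use 1 p in \<open>auto simp: slide_psi_def intro!: continuous_intros\<close>)
  next
    case 2
    show ?thesis
      by (rule continuous_at_left_transform[of t1 _ _ "\<lambda>_. 0"])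
         (use 2 in \<open>auto simp: slide_psi_def\<close>)
  next
    case 3
    show ?thesis
      by (rule continuous_at_left_transform[of t2 _ _ "\<lambda>t. - (t3 - t) / r"])
         (use 3 radius_pos times in \<open>auto simp: slide_psi_def intro!: continuous_intros\<close>)
  qed
qed

lemma slide_psi_bounded_variation: "bounded_variation_on 0 T \<psi>"
proof -
  \<comment> \<open>A nondecreasing continuous part minus a step function.\<close>
  let ?f = "\<lambda>t. max 0 (t - t2) / r - max 0 (t1 - t) / p"
  let ?g = "\<lambda>t. if t \<le> t2 then 0 else 1 - 1 / (k * r)"
  have "1 / (k * r) < 1" using inverse_r k radius_pos by (simp add: field_simps)
  then have g: "bounded_variation_on 0 T ?g"
    using times by (intro bounded_variation_mono_on) (auto intro!: mono_onI)
  have f: "bounded_variation_on 0 T ?f"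
    using times p radius_pos by (intro bounded_variation_mono_on mono_onI diff_mono divide_right_mono) auto
  have "\<psi> t = ?f t - ?g t" for t
    using times k radius_pos by (auto simp: slide_psi_def slide_switch_def max_def diff_divide_distrib add_divide_distrib)
  then show ?thesis by (rule bounded_variation_diff[OF f g])
qed

lemma slide_phi_has_integral:
  assumes "s \<le> t"
  shows "(\<phi> has_integral (\<psi> s + \<mu> s - (\<psi> t + \<mu> t))) {s..t}"
proof -
  \<comment> \<open>The function \<open>- (\<psi> + \<mu>)\<close>, written so that its continuity at \<open>t1\<close> and \<open>t2\<close> is evident:
      the jumps of \<open>\<psi>\<close> and \<open>\<mu>\<close> cancel.\<close>
  define W where "W t = max 0 (t1 - t) / p + (exp (- k * (max t1 (min t t2) - t1)) / p - 1 / p) / k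
      - max 0 (t - t2) / r" for t
  have W: "W t = - (\<psi> t + \<mu> t)" for t
  proof -
    consider "t \<le> t1" | "t1 < t" "t \<le> t2" | "t2 < t" by linarith
    then show ?thesis
    proof cases
      case 1
      then show ?thesis using times k p
        by (simp add: W_def slide_psi_def slide_mu_def slide_phi_def field_simps)
    next
      case 2
      then show ?thesis using k p
        by (simp add: W_def slide_psi_def slide_mu_def slide_phi_def field_simps)
    next
      case 3
      have m: "max t1 (min t t2) = t2" using 3 times by auto
      have "W t = (k - 1 / p) / k - (t - t2) / r"
        unfolding W_def m exp_neg_end using 3 times p by simp
      also have "\<dots> = - (\<psi> t + \<mu> t)"
        using 3 times k p radius_pos
        by (simp add: slide_psi_def slide_mu_def slide_phi_def slide_switch_def field_simps)
      finally show ?thesis .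
    qed
  qed
  have "(\<phi> has_integral (W t - W s)) {s..t}"
  proof (rule fundamental_theorem_of_calculus_interior_strong[of "{t1, t2}"])
    show "continuous_on {s..t} W"
      unfolding W_def using p k radius_pos by (intro continuous_intros) auto
    fix q assume "q \<in> {s<..<t} - {t1, t2}"
    then consider "q < t1" | "t1 < q" "q < t2" | "t2 < q" by fastforce
    then have "(W has_real_derivative \<phi> q) (at q)"
    proof cases
      case 1
      show ?thesis
        by (rule has_field_derivative_transform_within_open[of "\<lambda>q. (t1 - q) / p" _ _ "{..<t1}"])
           (use 1 times p k in \<open>auto simp: W_def slide_phi_def intro!: derivative_eq_intros\<close>)
    next
      case 2
      show ?thesis
        by (rule has_field_derivative_transform_within_open[of "\<lambda>q. (exp (- k * (q - t1)) / p - 1 / p) / k" _ _ "{t1<..<t2}"])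
           (use 2 times p k in \<open>auto simp: W_def slide_phi_def intro!: derivative_eq_intros\<close>)
    next
      case 3
      show ?thesis
        by (rule has_field_derivative_transform_within_open[of "\<lambda>q. (exp (- k * (t2 - t1)) / p - 1 / p) / k - (q - t2) / r" _ _ "{t2<..}"])
           (use 3 times p k radius_pos in \<open>auto simp: W_def slide_phi_def intro!: derivative_eq_intros\<close>)
    qed
    then show "(W has_vector_derivative \<phi> q) (at q)"
      by (simp add: has_real_derivative_iff_has_vector_derivative)
  qed (use assms in auto)
  then show ?thesis by (simp add: W algebra_simps)
qed

lemma slide_hamiltonian:
  assumes "t \<noteq> t1" "t \<noteq> t2" "t \<noteq> t3"
  shows "\<phi> t * \<eta> t + \<psi> t * v t = 1"
proof -
  consider "t < t1" | "t1 < t" "t < t2" | "t2 < t" "t < t3" | "t3 < t"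
    using assms by linarith
  then show ?thesis
  proof cases
    case 1
    then show ?thesis using p by (simp add: slide_phi_def slide_psi_def slide_y_def slide_u_def field_simps)
  next
    case 2
    have "exp (- k * (t - t1)) * exp (k * (t - t1)) = 1" by (simp flip: exp_add)
    then show ?thesis using 2 p by (simp add: slide_phi_def slide_psi_def slide_y_def slide_u_def)
  next
    case 3
    then show ?thesis using times radius_pos
      by (simp add: slide_phi_def slide_psi_def third_leg bang_y_def slide_u_def bang_u_def field_simps)
  next
    case 4
    then show ?thesis using times radius_pos
      by (simp add: slide_phi_def slide_psi_def third_leg bang_y_def slide_u_def bang_u_def field_simps)
  qed
qed

lemma slide_control_sign:
  assumes "t \<noteq> t1" "t \<noteq> t2" "t \<noteq> t3"
  shows "(\<psi> t > 0 \<longrightarrow> v t = 1) \<and> (\<psi> t < 0 \<longrightarrow> v t = - 1) \<and> (\<psi> t = 0 \<longrightarrow> v t \<in> {-1..1})"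
proof -
  consider "t < t1" | "t1 < t" "t < t2" | "t2 < t" "t < t3" | "t3 < t"
    using assms by linarith
  then show ?thesis
  proof cases
    case 1
    then have "\<psi> t < 0" "v t = - 1" using p by (auto simp: slide_psi_def slide_u_def field_simps)
    then show ?thesis by simp
  next
    case 2
    have "0 \<le> k * p * exp (k * (t - t1))" using k p by simp
    then show ?thesis using 2 exp_range(2)[of t]
      by (auto simp: slide_psi_def slide_u_def mult.assoc)
  next
    case 3
    then have "\<psi> t < 0" "v t = - 1" using times radius_pos
      by (auto simp: slide_psi_def slide_u_def bang_u_def divide_neg_pos)
    then show ?thesis by simp
  next
    case 4
    then have "\<psi> t > 0" "v t = 1" using times radius_pos
      by (auto simp: slide_psi_def slide_u_def bang_u_def)
    then show ?thesis by simp
  qed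
qed

proposition maximum_principle_slide:
  assumes f: "follows T \<xi> \<eta> v T x y u"
  shows "maximum_principle k b T x y u \<phi> \<psi> \<mu>"
proof -
  have T0: "0 \<le> T" using times by linarith
  have xy: "\<And>t. t \<in> {0..T} \<Longrightarrow> x t = \<xi> t \<and> y t = \<eta> t"
    and uv: "AE t in lebesgue_on {0..T}. u t = v t" using f by (auto simp: follows_def)
  have mono: "mono_on {0..T} \<mu>" using slide_mu_mono by (rule mono_on_subset) simp
  let ?\<nu> = "stieltjes_measure T \<mu>"
  have Ico: "emeasure ?\<nu> {s..<t} = ennreal (\<mu> t - \<mu> s)" if "0 \<le> s" "s \<le> t" "t \<le> T" for s t
    by (rule stieltjes_measure_left_continuous[OF T0 mono slide_mu_left_continuous that])
  have Ico': "measure ?\<nu> {s..<t} = \<mu> t - \<mu> s" if "0 \<le> s" "s \<le> t" "t \<le> T" for s t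
    using Ico[OF that] monoD[OF slide_mu_mono that(2)] by (simp add: measure_def)
  have off: "AE t in lebesgue_on {0..T}. t \<noteq> t1 \<and> t \<noteq> t2 \<and> t \<noteq> t3"
    unfolding AE_lebesgue_on_interval_iff
    by (rule negligible_subset[of "{t1, t2, t3}"]) (auto intro: negligible_finite)
  have "bounded_variation_on 0 T \<phi>"
    using slide_phi_mono T0 by (intro bounded_variation_mono_on) (auto intro: mono_on_subset)
  moreover have "\<phi> 0 \<noteq> 0" using t1 p by (simp add: slide_phi_def)
  moreover have "\<mu> 0 = 0" using t1 by (simp add: slide_mu_def slide_phi_def)
  moreover have "\<phi> t - \<phi> s = k * measure ?\<nu> {s..<t}" if "0 \<le> s" "s \<le> t" "t \<le> T" for s t
    unfolding Ico'[OF that] using k by (simp add: slide_mu_def field_simps)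
  moreover have "\<psi> t - \<psi> s = - integral {s..t} \<phi> - measure ?\<nu> {s..<t}" if "0 \<le> s" "s \<le> t" "t \<le> T" for s t
    unfolding Ico'[OF that] integral_unique[OF slide_phi_has_integral[OF that(2)]] by simp
  moreover have "AE t in ?\<nu>. t \<in> {0..T} \<longrightarrow> y t - k * x t + b = 0"
  proof (rule AE_I[of _ _ "{0..<t1} \<union> {t2<..T}"])
    have "emeasure ?\<nu> {t2<..T} = 0"
    proof (rule stieltjes_measure_Ioc_eq_0[OF T0 mono])
      show "\<mu> t = (- 1 / r + 1 / p) / k" if "t \<in> {t2<..T}" for t
        using that times by (simp add: slide_mu_def slide_phi_def)
    qed (use times in auto)
    moreover have "emeasure ?\<nu> {0..<t1} = 0"
      using Ico[of 0 t1] times by (simp add: slide_mu_def slide_phi_def)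
    ultimately have "{0..<t1} \<in> null_sets ?\<nu>" "{t2<..T} \<in> null_sets ?\<nu>" by auto
    then have "{0..<t1} \<union> {t2<..T} \<in> null_sets ?\<nu>" by (rule null_sets.Un)
    then show "emeasure ?\<nu> ({0..<t1} \<union> {t2<..T}) = 0" by auto
    show "{t \<in> space ?\<nu>. \<not> (t \<in> {0..T} \<longrightarrow> y t - k * x t + b = 0)} \<subseteq> {0..<t1} \<union> {t2<..T}"
    proof
      fix t assume t: "t \<in> {t \<in> space ?\<nu>. \<not> (t \<in> {0..T} \<longrightarrow> y t - k * x t + b = 0)}"
      have "t \<notin> {t1..t2}"
      proof
        assume "t \<in> {t1..t2}"
        then have "\<eta> t - k * \<xi> t + b = 0" using second_leg(2)[of t] k by simp
        then show False using t xy[of t] by auto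
      qed
      then show "t \<in> {0..<t1} \<union> {t2<..T}" using t by auto
    qed
  qed auto
  moreover have "AE t in lebesgue_on {0..T}. \<phi> t * y t + \<psi> t * u t = 1"
    using uv off AE_space[of "lebesgue_on {0..T}"]
    by eventually_elim (use slide_hamiltonian xy in auto)
  moreover have "AE t in lebesgue_on {0..T}.
        (\<psi> t > 0 \<longrightarrow> u t = 1) \<and> (\<psi> t < 0 \<longrightarrow> u t = - 1) \<and> (\<psi> t = 0 \<longrightarrow> u t \<in> {-1..1})"
    using uv off by eventually_elim (use slide_control_sign in auto)
  ultimately show ?thesis
    unfolding maximum_principle_def
    using slide_psi_bounded_variation mono slide_phi_left_continuous slide_psi_left_continuous T0
    by (intro conjI allI impI ballI) (auto intro: exI[of _ "1::real"])
qed

proposition type_NNCBO_slide: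
  assumes t1: "0 < t1" and f: "follows T \<xi> \<eta> v T x y u"
  shows "type_NNCBO k b T x y u t1 t2 t3"
proof -
  have xy: "x t = \<xi> t" "y t = \<eta> t" if "t \<in> {0..T}" for t
    using f that by (auto simp: follows_def)
  have leg: "AE t in lebesgue_on {a..c}. u t = w t"
    if "0 \<le> a" "c \<le> T" "\<And>t. t \<in> {a<..<c} \<Longrightarrow> v t = w t" for a c w
  proof -
    have "AE t in lebesgue_on {a..c}. u t = v t"
      by (rule AE_lebesgue_on_subinterval[OF _ that(1,2)]) (use f in \<open>simp add: follows_def\<close>)
    moreover have "AE t in lebesgue_on {a..c}. t \<noteq> a \<and> t \<noteq> c"
      unfolding AE_lebesgue_on_interval_iff
      by (rule negligible_subset[of "{a, c}"]) auto
    moreover note AE_space[of "lebesgue_on {a..c}"]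
    ultimately show ?thesis by eventually_elim (use that(3) in auto)
  qed
  have N: "(\<xi> t1, \<eta> t1) \<in> open_segment (point_C k b) (point_E k b)"
    unfolding open_segment_CE_iff[OF k] using p times second_leg[of t1] by (intro exI[of _ p]) simp
  have C: "(\<xi> t2, \<eta> t2) = point_C k b"
    using second_leg(2)[of t2] times k by (simp add: corner point_C_def field_simps power2_eq_square)
  have B: "(\<xi> t3, \<eta> t3) = point_B k b"
    using third_leg[of t3] times
    by (simp add: bang_x_def bang_y_def point_B_def radius(2) flip: tangent_radius_def)
  show ?thesis
    unfolding type_NNCBO_def
  proof (intro conjI ballI)
    show "AE t in lebesgue_on {0..t1}. u t = - 1"
      by (rule leg) (use times in \<open>auto simp: slide_u_def\<close>)
    show "AE t in lebesgue_on {t1..t2}. u t = k * y t"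
    proof -
      have "AE t in lebesgue_on {t1..t2}. u t = k * \<eta> t"
        by (rule leg) (use times in \<open>auto simp: slide_u_def slide_y_def\<close>)
      then show ?thesis by (rule lebesgue_on_mono) (use times xy in auto)
    qed
    show "AE t in lebesgue_on {t2..t3}. u t = - 1"
      by (rule leg) (use times in \<open>auto simp: slide_u_def bang_u_def\<close>)
    show "AE t in lebesgue_on {t3..T}. u t = 1"
      by (rule leg) (use times in \<open>auto simp: slide_u_def bang_u_def\<close>)
    show "(x t, y t) \<in> boundary_line k b" if "t \<in> {t1..t2}" for t
      using second_leg(2)[OF that] that times k by (simp add: xy boundary_line_def)
  qed (use t1 times N C B finish in \<open>auto simp: xy\<close>)
qed

end

section \<open>The optimal synthesis\<close>

theorem theorem1:
  fixes k b :: real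
  assumes "k > 0" and "b > 0"
    and "snd (point_C k b) > snd (point_A k b)"
  shows
    "(\<forall>P \<in> Omega1 k b.
        (\<exists>T x y u. constrained_optimal k b P T x y u) \<and>
        (\<forall>T x y u. constrained_optimal k b P T x y u \<longleftrightarrow> free_optimal P T x y u))
     \<and>
     (\<forall>P \<in> interior (Omega2 k b).
        (\<exists>T x y u. constrained_optimal k b P T x y u) \<and>
        (\<forall>T x y u. constrained_optimal k b P T x y u \<longrightarrow>
           (\<exists>t1 t2 t3. type_NNCBO k b T x y u t1 t2 t3 \<and>
              (\<exists>\<phi> \<psi> \<mu>. maximum_principle k b T x y u \<phi> \<psi> \<mu>) \<and>
              (\<forall>\<phi> \<psi> \<mu>. maximum_principle k b T x y u \<phi> \<psi> \<mu> \<longrightarrow>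
                 jump T \<mu> t2 > 0 \<and> (\<forall>t\<in>{0..T}. jump T \<mu> t \<noteq> 0 \<longrightarrow> t = t2)))))
     \<and>
     (\<forall>P \<in> open_segment (point_C k b) (point_E k b).
        (\<exists>T x y u. constrained_optimal k b P T x y u) \<and>
        (\<forall>T x y u. constrained_optimal k b P T x y u \<longleftrightarrow>
           (\<exists>P' \<in> interior (Omega2 k b). \<exists>T' x' y' u' \<tau>.
              constrained_optimal k b P' T' x' y' u' \<and>
              0 < \<tau> \<and> \<tau> \<le> T' \<and> (AE t in lebesgue_on {0..\<tau>}. u' t = - 1) \<and>
              (x' \<tau>, y' \<tau>) = P \<and>
              is_tail \<tau> T' x' y' u' T x y u)))"
proof -
  have kb: "3 / 2 < k * b" using assms C_above_A_iff by blast
  show ?thesis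
  proof (intro conjI ballI)
    fix P assume P: "P \<in> interior (Omega2 k b)"
    then obtain p t1 where sl: "sliding k b p t1" and t1_pos: "0 < t1"
      and P_eq: "P = (slide_x k b p t1 0, slide_y k b p t1 0)"
      using interior_Omega2_slide[OF assms(1) kb] by blast
    interpret sliding k b p t1 by (rule sl)
    note iff = constrained_optimal_iff_follows[folded P_eq]
    show "\<exists>T x y u. constrained_optimal k b P T x y u"
      unfolding iff by (intro exI) (rule follows_refl)
    show "\<forall>T x y u. constrained_optimal k b P T x y u \<longrightarrow>
           (\<exists>t1 t2 t3. type_NNCBO k b T x y u t1 t2 t3 \<and>
              (\<exists>\<phi> \<psi> \<mu>. maximum_principle k b T x y u \<phi> \<psi> \<mu>) \<and>
              (\<forall>\<phi> \<psi> \<mu>. maximum_principle k b T x y u \<phi> \<psi> \<mu> \<longrightarrow>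
                 jump T \<mu> t2 > 0 \<and> (\<forall>t\<in>{0..T}. jump T \<mu> t \<noteq> 0 \<longrightarrow> t = t2)))"
    proof (intro allI impI)
      fix T' x y u
      assume "constrained_optimal k b P T' x y u"
      then have "T' = T" and f: "follows T \<xi> \<eta> v T x y u"
        unfolding iff by (auto simp: follows_def)
      then show "\<exists>t1 t2 t3. type_NNCBO k b T' x y u t1 t2 t3 \<and>
              (\<exists>\<phi> \<psi> \<mu>. maximum_principle k b T' x y u \<phi> \<psi> \<mu>) \<and>
              (\<forall>\<phi> \<psi> \<mu>. maximum_principle k b T' x y u \<phi> \<psi> \<mu> \<longrightarrow>
                 jump T' \<mu> t2 > 0 \<and> (\<forall>t\<in>{0..T'}. jump T' \<mu> t \<noteq> 0 \<longrightarrow> t = t2))"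
        using type_NNCBO_slide[OF t1_pos f] maximum_principle_slide[OF f] multiplier_jump_unique[OF t1_pos f]
        by blast
    qed
  qed (use Omega1_synthesis[OF assms(1,2)] boundary_synthesis[OF assms(1) kb] in blast)+
qed

end
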